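(* For $2\le N\le 11$ and every real $x>z_N$ there exists $\theta$ with $|\theta|\le1$ such that \[ \frac{\operatorname{ali}(e^x)}{xe^x}=1+\sum_{n=1}^N\frac{P_{n-1}(\log x)}{x^n}+\theta\cdot20\cdot\Bigl(\frac{N}{e\log N}\Bigr)^N\frac{\log^Nx}{x^{N+1}}, \] where $z_2=1.50$, $z_3=2.34$, $z_4=3.32$, $z_5=4.33$, $z_6=5.36$, $z_7=6.39$, $z_8=7.43$, $z_9=8.46$, $z_{10}=9.50$, $z_{11}=10.53$.
   Context: $\operatorname{li}(x)=\mathrm{p.v.}\int_0^x\frac{dt}{\log t}$ for real $x>1$, and $\operatorname{ali}\colon\mathbb{R}\to(1,\infty)$ is its inverse function. The polynomials $P_n(y)$ are defined by $P_0(y)=y-1$ and, for $n\ge1$, $P_n=nP_{n-1}-P'_{n-1}+\frac{1}{n}\sum_{k=1}^{n-1}k\{(k-1)P_{k-1}-P_k-P'_{k-1}\}P_{n-k-1}$ (primes denote derivatives). *)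

theory Defs
  imports "HOL-Analysis.Analysis" "HOL-Computational_Algebra.Polynomial"
begin

definition li :: "real \<Rightarrow> real" where
  "li x = Lim (at_right 0)
     (\<lambda>\<epsilon>. integral {0..1-\<epsilon>} (\<lambda>t. 1 / ln t) + integral {1+\<epsilon>..x} (\<lambda>t. 1 / ln t))"

definition ali :: "real \<Rightarrow> real" where
  "ali y = (THE x. x > 1 \<and> li x = y)"

text \<open>The polynomials P_n. Pn (Suc m) is P_n with n = m+1; the sum runs over k = 1..n-1 = 1..m
  and P_{n-k-1} = P_{m-k}.\<close>
function Pn :: "nat \<Rightarrow> real poly" where
  "Pn 0 = [:-1, 1:]"
| "Pn (Suc m) = smult (real (Suc m)) (Pn m) - pderiv (Pn m)
     + smult (1 / real (Suc m))
         (\<Sum>k\<in>{1..m}. smult (real k)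
            (smult (real (k - 1)) (Pn (k - 1)) - Pn k - pderiv (Pn (k - 1))) * Pn (m - k))"
  by pat_completeness auto
termination
  by (relation "Wellfounded.measure id") auto

definition zN :: "nat \<Rightarrow> real" where
  "zN N = [1.50, 2.34, 3.32, 4.33, 5.36, 6.39, 7.43, 8.46, 9.50, 10.53] ! (N - 2)"

end

theory Submission
  imports Defs "HOL-Real_Asymp.Real_Asymp"
begin

text \<open>
  Put \<open>a(x) = ali (exp x)\<close>, so that \<open>a' = exp x * ln a\<close>. A barrier
  \<open>x * exp x * u(x)\<close> lies above (below) the solution for \<open>x \<ge> x\<^sub>0\<close> if it does so at \<open>x\<^sub>0\<close>
  and \<open>ln u \<le> D\<close> (\<open>ln u \<ge> D\<close>), where \<open>D = u + x * (u - 1) + x * u' - ln x\<close>.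
  For \<open>u\<close> equal to the truncated expansion plus a multiple of \<open>ln\<^sup>N x / x\<^sup>N\<^sup>+\<^sup>1\<close>, both \<open>u\<close> and \<open>D\<close>
  are polynomials in \<open>y = ln x\<close> and \<open>v = 1 / x\<close>. Treating these as independent variables,
  \<open>u * exp (- D)\<close> is \<open>1\<close> at \<open>v = 0\<close>, so it suffices to know the sign of the polynomial
  \<open>M = u * \<partial>D / \<partial>v - \<partial>u / \<partial>v\<close> for \<open>0 \<le> v \<le> exp (- y)\<close>. By the choice of the \<open>P\<^sub>n\<close>, \<open>M\<close> is
  divisible by \<open>v\<^sup>N\<^sup>-\<^sup>1\<close>, and the sign of the quotient is decided by interval arithmetic in
  \<open>1 / y\<close> and \<open>y * v\<close>.

  The upper barrier works from \<open>z\<^sub>N\<close> on. The lower one works only further out. In between, for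
  \<open>N \<ge> 4\<close>, the multiple of \<open>ln\<^sup>N x\<close> is replaced by a linear function of \<open>ln x\<close>, and for \<open>N \<le> 6\<close>
  the lower bound for \<open>N + 1\<close> implies the one for \<open>N\<close> beyond \<open>z\<^sub>N\<^sub>+\<^sub>1\<close>. The values at \<open>z\<^sub>N\<close> come from
  \<open>li (exp b) = ln b + \<Sum> b\<^sup>k / (k * k!) - L\<close> with rational bounds on the constant \<open>L\<close>, which
  is minus Euler's constant.
\<close>

section \<open>The logarithmic integral\<close>

definition Gser :: "real \<Rightarrow> real" where
  "Gser u = (\<Sum>k. (if k = 0 then 0 else 1 / (real k * fact k)) * u ^ k)"

text \<open>The exponential integral Ei on both half-lines, up to its additive constant;
  \<open>Gser u\<close> is its entire part, the integral of \<open>(exp t - 1) / t\<close> from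
  \<open>0\<close> to \<open>u\<close>.\<close>

definition Ei0 :: "real \<Rightarrow> real" where
  "Ei0 u = ln \<bar>u\<bar> + Gser u"

lemma Gser_summable: "summable (\<lambda>k. (if k = 0 then 0 else 1 / (real k * fact k)) * u ^ k)"
  for u :: real
proof (rule summable_comparison_test)
  have "summable (\<lambda>k. inverse (fact k) * \<bar>u\<bar> ^ k)"
    by (rule summable_exp)
  then show "summable (\<lambda>k. inverse (fact k) * \<bar>u\<bar> ^ k :: real)" .
  show "\<exists>N. \<forall>n\<ge>N. norm ((if n = 0 then 0 else 1 / (real n * fact n)) * u ^ n)
      \<le> inverse (fact n) * \<bar>u\<bar> ^ n"
  proof (intro exI allI impI)
    fix n :: nat
    have "1 / (real n * fact n) \<le> inverse (fact n)" if "n > 0"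
      using that by (simp add: field_simps)
    then show "norm ((if n = 0 then 0 else 1 / (real n * fact n)) * u ^ n)
      \<le> inverse (fact n) * \<bar>u\<bar> ^ n"
      using mult_left_mono[of "1 / (real n * fact n)" "inverse (fact n)" "\<bar>u\<bar> ^ n"]
      by (auto simp: abs_mult power_abs mult.commute)
  qed
qed

lemma exp_shifted_series:
  fixes u :: real
  shows "u * (\<Sum>n. u ^ n / fact (Suc n)) = exp u - 1"
    and "summable (\<lambda>n. u ^ n / fact (Suc n))"
proof -
  show s: "summable (\<lambda>n. u ^ n / fact (Suc n))"
  proof (rule summable_comparison_test)
    show "summable (\<lambda>k. inverse (fact k) * \<bar>u\<bar> ^ k)"
      by (rule summable_exp)
    show "\<exists>N. \<forall>n\<ge>N. norm (u ^ n / fact (Suc n)) \<le> inverse (fact n) * \<bar>u\<bar> ^ n"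
    proof (intro exI allI impI)
      fix n :: nat
      have "(fact n :: real) \<le> fact (Suc n)" by (rule fact_mono) auto
      then have "inverse (fact (Suc n)) \<le> (inverse (fact n) :: real)"
        by (intro le_imp_inverse_le) auto
      then have "\<bar>u\<bar> ^ n * inverse (fact (Suc n)) \<le> \<bar>u\<bar> ^ n * inverse (fact n)"
        by (intro mult_left_mono) auto
      then show "norm (u ^ n / fact (Suc n)) \<le> inverse (fact n) * \<bar>u\<bar> ^ n"
        by (simp add: power_abs field_simps del: fact_Suc)
    qed
  qed
  have "exp u = (\<Sum>n. u ^ n /\<^sub>R fact n)" by (simp add: exp_def)
  also have "\<dots> = (\<Sum>n. u ^ Suc n /\<^sub>R fact (Suc n)) + 1"
    using suminf_split_head[OF summable_exp_generic[of u]] by simp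
  also have "(\<Sum>n. u ^ Suc n /\<^sub>R fact (Suc n)) = (\<Sum>n. u * (u ^ n / fact (Suc n)))"
    by (intro suminf_cong) (simp add: field_simps del: fact_Suc)
  also have "\<dots> = u * (\<Sum>n. u ^ n / fact (Suc n))"
    by (rule suminf_mult[OF s])
  finally show "u * (\<Sum>n. u ^ n / fact (Suc n)) = exp u - 1" by simp
qed

lemma Gser_has_derivative:
  assumes "u \<noteq> 0"
  shows "(Gser has_real_derivative (exp u - 1) / u) (at u)"
proof -
  let ?c = "\<lambda>k. if k = 0 then 0 else 1 / (real k * fact k) :: real"
  have "(Gser has_real_derivative (\<Sum>n. diffs ?c n * u ^ n)) (at u)"
    unfolding Gser_def[abs_def]
    by (rule termdiffs_strong_converges_everywhere) (rule Gser_summable)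
  also have "(\<lambda>n. diffs ?c n * u ^ n) = (\<lambda>n. u ^ n / fact (Suc n))"
    by (simp add: diffs_def fun_eq_iff del: of_nat_Suc fact_Suc)
  also have "(\<Sum>n. u ^ n / fact (Suc n)) = (exp u - 1) / u"
    using exp_shifted_series(1)[of u] assms by (simp add: field_simps del: fact_Suc)
  finally show ?thesis .
qed

lemma isCont_Gser: "isCont Gser u"
proof -
  let ?c = "\<lambda>k. if k = 0 then 0 else 1 / (real k * fact k) :: real"
  have "(Gser has_real_derivative (\<Sum>n. diffs ?c n * u ^ n)) (at u)"
    unfolding Gser_def[abs_def]
    by (rule termdiffs_strong_converges_everywhere) (rule Gser_summable)
  then show ?thesis by (rule DERIV_isCont)
qed

lemma Ei0_has_derivative:
  assumes "u \<noteq> 0"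
  shows "(Ei0 has_real_derivative exp u / u) (at u)"
proof -
  have l: "((\<lambda>u. ln \<bar>u\<bar>) has_real_derivative 1 / u) (at u)"
  proof (cases "u > 0")
    case True
    have "((\<lambda>u. ln u) has_real_derivative 1 / u) (at u)"
      using True by (auto intro!: derivative_eq_intros)
    then show ?thesis
      by (rule DERIV_cong_ev[THEN iffD1, rotated -1])
         (use True in \<open>auto simp: eventually_nhds intro!: exI[of _ "{0<..}"]\<close>)
  next
    case False
    then have "u < 0" using assms by simp
    have "((\<lambda>u. ln (- u)) has_real_derivative 1 / u) (at u)"
      using \<open>u < 0\<close> by (auto intro!: derivative_eq_intros simp: divide_simps)
    then show ?thesis
      by (rule DERIV_cong_ev[THEN iffD1, rotated -1])
         (use \<open>u < 0\<close> in \<open>auto simp: eventually_nhds intro!: exI[of _ "{..<0}"]\<close>)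
  qed
  have "((\<lambda>u. ln \<bar>u\<bar> + Gser u) has_real_derivative 1 / u + (exp u - 1) / u) (at u)"
    by (intro DERIV_add l Gser_has_derivative assms)
  moreover have "1 / u + (exp u - 1) / u = exp u / u"
    by (simp add: diff_divide_distrib)
  ultimately show ?thesis unfolding Ei0_def[abs_def] by simp
qed

lemma inverse_ln_has_integral_Ei0:
  assumes "0 < a" "a \<le> b" "b < 1 \<or> 1 < a"
  shows "((\<lambda>t. 1 / ln t) has_integral Ei0 (ln b) - Ei0 (ln a)) {a..b}"
proof (rule fundamental_theorem_of_calculus)
  fix t assume t: "t \<in> {a..b}"
  then have "t > 0" "t \<noteq> 1" using assms by auto
  have "((\<lambda>t. Ei0 (ln t)) has_real_derivative exp (ln t) / ln t * (1 / t)) (at t)"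
    by (rule DERIV_chain2[OF Ei0_has_derivative])
       (use \<open>t > 0\<close> \<open>t \<noteq> 1\<close> in \<open>auto intro!: derivative_eq_intros simp: ln_eq_zero_iff\<close>)
  then have "((\<lambda>t. Ei0 (ln t)) has_real_derivative 1 / ln t) (at t)"
    using \<open>t > 0\<close> by simp
  then show "((\<lambda>t. Ei0 (ln t)) has_vector_derivative 1 / ln t) (at t within {a..b})"
    by (simp add: has_real_derivative_iff_has_vector_derivative has_vector_derivative_at_within)
qed (use assms in auto)

text \<open>On \<open>(0, 1)\<close> the functions \<open>Ei0 (ln a)\<close> and the integral from
  \<open>0\<close> to \<open>a\<close> have the same derivative in \<open>a\<close>, so any cut
  point gives this constant. At \<open>- 2\<close> the series for \<open>Gser\<close> converges fast
  and the remaining integral is small.\<close>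

definition Lconst :: real where
  "Lconst = Ei0 (- 2) - integral {0..exp (- 2)} (\<lambda>t. 1 / ln t)"

lemma continuous_inverse_ln_at_0: "continuous_on {0..<1} (\<lambda>t::real. 1 / ln t)"
  unfolding continuous_on_eq_continuous_within
proof
  fix t :: real assume t: "t \<in> {0..<1}"
  show "continuous (at t within {0..<1}) (\<lambda>t. 1 / ln t)"
  proof (cases "t = 0")
    case True
    \<comment> \<open>The conventions \<open>ln 0 = 0\<close> and \<open>1 / 0 = 0\<close> give the
      integrand the value \<open>0\<close> at \<open>0\<close>, in agreement with this
      limit.\<close>
    have "((\<lambda>t::real. 1 / ln t) \<longlongrightarrow> 0) (at_right 0)"
      using tendsto_divide_0[OF tendsto_const[of "1::real"] filterlim_at_bot_imp_at_infinity[OF ln_at_0]] .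
    moreover have "at_right (0::real) = at 0 within {0..<1}"
      by (rule at_within_nhd[where S = "{-1<..<1}"]) auto
    ultimately show ?thesis
      using True by (simp add: continuous_within)
  next
    case False
    then have "continuous (at t) (\<lambda>t. 1 / ln t)"
      using t by (intro continuous_intros) auto
    then show ?thesis by (rule continuous_at_imp_continuous_at_within)
  qed
qed

lemma Icc_exp_minus_2_subset: "{0..exp (- 2)} \<subseteq> {0..<1::real}"
proof
  fix x :: real assume "x \<in> {0..exp (- 2)}"
  moreover have "exp (- 2) < (1::real)" by simp
  ultimately show "x \<in> {0..<1}"
    by (metis atLeastAtMost_iff atLeastLessThan_iff le_less_trans)
qed

lemma integral_inverse_ln_split:
  assumes "exp (- 2) \<le> b" "b < 1"
  shows "integral {0..b} (\<lambda>t. 1 / ln t) = Ei0 (ln b) - Lconst"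
proof -
  have b: "0 < b" using assms(1) exp_gt_zero[of "-2::real"] by linarith
  have "integral {0..exp (- 2)} (\<lambda>t. 1 / ln t) + integral {exp (- 2)..b} (\<lambda>t. 1 / ln t)
      = integral {0..b} (\<lambda>t::real. 1 / ln t)"
    by (rule Henstock_Kurzweil_Integration.integral_combine)
       (use assms in \<open>auto intro!: integrable_continuous_interval
          continuous_on_subset[OF continuous_inverse_ln_at_0]\<close>)
  moreover have "integral {exp (- 2)..b} (\<lambda>t. 1 / ln t) = Ei0 (ln b) - Ei0 (- 2)"
    using inverse_ln_has_integral_Ei0[of "exp (- 2)" b] assms by (simp add: integral_unique)
  ultimately show ?thesis by (simp add: Lconst_def)
qed

text \<open>The logarithmic poles on the two sides of \<open>1\<close> cancel, since
  \<open>- ln (1 - \<epsilon>)\<close> and \<open>ln (1 + \<epsilon>)\<close> are asymptotically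
  equal. This is the existence of the principal value.\<close>

lemma Ei0_symmetric_limit:
  "((\<lambda>\<epsilon>. Ei0 (ln (1 - \<epsilon>)) - Ei0 (ln (1 + \<epsilon>))) \<longlongrightarrow> 0) (at_right 0)"
proof -
  have "((\<lambda>\<epsilon>::real. ln \<bar>ln (1 - \<epsilon>)\<bar> - ln \<bar>ln (1 + \<epsilon>)\<bar>) \<longlongrightarrow> 0) (at_right 0)"
    by real_asymp
  moreover have "((\<lambda>\<epsilon>. Gser (ln (1 - \<epsilon>))) \<longlongrightarrow> Gser (ln (1 - 0))) (at_right 0)"
    by (rule isCont_tendsto_compose[OF isCont_Gser]) (auto intro!: tendsto_eq_intros)
  moreover have "((\<lambda>\<epsilon>. Gser (ln (1 + \<epsilon>))) \<longlongrightarrow> Gser (ln (1 + 0))) (at_right 0)"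
    by (rule isCont_tendsto_compose[OF isCont_Gser]) (auto intro!: tendsto_eq_intros)
  ultimately have "((\<lambda>\<epsilon>::real. (ln \<bar>ln (1 - \<epsilon>)\<bar> - ln \<bar>ln (1 + \<epsilon>)\<bar>)
      + (Gser (ln (1 - \<epsilon>)) - Gser (ln (1 + \<epsilon>)))) \<longlongrightarrow> 0 + (Gser (ln (1 - 0)) - Gser (ln (1 + 0)))) (at_right 0)"
    by (intro tendsto_intros)
  then show ?thesis by (simp add: Ei0_def algebra_simps)
qed

lemma li_exp:
  assumes "b > 0"
  shows "li (exp b) = Ei0 b - Lconst"
proof -
  have "eventually (\<lambda>\<epsilon>::real. 0 < \<epsilon> \<and> \<epsilon> < min (1 - exp (- 2)) (exp b - 1)) (at_right 0)"
    unfolding eventually_at_right_field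
    using assms by (intro exI[of _ "min (1 - exp (- 2)) (exp b - 1)"]) auto
  then have ev: "eventually (\<lambda>\<epsilon>. Ei0 b - Lconst + (Ei0 (ln (1 - \<epsilon>)) - Ei0 (ln (1 + \<epsilon>))) =
      integral {0..1-\<epsilon>} (\<lambda>t. 1 / ln t) + integral {1+\<epsilon>..exp b} (\<lambda>t. 1 / ln t)) (at_right 0)"
  proof eventually_elim
    case (elim \<epsilon>)
    have "integral {1+\<epsilon>..exp b} (\<lambda>t. 1 / ln t) = Ei0 (ln (exp b)) - Ei0 (ln (1 + \<epsilon>))"
      using elim by (intro integral_unique inverse_ln_has_integral_Ei0) auto
    with integral_inverse_ln_split[of "1 - \<epsilon>"] elim show ?case by simp
  qed
  have "((\<lambda>\<epsilon>. Ei0 b - Lconst + (Ei0 (ln (1 - \<epsilon>)) - Ei0 (ln (1 + \<epsilon>)))) \<longlongrightarrow> Ei0 b - Lconst + 0) (at_right 0)"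
    by (intro tendsto_intros Ei0_symmetric_limit)
  then have "((\<lambda>\<epsilon>. integral {0..1-\<epsilon>} (\<lambda>t. 1 / ln t) + integral {1+\<epsilon>..exp b} (\<lambda>t. 1 / ln t))
      \<longlongrightarrow> Ei0 b - Lconst) (at_right 0)"
    using tendsto_cong[OF ev] by simp
  then show ?thesis
    unfolding li_def by (intro tendsto_Lim) auto
qed

text \<open>The crude side: \<open>1 / ln t\<close> is nonpositive on the range, so the integral is
  simply dropped.\<close>

lemma Lconst_ge: "Ei0 (- 2) \<le> Lconst"
proof -
  have "integral {0..exp (- 2)} (\<lambda>t::real. 1 / ln t) \<le> integral {0..exp (- 2)} (\<lambda>t::real. 0)"
  proof (rule integral_le)
    show "(\<lambda>t::real. 1 / ln t) integrable_on {0..exp (- 2)}"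
      by (intro integrable_continuous_interval continuous_on_subset[OF continuous_inverse_ln_at_0]
        Icc_exp_minus_2_subset)
  next
    fix t :: real assume t: "t \<in> {0..exp (- 2)}"
    then have "t \<in> {0..<1}" using Icc_exp_minus_2_subset by blast
    then have "t = 0 \<or> ln t < 0" by (cases "t = 0") (auto intro!: ln_less_zero)
    then show "1 / ln t \<le> 0" by auto
  qed auto
  then show ?thesis by (simp add: Lconst_def)
qed

text \<open>The rational function is a convergent of the continued fraction of
  \<open>exp s * E\<^sub>1 s\<close>.\<close>
lemma Lconst_le: "Lconst \<le> Ei0 (- 2) + exp (- 2) * (4 / 11)"
proof -
  define R where "R = (\<lambda>s::real. (s\<^sup>2 + 5 * s + 2) / (s * (s\<^sup>2 + 6 * s + 6)))"
  define R' where "R' = (\<lambda>s::real. ((2 * s + 5) * (s * (s\<^sup>2 + 6 * s + 6)) -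
      (s\<^sup>2 + 5 * s + 2) * (3 * s\<^sup>2 + 12 * s + 6)) / (s * (s\<^sup>2 + 6 * s + 6))\<^sup>2)"
  have pos: "s * (s\<^sup>2 + 6 * s + 6) > 0" if "s > 0" for s :: real
    using that by (intro mult_pos_pos add_pos_pos) auto
  have dR: "(R has_real_derivative R' s) (at s)" if "s > 0" for s
  proof -
    have "s * (s\<^sup>2 + 6 * s + 6) \<noteq> 0" using pos[OF that] by (metis less_irrefl)
    moreover have "((\<lambda>s. s\<^sup>2 + 5 * s + 2) has_real_derivative 2 * s + 5) (at s)"
      by (auto intro!: derivative_eq_intros)
    moreover have "((\<lambda>s. s * (s\<^sup>2 + 6 * s + 6)) has_real_derivative 3 * s\<^sup>2 + 12 * s + 6) (at s)"
      by (auto intro!: derivative_eq_intros simp: power2_eq_square algebra_simps)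
    ultimately show ?thesis
      unfolding R_def R'_def power2_eq_square[of "s * (s\<^sup>2 + 6 * s + 6)"]
      by (intro DERIV_divide)
  qed
  \<comment> \<open>\<open>F = exp s * E_1 s\<close> satisfies \<open>F - F' = 1 / s\<close>. The
    convergent \<open>R\<close> satisfies it with an excess whose numerator reduces to
    \<open>12 * s\<close>, so it bounds \<open>F\<close> from above.\<close>
  have ineq: "1 / s \<le> R s - R' s" if "s > 0" for s
  proof -
    let ?d = "s * (s\<^sup>2 + 6 * s + 6)" and ?p = "s\<^sup>2 + 5 * s + 2"
    have "R s - R' s - 1 / s = (s * (?p * ?d - ((2 * s + 5) * ?d - ?p * (3 * s\<^sup>2 + 12 * s + 6))) - ?d\<^sup>2) / (s * ?d\<^sup>2)"
    proof -
      have rw: "p / d - n / d\<^sup>2 - 1 / s = (s * (p * d - n) - d\<^sup>2) / (s * d\<^sup>2)" if "d \<noteq> 0" for p d n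
        using that \<open>s > 0\<close> by (simp add: field_simps power2_eq_square)
      show ?thesis unfolding R_def R'_def using pos[OF that] by (intro rw) (metis less_irrefl)
    qed
    also have "s * (?p * ?d - ((2 * s + 5) * ?d - ?p * (3 * s\<^sup>2 + 12 * s + 6))) - ?d\<^sup>2 = 12 * s"
      by (simp add: algebra_simps power2_eq_square power3_eq_cube)
    also have "12 * s / (s * ?d\<^sup>2) \<ge> 0" using that by simp
    finally show ?thesis by simp
  qed
  \<comment> \<open>This is \<open>- exp (- s) * R s\<close> in the variable
    \<open>t = exp (- s)\<close>. Its derivative \<open>R' - R\<close> is compared with
    \<open>1 / ln t = - 1 / s\<close>; at the end \<open>s = 2\<close> one has
    \<open>R 2 = 16 / 44 = 4 / 11\<close>.\<close>
  define K where "K = (\<lambda>t::real. - t * R (- ln t))"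
  have "((\<lambda>t. - R (- ln t) + R' (- ln t)) has_integral K (exp (- 2)) - K 0) {0..exp (- 2)}"
  proof (rule fundamental_theorem_of_calculus_interior)
    show "continuous_on {0..exp (- 2)} K"
      unfolding continuous_on_eq_continuous_within
    proof
      fix t :: real assume t: "t \<in> {0..exp (- 2)}"
      show "continuous (at t within {0..exp (- 2)}) K"
      proof (cases "t = 0")
        case True
        have "((\<lambda>t::real. - t * (((- ln t)\<^sup>2 + 5 * (- ln t) + 2) / ((- ln t) * ((- ln t)\<^sup>2 + 6 * (- ln t) + 6)))) \<longlongrightarrow> 0) (at_right 0)"
          by real_asymp
        then have "(K \<longlongrightarrow> 0) (at_right 0)" by (simp add: K_def R_def)
        moreover have "at_right (0::real) = at 0 within {0..exp (- 2)}"
          by (rule at_within_nhd[where S = "{-1<..<exp (- 2)}"]) auto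
        ultimately show ?thesis
          using True by (simp add: continuous_within K_def)
      next
        case False
        with t have "t > 0" "- ln t > 0"
          by (auto simp: less_le_trans[of _ "exp (-2)" 1] intro!: le_less_trans[of t "exp (- 2)" 1])
        then have "isCont K t"
          unfolding K_def
          by (intro continuous_intros isCont_o2[OF _ DERIV_isCont[OF dR]]) auto
        then show ?thesis by (rule continuous_at_imp_continuous_at_within)
      qed
    qed
  next
    fix t :: real assume t: "t \<in> {0<..<exp (- 2)}"
    then have "t > 0" "- ln t > 0"
      by (auto intro!: less_trans[of t "exp (- 2)" 1])
    then have "(K has_real_derivative - R (- ln t) + R' (- ln t)) (at t)"
      unfolding K_def by (auto intro!: derivative_eq_intros DERIV_chain2[OF dR] simp: field_simps)
    then show "(K has_vector_derivative - R (- ln t) + R' (- ln t)) (at t)"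
      by (simp add: has_real_derivative_iff_has_vector_derivative)
  qed auto
  moreover have "((\<lambda>t. 1 / ln t) has_integral integral {0..exp (- 2)} (\<lambda>t::real. 1 / ln t)) {0..exp (- 2)}"
    by (intro integrable_integral integrable_continuous_interval
        continuous_on_subset[OF continuous_inverse_ln_at_0] Icc_exp_minus_2_subset)
  ultimately have "K (exp (- 2)) - K 0 \<le> integral {0..exp (- 2)} (\<lambda>t::real. 1 / ln t)"
  proof (rule has_integral_le)
    fix t :: real assume t: "t \<in> {0..exp (- 2)}"
    show "- R (- ln t) + R' (- ln t) \<le> 1 / ln t"
    proof (cases "t = 0")
      case True then show ?thesis by (simp add: R_def R'_def)
    next
      case False
      with t have "- ln t > 0"
        by (auto intro!: le_less_trans[of t "exp (- 2)" 1])
      from ineq[OF this] show ?thesis by simp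
    qed
  qed
  moreover have "K (exp (- 2)) - K 0 = - exp (- 2) * (4 / 11)"
    by (simp add: K_def R_def)
  ultimately show ?thesis by (simp add: Lconst_def)
qed

section \<open>The inverse function and barriers\<close>

lemma Ei0_strict_mono:
  assumes "0 < a" "a < b"
  shows "Ei0 a < Ei0 b"
proof (rule DERIV_pos_imp_increasing[OF assms(2)])
  fix x assume "a \<le> x" "x \<le> b"
  then show "\<exists>y. (Ei0 has_real_derivative y) (at x) \<and> 0 < y"
    using assms(1) by (intro exI[of _ "exp x / x"] conjI Ei0_has_derivative) auto
qed

lemma Gser_nonneg: "0 \<le> u \<Longrightarrow> 0 \<le> Gser u"
  unfolding Gser_def by (intro suminf_nonneg Gser_summable) auto

lemma Ei0_surj: "\<exists>b>0. Ei0 b = t"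
proof -
  have "(Gser \<longlongrightarrow> Gser 0) (at_right 0)"
    using isCont_Gser[of 0] by (auto simp: isCont_def intro: filterlim_mono at_le)
  then have "filterlim (\<lambda>u. - Gser u + - ln u) at_top (at_right 0)"
    by (intro filterlim_tendsto_add_at_top[OF tendsto_minus]
        filterlim_compose[OF filterlim_uminus_at_top_at_bot ln_at_0])
  then have "eventually (\<lambda>u. - t \<le> - Gser u + - ln u) (at_right 0)"
    by (auto simp: filterlim_at_top)
  then have "eventually (\<lambda>u. Gser u + ln u \<le> t) (at_right 0)"
    by eventually_elim simp
  then have "eventually (\<lambda>u. 0 < u \<and> Gser u + ln u \<le> t) (at_right 0)"
    using eventually_at_right_less[of 0] by (rule eventually_conj[rotated])
  then obtain b1 where b1: "0 < b1" "Gser b1 + ln b1 \<le> t"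
    using eventually_happens'[OF trivial_limit_at_right_real] by blast
  define b2 where "b2 = max b1 (exp t)"
  have b2: "b1 \<le> b2" "0 < b2" using b1 by (auto simp: b2_def)
  have "t \<le> ln b2" using b2 by (simp add: ln_ge_iff b2_def)
  then have "t \<le> Ei0 b2" using b2 Gser_nonneg[of b2] by (simp add: Ei0_def)
  moreover have "Ei0 b1 \<le> t" using b1 by (simp add: Ei0_def)
  moreover have "\<forall>x. b1 \<le> x \<and> x \<le> b2 \<longrightarrow> isCont Ei0 x"
    using b1 by (auto intro!: DERIV_isCont[OF Ei0_has_derivative])
  ultimately obtain b where "b1 \<le> b" "Ei0 b = t"
    using IVT[of Ei0 b1 t b2] b2 by auto
  then show ?thesis using b1 by (intro exI[of _ b]) auto
qed

lemma ali_eq_exp: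
  assumes "b > 0" "Ei0 b - Lconst = t"
  shows "ali t = exp b"
  unfolding ali_def
proof (rule the_equality)
  show "1 < exp b \<and> li (exp b) = t" using assms by (simp add: li_exp)
next
  fix x assume x: "1 < x \<and> li x = t"
  define c where "c = ln x"
  have c: "c > 0" "x = exp c" using x by (auto simp: c_def)
  then have "Ei0 c = Ei0 b" using x assms li_exp[of c] by simp
  then have "c = b"
    using Ei0_strict_mono[of c b] Ei0_strict_mono[of b c] c(1) assms(1)
    by (cases c b rule: linorder_cases) auto
  then show "x = exp b" using c by simp
qed

text \<open>Together with the reverse bound below, this turns estimates of \<open>ali\<close> into
  inequalities between values of \<open>Ei0\<close>; the inverse function disappears from the
  analysis.\<close>

lemma ali_le_exp:
  assumes "W > 0" "t + Lconst \<le> Ei0 W"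
  shows "ali t \<le> exp W"
proof -
  obtain b where b: "b > 0" "Ei0 b = t + Lconst" using Ei0_surj by blast
  then have "ali t = exp b" by (intro ali_eq_exp) auto
  moreover have "b \<le> W" using Ei0_strict_mono[of W b] assms b by force
  ultimately show ?thesis by simp
qed

lemma exp_le_ali:
  assumes "W > 0" "Ei0 W \<le> t + Lconst"
  shows "exp W \<le> ali t"
proof -
  obtain b where b: "b > 0" "Ei0 b = t + Lconst" using Ei0_surj by blast
  then have "ali t = exp b" by (intro ali_eq_exp) auto
  moreover have "W \<le> b" using Ei0_strict_mono[of b W] assms b by force
  ultimately show ?thesis by simp
qed

lemma ali_pos: "0 < ali t"
proof -
  obtain b where b: "b > 0" "Ei0 b = t + Lconst" using Ei0_surj by blast
  then have "ali t = exp b" by (intro ali_eq_exp) auto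
  then show ?thesis by simp
qed

section \<open>Barriers and the monotonicity of their defect\<close>

definition logbar :: "(real \<Rightarrow> real) \<Rightarrow> real \<Rightarrow> real" where
  "logbar u x = x + ln x + ln (u x)"

text \<open>The first integral: if \<open>x * exp x * u x\<close> equals \<open>ali (exp x)\<close>,
  this is \<open>Lconst\<close>. A larger value means that the barrier lies above the
  solution.\<close>

definition defect :: "(real \<Rightarrow> real) \<Rightarrow> real \<Rightarrow> real" where
  "defect u x = Ei0 (logbar u x) - exp x"

lemma exp_logbar: "x > 0 \<Longrightarrow> u x > 0 \<Longrightarrow> exp (logbar u x) = x * exp x * u x"
  by (simp add: logbar_def exp_add)

text \<open>The origin of the bound \<open>1 / 5\<close> on \<open>u\<close> used throughout:
  \<open>(3 / 2) * 3.6 / 5 > 1\<close>, so the barrier exceeds \<open>1\<close> and its logarithm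
  stays on the increasing branch of \<open>Ei0\<close>, to the right of the pole.\<close>

lemma logbar_pos:
  assumes "x \<ge> 3/2" "u x \<ge> 1/5"
  shows "logbar u x > 0"
proof -
  have "1 + 3/2 + (3/2)\<^sup>2 / 2 \<le> exp (3/2::real)"
    by (rule exp_lower_Taylor_quadratic) simp
  also have "\<dots> \<le> exp x" using assms by simp
  finally have e: "3.6 < exp x" by (simp add: power2_eq_square)
  have "1 < (3/2) * 3.6 * (1/5::real)" by simp
  also have "\<dots> \<le> x * exp x * u x"
    using assms e by (intro mult_mono) auto
  also have "\<dots> = exp (logbar u x)" using assms by (simp add: exp_logbar)
  finally show ?thesis by simp
qed

text \<open>The factor \<open>exp (logbar u x) = x * exp x * u x\<close> cancels the denominator of
  \<open>u' / u x\<close>; the numerator that remains is \<open>D - ln (u x)\<close>.\<close>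

lemma defect_has_derivative:
  assumes "x > 0" "u x > 0" "logbar u x > 0" "(u has_real_derivative u') (at x)"
  shows "(defect u has_real_derivative
      exp x * (u x + x * u x + x * u' - logbar u x) / logbar u x) (at x)"
proof -
  let ?W = "logbar u x"
  have "(logbar u has_real_derivative 1 + 1 / x + u' / u x) (at x)"
    unfolding logbar_def[abs_def] using assms
    by (auto intro!: derivative_eq_intros)
  then have "((\<lambda>x. Ei0 (logbar u x)) has_real_derivative exp ?W / ?W * (1 + 1 / x + u' / u x)) (at x)"
    using assms by (intro DERIV_chain2[OF Ei0_has_derivative]) auto
  then have "(defect u has_real_derivative exp ?W / ?W * (1 + 1 / x + u' / u x) - exp x) (at x)"
    unfolding defect_def[abs_def] by (intro DERIV_diff DERIV_exp)
  moreover have "exp ?W / ?W * (1 + 1 / x + u' / u x) - exp x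
      = exp x * (u x + x * u x + x * u' - ?W) / ?W"
    using assms by (simp add: exp_logbar field_simps)
  ultimately show ?thesis by simp
qed

lemma defect_mono:
  assumes "a \<le> b" "a \<ge> 3/2"
    and "\<And>x. x \<in> {a..b} \<Longrightarrow> u x \<ge> 1/5"
    and "\<And>x. x \<in> {a..b} \<Longrightarrow> (u has_real_derivative u' x) (at x)"
    and "\<And>x. x \<in> {a..b} \<Longrightarrow> ln (u x) \<le> u x + x * (u x - 1) + x * u' x - ln x"
  shows "defect u a \<le> defect u b"
proof (rule DERIV_nonneg_imp_nondecreasing[OF assms(1)])
  fix x assume "a \<le> x" "x \<le> b"
  then have x: "x \<in> {a..b}" "x \<ge> 3/2" using assms(2) by auto
  note W = logbar_pos[of x u, OF x(2) assms(3)[OF x(1)]]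
  have "(defect u has_real_derivative
      exp x * (u x + x * u x + x * u' x - logbar u x) / logbar u x) (at x)"
    using x W assms(3,4)[OF x(1)] by (intro defect_has_derivative) auto
  moreover have "0 \<le> u x + x * u x + x * u' x - logbar u x"
    using assms(5)[OF x(1)] by (simp add: logbar_def algebra_simps)
  ultimately show "\<exists>y. (defect u has_real_derivative y) (at x) \<and> 0 \<le> y"
    using W by (intro exI conjI) auto
qed

lemma defect_antimono:
  assumes "a \<le> b" "a \<ge> 3/2"
    and "\<And>x. x \<in> {a..b} \<Longrightarrow> u x \<ge> 1/5"
    and "\<And>x. x \<in> {a..b} \<Longrightarrow> (u has_real_derivative u' x) (at x)"
    and "\<And>x. x \<in> {a..b} \<Longrightarrow> ln (u x) \<ge> u x + x * (u x - 1) + x * u' x - ln x"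
  shows "defect u b \<le> defect u a"
proof (rule DERIV_nonpos_imp_nonincreasing[OF assms(1)])
  fix x assume "a \<le> x" "x \<le> b"
  then have x: "x \<in> {a..b}" "x \<ge> 3/2" using assms(2) by auto
  note W = logbar_pos[of x u, OF x(2) assms(3)[OF x(1)]]
  have "(defect u has_real_derivative
      exp x * (u x + x * u x + x * u' x - logbar u x) / logbar u x) (at x)"
    using x W assms(3,4)[OF x(1)] by (intro defect_has_derivative) auto
  moreover have "u x + x * u x + x * u' x - logbar u x \<le> 0"
    using assms(5)[OF x(1)] by (simp add: logbar_def algebra_simps)
  ultimately show "\<exists>y. (defect u has_real_derivative y) (at x) \<and> y \<le> 0"
    using W by (intro exI conjI) (auto simp: divide_le_0_iff mult_le_0_iff)
qed

lemma ali_upper: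
  assumes "x \<ge> 3/2" "u x \<ge> 1/5" "Lconst \<le> defect u x"
  shows "ali (exp x) / (x * exp x) \<le> u x"
proof -
  have "ali (exp x) \<le> exp (logbar u x)"
    using assms logbar_pos[of x u] by (intro ali_le_exp) (auto simp: defect_def)
  also have "\<dots> = u x * (x * exp x)" using assms by (simp add: exp_logbar)
  finally show ?thesis using assms(1) by (subst pos_divide_le_eq) auto
qed

lemma ali_lower:
  assumes "x \<ge> 3/2" "u x \<ge> 1/5" "defect u x \<le> Lconst"
  shows "u x \<le> ali (exp x) / (x * exp x)"
proof -
  have "u x * (x * exp x) = exp (logbar u x)" using assms by (simp add: exp_logbar)
  also have "\<dots> \<le> ali (exp x)"
    using assms logbar_pos[of x u] by (intro exp_le_ali) (auto simp: defect_def)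
  finally show ?thesis using assms(1) by (subst pos_le_divide_eq) auto
qed

text \<open>\<open>Ttail (\<lambda>_. 1) 0\<close> is the exponential function and
  \<open>Ttail (\<lambda>k. 1 / k) 0\<close> is \<^const>\<open>Gser\<close>, since \<open>1 / 0 = 0\<close>.\<close>
definition Ttail :: "(nat \<Rightarrow> real) \<Rightarrow> nat \<Rightarrow> real \<Rightarrow> real" where
  "Ttail f k u = (\<Sum>j. f (k + j) * u ^ j * (fact k / fact (k + j)))"

text \<open>\<open>fact (k + j) / fact k\<close> is a product of \<open>j\<close> factors, each at
  least \<open>k + 1\<close>; this gives the geometric majorant of the tails.\<close>

lemma fact_mult_power_le: "fact k * (k + 1) ^ j \<le> (fact (k + j) :: nat)"
proof (induction j)
  case (Suc j)
  have "fact k * (k + 1) ^ Suc j = (fact k * (k + 1) ^ j) * (k + 1)"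
    by (simp only: power_Suc mult_ac)
  also have "\<dots> \<le> fact (k + j) * (k + j + 1)" by (intro mult_mono Suc) auto
  finally show ?case by (simp add: algebra_simps)
qed simp

lemma fact_ratio_le: "fact k / fact (k + j) \<le> (1 / real (k + 1)) ^ j"
proof -
  have "real (fact k * (k + 1) ^ j) \<le> real (fact (k + j))"
    using fact_mult_power_le of_nat_le_iff by blast
  then have "fact k * real (k + 1) ^ j \<le> fact (k + j)" by simp
  moreover have "(fact (k + j) :: real) > 0" "real (k + 1) ^ j > 0" by simp_all
  ultimately show ?thesis by (simp add: power_one_over divide_simps del: of_nat_add)
qed

lemma Ttail_term_bound:
  fixes f :: "nat \<Rightarrow> real" and u :: real
  assumes "\<And>k. 0 \<le> f k \<and> f k \<le> 1"
  shows "\<bar>f (k + j) * u ^ j * (fact k / fact (k + j))\<bar> \<le> (\<bar>u\<bar> / real (k + 1)) ^ j"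
proof -
  have "\<bar>f (k + j) * u ^ j * (fact k / fact (k + j))\<bar> = f (k + j) * (\<bar>u\<bar> ^ j * (fact k / fact (k + j)))"
    using assms[of "k + j"] by (simp add: abs_mult power_abs)
  also have "\<dots> \<le> 1 * (\<bar>u\<bar> ^ j * (fact k / fact (k + j)))"
    using assms[of "k + j"] by (intro mult_right_mono) auto
  also have "\<dots> \<le> 1 * (\<bar>u\<bar> ^ j * (1 / real (k + 1)) ^ j)"
    by (intro mult_left_mono fact_ratio_le) auto
  finally show ?thesis by (simp add: power_divide)
qed

lemma Ttail_summable:
  fixes f :: "nat \<Rightarrow> real" and u :: real
  assumes "\<And>k. 0 \<le> f k \<and> f k \<le> 1"
  shows "summable (\<lambda>j. f (k + j) * u ^ j * (fact k / fact (k + j)))"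
proof (rule summable_comparison_test)
  show "summable (\<lambda>j. fact k * (inverse (fact (k + j)) * \<bar>u\<bar> ^ j))"
  proof (rule summable_mult, rule summable_comparison_test)
    show "summable (\<lambda>j. inverse (fact j) * \<bar>u\<bar> ^ j)" by (rule summable_exp)
    have "inverse (fact (k + j)) \<le> (inverse (fact j) :: real)" for j
      by (intro le_imp_inverse_le fact_mono) auto
    then show "\<exists>N. \<forall>n\<ge>N. norm (inverse (fact (k + n)) * \<bar>u\<bar> ^ n) \<le> inverse (fact n) * \<bar>u\<bar> ^ n"
      by (auto simp: abs_mult intro!: mult_right_mono)
  qed
  have "\<bar>f (k + n) * u ^ n * (fact k / fact (k + n))\<bar> \<le> fact k * (inverse (fact (k + n)) * \<bar>u\<bar> ^ n)" for n
  proof -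
    have "\<bar>f (k + n) * u ^ n * (fact k / fact (k + n))\<bar>
        = f (k + n) * (fact k * (inverse (fact (k + n)) * \<bar>u\<bar> ^ n))"
      using assms[of "k + n"] by (simp add: abs_mult power_abs field_simps)
    also have "\<dots> \<le> 1 * (fact k * (inverse (fact (k + n)) * \<bar>u\<bar> ^ n))"
      using assms[of "k + n"] by (intro mult_right_mono) auto
    finally show ?thesis by simp
  qed
  then show "\<exists>N. \<forall>n\<ge>N. norm (f (k + n) * u ^ n * (fact k / fact (k + n)))
      \<le> fact k * (inverse (fact (k + n)) * \<bar>u\<bar> ^ n)" by auto
qed

lemma Ttail_rec:
  fixes f :: "nat \<Rightarrow> real" and u :: real
  assumes "\<And>k. 0 \<le> f k \<and> f k \<le> 1"
  shows "Ttail f k u = f k + u / real (k + 1) * Ttail f (k + 1) u"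
proof -
  have "Ttail f k u = (\<Sum>j. f (k + Suc j) * u ^ Suc j * (fact k / fact (k + Suc j))) + f k"
    unfolding Ttail_def using suminf_split_head[OF Ttail_summable[of f k u, OF assms]] by simp
  also have "(\<lambda>j. f (k + Suc j) * u ^ Suc j * (fact k / fact (k + Suc j)))
      = (\<lambda>j. u / real (k + 1) * (f (k + 1 + j) * u ^ j * (fact (k + 1) / fact (k + 1 + j))))"
  proof
    fix j
    have i: "k + 1 + j = k + Suc j" by simp
    have "(fact k :: real) = fact (k + 1) / real (k + 1)" by simp
    then show "f (k + Suc j) * u ^ Suc j * (fact k / fact (k + Suc j))
      = u / real (k + 1) * (f (k + 1 + j) * u ^ j * (fact (k + 1) / fact (k + 1 + j)))"
      unfolding i by (simp add: mult_ac del: fact_Suc of_nat_Suc of_nat_add add_Suc_right)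
  qed
  also have "(\<Sum>j. u / real (k + 1) * (f (k + 1 + j) * u ^ j * (fact (k + 1) / fact (k + 1 + j))))
      = u / real (k + 1) * Ttail f (k + 1) u"
    unfolding Ttail_def by (rule suminf_mult[OF Ttail_summable[of f "k + 1" u, OF assms]])
  finally show ?thesis by simp
qed

lemma Ttail_nonneg:
  fixes f :: "nat \<Rightarrow> real" and u :: real
  assumes "\<And>k. 0 \<le> f k \<and> f k \<le> 1" "0 \<le> u"
  shows "0 \<le> Ttail f k u"
  unfolding Ttail_def using assms by (intro suminf_nonneg Ttail_summable) auto

lemma Ttail_abs_le_2:
  fixes f :: "nat \<Rightarrow> real" and u :: real
  assumes "\<And>k. 0 \<le> f k \<and> f k \<le> 1" "2 * \<bar>u\<bar> \<le> real (k + 1)"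
  shows "\<bar>Ttail f k u\<bar> \<le> 2"
proof -
  have b: "norm (f (k + j) * u ^ j * (fact k / fact (k + j))) \<le> (1 / 2) ^ j" for j
  proof -
    have "norm (f (k + j) * u ^ j * (fact k / fact (k + j))) \<le> (\<bar>u\<bar> / real (k + 1)) ^ j"
      using Ttail_term_bound[of f k j u, OF assms(1)] by simp
    also have "\<dots> \<le> (1 / 2) ^ j"
      using assms(2) by (intro power_mono) (auto simp: field_simps)
    finally show ?thesis .
  qed
  have "norm (Ttail f k u) \<le> (\<Sum>j. (1 / 2 :: real) ^ j)"
    unfolding Ttail_def by (rule norm_suminf_le[OF b]) (simp add: summable_geometric)
  also have "\<dots> = 2" by (simp add: suminf_geometric)
  finally show ?thesis by simp
qed

lemma exp_eq_Ttail: "exp u = Ttail (\<lambda>_. 1) 0 u"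
  by (simp add: exp_def Ttail_def field_simps)

text \<open>\<open>t * exp (- t)\<close> rises up to \<open>t = 1\<close> and falls afterwards. The
  first hypothesis says that \<open>y\<close> is on the far side of \<open>y0\<close> as seen from
  the peak, or that \<open>y0\<close> is the peak; the tangent bound
  \<open>1 + z \<le> exp z\<close> then suffices.\<close>

lemma mult_exp_minus_le:
  fixes y y0 :: real
  assumes "0 \<le> (y - y0) * (y0 - 1)" "0 \<le> y0"
  shows "y * exp (- y) \<le> y0 * exp (- y0)"
proof -
  have "y \<le> y0 * (1 + (y - y0))" using assms(1) by (simp add: algebra_simps)
  also have "\<dots> \<le> y0 * exp (y - y0)"
    using assms(2) exp_ge_add_one_self[of "y - y0"] by (intro mult_left_mono) auto
  finally have "y * exp (- y) \<le> y0 * exp (y - y0) * exp (- y)"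
    by (intro mult_right_mono) auto
  also have "\<dots> = y0 * exp (- y0)" by (simp add: mult.assoc exp_add[symmetric])
  finally show ?thesis .
qed

section \<open>Polynomials in two variables as integer lists\<close>

fun padd :: "int list \<Rightarrow> int list \<Rightarrow> int list" where
  "padd [] q = q"
| "padd p [] = p"
| "padd (a # p) (b # q) = (a + b) # padd p q"

fun pmul :: "int list \<Rightarrow> int list \<Rightarrow> int list" where
  "pmul [] q = []"
| "pmul (a # p) q = padd (map ((*) a) q) (0 # pmul p q)"

fun pder :: "int list \<Rightarrow> int list" where
  "pder [] = []"
| "pder (a # p) = padd p (0 # pder p)"

fun badd :: "int list list \<Rightarrow> int list list \<Rightarrow> int list list" where
  "badd [] q = q"
| "badd p [] = p"
| "badd (a # p) (b # q) = padd a b # badd p q"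

fun bmul :: "int list list \<Rightarrow> int list list \<Rightarrow> int list list" where
  "bmul [] q = []"
| "bmul (a # p) q = badd (map (pmul a) q) ([] # bmul p q)"

fun bder :: "int list list \<Rightarrow> int list list" where
  "bder [] = []"
| "bder (a # p) = badd p ([] # bder p)"

definition bscale :: "int \<Rightarrow> int list list \<Rightarrow> int list list" where
  "bscale c = map (map ((*) c))"

abbreviation ev :: "int list \<Rightarrow> real \<Rightarrow> real" where
  "ev p y \<equiv> horner_sum of_int y p"

text \<open>The outer list runs over the powers of \<open>v\<close>, the inner lists over those of
  \<open>y\<close>, lowest degree first.\<close>

abbreviation ev2 :: "int list list \<Rightarrow> real \<Rightarrow> real \<Rightarrow> real" where
  "ev2 P y v \<equiv> horner_sum (\<lambda>p. ev p y) v P"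

lemma ev_padd [simp]: "ev (padd p q) y = ev p y + ev q y"
  by (induction p q rule: padd.induct) (auto simp: algebra_simps)

lemma ev_scale [simp]: "ev (map ((*) c) p) y = of_int c * ev p y"
  by (induction p) (auto simp: algebra_simps)

lemma ev_pmul [simp]: "ev (pmul p q) y = ev p y * ev q y"
  by (induction p) (auto simp: algebra_simps)

lemma ev_pder: "((\<lambda>y. ev p y) has_real_derivative ev (pder p) y) (at y)"
proof (induction p)
  case (Cons a p)
  show ?case by (auto intro!: derivative_eq_intros Cons.IH)
qed simp

lemma ev2_badd [simp]: "ev2 (badd p q) y v = ev2 p y v + ev2 q y v"
  by (induction p q rule: badd.induct) (auto simp: algebra_simps)

lemma ev2_map_pmul: "ev2 (map (pmul a) q) y v = ev a y * ev2 q y v"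
  by (induction q) (auto simp: algebra_simps)

lemma ev2_bmul [simp]: "ev2 (bmul p q) y v = ev2 p y v * ev2 q y v"
  by (induction p) (auto simp: algebra_simps ev2_map_pmul)

lemma ev2_bscale [simp]: "ev2 (bscale c p) y v = of_int c * ev2 p y v"
  by (induction p) (auto simp: algebra_simps bscale_def)

lemma ev2_bder: "((\<lambda>v. ev2 p y v) has_real_derivative ev2 (bder p) y v) (at v)"
proof (induction p)
  case (Cons a p)
  show ?case by (auto intro!: derivative_eq_intros Cons.IH)
qed simp

lemma ev2_has_derivative:
  assumes "x > 0"
  shows "((\<lambda>x. ev2 p (ln x) (1 / x)) has_real_derivative
    (ev2 (map pder p) (ln x) (1 / x) - ev2 (bder p) (ln x) (1 / x) / x) / x) (at x)"
proof (induction p)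
  case (Cons a p)
  have "((\<lambda>x. ev a (ln x)) has_real_derivative ev (pder a) (ln x) * (1 / x)) (at x)"
    by (rule DERIV_chain2[OF ev_pder]) (use assms in \<open>auto intro!: derivative_eq_intros\<close>)
  moreover have "((\<lambda>x. 1 / x) has_real_derivative - (1 / (x * x))) (at x)"
    using assms by (auto intro!: derivative_eq_intros simp: divide_simps)
  ultimately have "((\<lambda>x. ev a (ln x) + 1 / x * ev2 p (ln x) (1 / x)) has_real_derivative
     ev (pder a) (ln x) * (1 / x) + (- (1 / (x * x)) * ev2 p (ln x) (1 / x)
     + (ev2 (map pder p) (ln x) (1 / x) - ev2 (bder p) (ln x) (1 / x) / x) / x * (1 / x))) (at x)"
    by (intro DERIV_add DERIV_mult Cons.IH)
  then show ?case unfolding horner_sum_simps list.map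
    by (rule DERIV_cong) (use assms in \<open>simp add: divide_simps, simp add: algebra_simps\<close>)
qed simp

text \<open>With \<open>K\<close> a common denominator, \<open>Dop K U\<close> represents \<open>K * D\<close> when \<open>U\<close> represents
  \<open>K * u\<close>, and \<open>Mop K U E\<close> represents \<open>K\<^sup>2 * M\<close> with \<open>D\<close> replaced by \<open>D + E / K\<close>.\<close>
definition Dop :: "int \<Rightarrow> int list list \<Rightarrow> int list list" where
  "Dop K U = badd (map pder U) (badd U (badd (tl U) (badd (bscale (- 1) ([] # bder U)) [[0, - K]])))"

definition Mop :: "int \<Rightarrow> int list list \<Rightarrow> int list list \<Rightarrow> int list list" where
  "Mop K U E = badd (bmul (bder (badd (Dop K U) E)) U) (bscale (- K) (bder U))"

section \<open>Polynomial barriers and the path argument\<close>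

definition barrier :: "int \<Rightarrow> int list list \<Rightarrow> real \<Rightarrow> real" where
  "barrier K U x = ev2 U (ln x) (1 / x) / of_int K"

definition barrier' :: "int \<Rightarrow> int list list \<Rightarrow> real \<Rightarrow> real" where
  "barrier' K U x = (ev2 (map pder U) (ln x) (1 / x) - ev2 (bder U) (ln x) (1 / x) / x) / x / of_int K"

lemma barrier_has_derivative: "x > 0 \<Longrightarrow> (barrier K U has_real_derivative barrier' K U x) (at x)"
  unfolding barrier_def[abs_def] barrier'_def by (intro DERIV_cdivide ev2_has_derivative)

text \<open>Multiplication of \<open>u - 1\<close> by \<open>x = 1 / v\<close> is the
  \<open>tl\<close> in \<open>Dop\<close>; it is exact because the constant row of \<open>U\<close>
  is \<open>K\<close>.\<close>

lemma Dop_eq: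
  assumes "x > 0" "K > 0"
  shows "barrier K ([K] # us) x + x * (barrier K ([K] # us) x - 1) + x * barrier' K ([K] # us) x - ln x
    = ev2 (Dop K ([K] # us)) (ln x) (1 / x) / of_int K"
proof -
  define w where "w = 1 / x"
  define k :: real where "k = of_int K"
  define a b c where "a = ev2 us (ln x) w" and "b = ev2 (map pder us) (ln x) w"
    and "c = ev2 (bder us) (ln x) w"
  have k: "k > 0" "x * w = 1" using assms by (auto simp: k_def w_def)
  have u: "barrier K ([K] # us) x = (k + w * a) / k"
    by (simp add: barrier_def w_def k_def a_def)
  have u': "barrier' K ([K] # us) x = (w * b - (a + w * c) * w) * w / k"
    by (simp add: barrier'_def w_def k_def a_def b_def c_def)
  have D: "ev2 (Dop K ([K] # us)) (ln x) (1 / x) = w * b + (k + w * a) + a - w * (a + w * c) - k * ln x"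
    unfolding w_def[symmetric] by (simp add: Dop_def k_def a_def b_def c_def)
  have dist: "k * (A + x * (A - 1) + x * B - l) = k * A + x * (k * A - k) + x * (k * B) - k * l" for A B l
    by (simp add: algebra_simps)
  have "k * ((k + w * a) / k + x * ((k + w * a) / k - 1) + x * ((w * b - (a + w * c) * w) * w / k) - ln x)
      = (k + w * a) + x * (k + w * a - k) + x * ((w * b - (a + w * c) * w) * w) - k * ln x"
    unfolding dist using k(1) by simp
  also have "\<dots> = (k + w * a) + (x * w) * a + (x * w) * (w * b - (a + w * c) * w) - k * ln x"
    by (simp add: mult_ac)
  also have "\<dots> = w * b + (k + w * a) + a - w * (a + w * c) - k * ln x"
    unfolding k(2) by (simp add: mult_ac)
  finally show ?thesis
    unfolding u u' D k_def[symmetric] using k(1) by (simp add: eq_divide_eq mult.commute)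
qed

text \<open>The second row is \<open>P_0 = y - 1\<close>, and at \<open>v = 0\<close> the expression
  \<open>D\<close> is \<open>1 + P_0 - y\<close>.\<close>

lemma Dop_at_0: "ev2 (Dop K ([K] # [- K, K] # us)) y 0 = 0"
  by (simp add: Dop_def horner_sum_simps(1))

text \<open>Along the segment from \<open>(y, 0)\<close> to \<open>(y, v)\<close> the derivative of \<open>U exp (- D)\<close>
  has the sign of \<open>- M\<close>, and the value at the start is \<open>1\<close>.\<close>
lemma path_derivative:
  assumes "K > 0"
  shows "((\<lambda>v. ev2 U y v / of_int K * exp (- (ev2 D y v / of_int K))) has_real_derivative
    - (ev2 (badd (bmul (bder D) U) (bscale (- K) (bder U))) y v / (of_int K)\<^sup>2
      * exp (- (ev2 D y v / of_int K)))) (at v)"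
proof -
  define k :: real where "k = of_int K"
  have k: "k > 0" using assms by (simp add: k_def)
  have *: "((\<lambda>v. u v / k * exp (- (e v / k))) has_real_derivative
      - ((e' * u v + - k * u') / k\<^sup>2 * exp (- (e v / k)))) (at v)"
    if "(u has_real_derivative u') (at v)" "(e has_real_derivative e') (at v)" for u e :: "real \<Rightarrow> real" and u' e'
  proof (rule DERIV_cong)
    show "((\<lambda>v. u v / k * exp (- (e v / k))) has_real_derivative
        u' / k * exp (- (e v / k)) + exp (- (e v / k)) * - (e' / k) * (u v / k)) (at v)"
      by (intro DERIV_mult DERIV_cdivide DERIV_fun_exp DERIV_minus that)
    have "u' / k * E + E * - (e' / k) * (p / k) = - ((e' * p + - k * u') / k\<^sup>2 * E)" for E p
      using k by (simp add: field_simps power2_eq_square)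
    then show "u' / k * exp (- (e v / k)) + exp (- (e v / k)) * - (e' / k) * (u v / k)
        = - ((e' * u v + - k * u') / k\<^sup>2 * exp (- (e v / k)))" .
  qed
  show ?thesis
    using *[OF ev2_bder[where p = U and y = y and v = v] ev2_bder[where p = D and y = y and v = v]]
    by (simp only: ev2_badd ev2_bmul ev2_bscale of_int_minus k_def)
qed

lemma mult_exp_minus_le_1: "a * exp (- d) \<le> 1 \<longleftrightarrow> a \<le> exp (d :: real)"
  by (simp add: exp_minus field_simps)

lemma mult_exp_minus_ge_1: "1 \<le> a * exp (- d) \<longleftrightarrow> exp (d :: real) \<le> a"
  by (simp add: exp_minus field_simps)

lemma path_upper:
  fixes us :: "int list list" and K :: int
  defines "U \<equiv> [K] # [- K, K] # us"
  assumes "K > 0" "0 \<le> w" "ev2 E y 0 = 0"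
    and "\<And>v. 0 \<le> v \<Longrightarrow> v \<le> w \<Longrightarrow> 0 \<le> ev2 (Mop K U E) y v"
  shows "ev2 U y w / of_int K \<le> exp (ev2 (badd (Dop K U) E) y w / of_int K)"
proof -
  let ?D = "badd (Dop K U) E"
  let ?g = "\<lambda>v. ev2 U y v / of_int K * exp (- (ev2 ?D y v / of_int K))"
  have "?g w \<le> ?g 0"
  proof (rule DERIV_nonpos_imp_nonincreasing[OF assms(3)])
    fix v assume "0 \<le> v" "v \<le> w"
    then have "0 \<le> ev2 (Mop K U E) y v" using assms(5) by blast
    then have "0 \<le> ev2 (Mop K U E) y v / (of_int K)\<^sup>2 * exp (- (ev2 ?D y v / of_int K))"
      by (intro mult_nonneg_nonneg divide_nonneg_nonneg) (assumption | simp)+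
    then show "\<exists>d. (?g has_real_derivative d) (at v) \<and> d \<le> 0"
      unfolding Mop_def
      using path_derivative[where K = K and U = U and y = y and D = ?D and v = v, OF assms(2)]
      by (intro exI conjI) (assumption, simp only: neg_0_le_iff_le neg_le_0_iff_le)
  qed
  also have "?g 0 = 1"
    using assms(2,4) Dop_at_0[where K = K and us = us and y = y] by (simp add: U_def)
  finally show ?thesis by (simp only: mult_exp_minus_le_1 mult_exp_minus_ge_1)
qed

lemma path_lower:
  fixes us :: "int list list" and K :: int
  defines "U \<equiv> [K] # [- K, K] # us"
  assumes "K > 0" "0 \<le> w" "ev2 E y 0 = 0"
    and "\<And>v. 0 \<le> v \<Longrightarrow> v \<le> w \<Longrightarrow> ev2 (Mop K U E) y v \<le> 0"
  shows "exp (ev2 (badd (Dop K U) E) y w / of_int K) \<le> ev2 U y w / of_int K"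
proof -
  let ?D = "badd (Dop K U) E"
  let ?g = "\<lambda>v. ev2 U y v / of_int K * exp (- (ev2 ?D y v / of_int K))"
  have "?g 0 \<le> ?g w"
  proof (rule DERIV_nonneg_imp_nondecreasing[OF assms(3)])
    fix v assume "0 \<le> v" "v \<le> w"
    then have "ev2 (Mop K U E) y v \<le> 0" using assms(5) by blast
    then have "ev2 (Mop K U E) y v / (of_int K)\<^sup>2 * exp (- (ev2 ?D y v / of_int K)) \<le> 0"
      by (intro mult_nonpos_nonneg divide_nonpos_nonneg) (assumption | simp)+
    then show "\<exists>d. (?g has_real_derivative d) (at v) \<and> 0 \<le> d"
      unfolding Mop_def
      using path_derivative[where K = K and U = U and y = y and D = ?D and v = v, OF assms(2)]
      by (intro exI conjI) (assumption, simp only: neg_0_le_iff_le neg_le_0_iff_le)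
  qed
  also have "?g 0 = 1"
    using assms(2,4) Dop_at_0[where K = K and us = us and y = y] by (simp add: U_def)
  finally show ?thesis by (simp only: mult_exp_minus_le_1 mult_exp_minus_ge_1)
qed

text \<open>The curve \<open>v = exp (- y)\<close> over \<open>a \<le> x \<le> b\<close> together
  with the segments from it down to \<open>v = 0\<close> along which the paths run.\<close>

definition dom2 :: "real \<Rightarrow> real \<Rightarrow> real \<Rightarrow> real \<Rightarrow> bool" where
  "dom2 a b y v \<longleftrightarrow> ln a \<le> y \<and> y \<le> ln b \<and> 0 \<le> v \<and> v \<le> exp (- y)"

lemma dom2_ln: "3/2 \<le> a \<Longrightarrow> x \<in> {a..b} \<Longrightarrow> 0 \<le> v \<Longrightarrow> v \<le> 1 / x \<Longrightarrow> dom2 a b (ln x) v"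
  by (auto simp: dom2_def exp_minus inverse_eq_divide)

lemma supersolution_mono:
  fixes us :: "int list list" and K :: int
  defines "U \<equiv> [K] # [- K, K] # us"
  assumes "K > 0" "3/2 \<le> a" "a \<le> b"
    and "\<And>y v. dom2 a b y v \<Longrightarrow> 0 \<le> ev2 (Mop K U []) y v"
    and "\<And>y v. dom2 a b y v \<Longrightarrow> 1/5 \<le> ev2 U y v / of_int K"
  shows "defect (barrier K U) a \<le> defect (barrier K U) b"
proof (rule defect_mono[OF assms(4,3)])
  fix x assume x: "x \<in> {a..b}"
  then have "x > 0" using assms(3) by auto
  show u: "1 / 5 \<le> barrier K U x"
    using assms(6)[OF dom2_ln[OF assms(3) x, of "1 / x"]] \<open>x > 0\<close> by (simp add: barrier_def)
  show "(barrier K U has_real_derivative barrier' K U x) (at x)"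
    using \<open>x > 0\<close> by (rule barrier_has_derivative)
  have "barrier K U x \<le> exp (ev2 (badd (Dop K U) []) (ln x) (1 / x) / of_int K)"
    unfolding barrier_def U_def
    by (rule path_upper)
       (use assms(2) \<open>x > 0\<close> assms(5)[OF dom2_ln[OF assms(3) x]] in \<open>auto simp: U_def\<close>)
  also have "ev2 (badd (Dop K U) []) (ln x) (1 / x) / of_int K =
      barrier K U x + x * (barrier K U x - 1) + x * barrier' K U x - ln x"
    unfolding U_def by (subst Dop_eq[OF \<open>x > 0\<close> assms(2)]) simp
  finally have "ln (barrier K U x) \<le> ln (exp (barrier K U x + x * (barrier K U x - 1) + x * barrier' K U x - ln x))"
    using u by (subst ln_le_cancel_iff) auto
  then show "ln (barrier K U x) \<le> barrier K U x + x * (barrier K U x - 1) + x * barrier' K U x - ln x"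
    by simp
qed

text \<open>\<open>E\<close> may be any polynomial that vanishes at \<open>v = 0\<close> and is
  nonnegative on the curve itself: only the end of each path matters, and enlarging \<open>D\<close>
  there strengthens the inequality. Off the curve \<open>E\<close> can have either sign, which is
  the freedom that \<open>lower_phase\<close> exploits.\<close>

lemma subsolution_antimono:
  fixes us :: "int list list" and K :: int
  defines "U \<equiv> [K] # [- K, K] # us"
  assumes "K > 0" "3/2 \<le> a" "a \<le> b" "\<And>y. ev2 E y 0 = 0"
    and "\<And>x. x \<in> {a..b} \<Longrightarrow> 0 \<le> ev2 E (ln x) (1 / x)"
    and "\<And>y v. dom2 a b y v \<Longrightarrow> ev2 (Mop K U E) y v \<le> 0"
    and "\<And>y v. dom2 a b y v \<Longrightarrow> 1/5 \<le> ev2 U y v / of_int K"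
  shows "defect (barrier K U) b \<le> defect (barrier K U) a"
proof (rule defect_antimono[OF assms(4,3)])
  fix x assume x: "x \<in> {a..b}"
  then have "x > 0" using assms(3) by auto
  show u: "1 / 5 \<le> barrier K U x"
    using assms(8)[OF dom2_ln[OF assms(3) x, of "1 / x"]] \<open>x > 0\<close> by (simp add: barrier_def)
  show "(barrier K U has_real_derivative barrier' K U x) (at x)"
    using \<open>x > 0\<close> by (rule barrier_has_derivative)
  have "barrier K U x + x * (barrier K U x - 1) + x * barrier' K U x - ln x
      = ev2 (Dop K U) (ln x) (1 / x) / of_int K"
    unfolding U_def by (rule Dop_eq[OF \<open>x > 0\<close> assms(2)])
  also have "\<dots> \<le> ev2 (badd (Dop K U) E) (ln x) (1 / x) / of_int K"
    using assms(2) assms(6)[OF x] by (simp add: divide_right_mono)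
  finally have "exp (barrier K U x + x * (barrier K U x - 1) + x * barrier' K U x - ln x)
      \<le> exp (ev2 (badd (Dop K U) E) (ln x) (1 / x) / of_int K)" by simp
  also have "\<dots> \<le> barrier K U x"
    unfolding barrier_def U_def
    by (rule path_lower)
       (use assms(2,5) \<open>x > 0\<close> assms(7)[OF dom2_ln[OF assms(3) x]] in \<open>auto simp: U_def\<close>)
  finally show "barrier K U x + x * (barrier K U x - 1) + x * barrier' K U x - ln x \<le> ln (barrier K U x)"
    using u by (subst ln_ge_iff) auto
qed

section \<open>Fixed-point evaluation\<close>

text \<open>Fixed-point Horner evaluation, rounding down: a lower bound for a polynomial with
  coefficients \<open>cs\<close> over the interval from \<open>a / 2 ^ k\<close> to \<open>b / 2 ^ k\<close>.\<close>
fun lowH :: "int \<Rightarrow> int \<Rightarrow> nat \<Rightarrow> int list \<Rightarrow> int" where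
  "lowH a b k [] = 0"
| "lowH a b k (c # cs) =
    (let r = lowH a b k cs in c + drop_bit k ((if r \<ge> 0 then a else b) * r))"

lemma of_int_div_le: "d > 0 \<Longrightarrow> real_of_int (a div d) \<le> of_int a / of_int d"
  by (metis floor_divide_of_int_eq of_int_floor_le of_int_0_less_iff)

lemma of_int_drop_bit_le: "real_of_int (drop_bit k a) \<le> of_int a / 2 ^ k"
  using of_int_div_le[of "2 ^ k" a] by (simp add: drop_bit_eq_div)

text \<open>The coefficients may themselves be mere lower bounds, so the evaluation nests: inner
  results in one variable become the coefficients in the other. The sign of the partial result
  decides which endpoint minimises the product.\<close>

lemma lowH_le:
  assumes "0 \<le> a" "of_int a / 2 ^ k \<le> x" "x \<le> of_int b / 2 ^ k"
    and "\<And>p. p \<in> set ps \<Longrightarrow> of_int (l p) \<le> (f p :: real)"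
  shows "of_int (lowH a b k (map l ps)) \<le> horner_sum f x ps"
  using assms(4)
proof (induction ps)
  case (Cons p ps)
  define r where "r = lowH a b k (map l ps)"
  have IH: "of_int r \<le> horner_sum f x ps" using Cons by (simp add: r_def)
  have "0 \<le> of_int a / (2 ^ k :: real)" using assms(1) by simp
  then have x: "0 \<le> x" using assms(2) by linarith
  let ?e = "if r \<ge> 0 then a else b"
  have "of_int (drop_bit k (?e * r)) \<le> of_int (?e * r) / (2 ^ k :: real)"
    by (rule of_int_drop_bit_le)
  also have "\<dots> = of_int ?e / 2 ^ k * of_int r" by simp
  also have "\<dots> \<le> x * of_int r"
  proof (cases "r \<ge> 0")
    case True
    then have "of_int a / 2 ^ k * of_int r \<le> x * of_int r" using assms(2) by (intro mult_right_mono) auto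
    then show ?thesis using True by simp
  next
    case False
    then have "of_int b / 2 ^ k * of_int r \<le> x * of_int r" using assms(3) by (intro mult_right_mono_neg) auto
    then show ?thesis using False by simp
  qed
  also have "\<dots> \<le> x * horner_sum f x ps" using x IH by (intro mult_left_mono)
  finally show ?case using Cons.prems by (simp add: Let_def r_def[symmetric] add_mono)
qed simp

lemma lowH_ev_le:
  assumes "0 \<le> a" "of_int a / 2 ^ k \<le> x" "x \<le> of_int b / 2 ^ k"
  shows "of_int (lowH a b k cs) \<le> ev cs x"
  using lowH_le[OF assms, of cs id of_int] by simp

lemma Ttail_partial_sum:
  fixes f :: "nat \<Rightarrow> real"
  assumes f: "\<And>k. 0 \<le> f k \<and> f k \<le> 1"
  shows "Ttail f 0 u = (\<Sum>k<n. f k * u ^ k / fact k) + u ^ n / fact n * Ttail f n u"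
proof (induction n)
  case (Suc n)
  have r: "Ttail f n u = f n + u / real (n + 1) * Ttail f (n + 1) u" by (rule Ttail_rec[OF f])
  show ?case unfolding Suc r by (simp add: algebra_simps add_divide_distrib)
qed simp

lemma Gser_eq_Ttail0: "Gser u = Ttail (\<lambda>k. 1 / real k) 0 u"
  unfolding Gser_def Ttail_def by (intro suminf_cong) simp

lemma inverse_nat_bounds: "0 \<le> 1 / real k \<and> 1 / real k \<le> 1"
  by (cases k) auto

lemma ev_le_Ttail:
  fixes f :: "nat \<Rightarrow> real"
  assumes f: "\<And>k. 0 \<le> f k \<and> f k \<le> 1" and "0 \<le> u" "0 < B" "0 \<le> S"
    and c: "\<And>i. i < length cs \<Longrightarrow> of_int (cs ! i) \<le> S * f i * B ^ i / fact i"
  shows "ev cs (u / B) \<le> S * Ttail f 0 u"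
proof -
  have "ev cs (u / B) = (\<Sum>i<length cs. of_int (cs ! i) * (u / B) ^ i)"
    by (simp add: horner_sum_eq_sum atLeast0LessThan)
  also have "\<dots> \<le> (\<Sum>i<length cs. (S * f i * B ^ i / fact i) * (u / B) ^ i)"
    using c assms(2,3) by (intro sum_mono mult_right_mono) auto
  also have "\<dots> = S * (\<Sum>i<length cs. f i * u ^ i / fact i)"
    using assms(3) by (simp add: sum_distrib_left power_divide mult_ac)
  also have "\<dots> \<le> S * Ttail f 0 u"
    using Ttail_nonneg[of f u "length cs", OF f assms(2)] assms(2,4)
    by (subst Ttail_partial_sum[where n = "length cs", OF f]) (auto intro!: mult_left_mono)
  finally show ?thesis .
qed

text \<open>The last coefficient is doubled, since \<open>Ttail f n u \<le> 2\<close> lets it absorb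
  the entire tail.\<close>

lemma Ttail_le_ev:
  fixes f :: "nat \<Rightarrow> real"
  assumes f: "\<And>k. 0 \<le> f k \<and> f k \<le> 1" and "0 \<le> u" "u \<le> B" "0 < B" "0 \<le> S"
    and len: "length cs = Suc n" "2 * u \<le> real (n + 1)"
    and c: "\<And>i. i < n \<Longrightarrow> S * f i * B ^ i / fact i \<le> of_int (cs ! i)"
    and cn: "2 * S * B ^ n / fact n \<le> of_int (cs ! n)"
  shows "S * Ttail f 0 u \<le> ev cs (u / B)"
proof -
  have t: "Ttail f n u \<le> 2" using Ttail_abs_le_2[of f u n, OF f] len(2) assms(2) by simp
  have "S * Ttail f 0 u = S * (\<Sum>i<n. f i * u ^ i / fact i) + S * (u ^ n / fact n * Ttail f n u)"
    by (subst Ttail_partial_sum[where n = n, OF f]) (simp add: algebra_simps)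
  also have "\<dots> \<le> S * (\<Sum>i<n. f i * u ^ i / fact i) + S * (u ^ n / fact n * 2)"
    using t assms by (intro add_left_mono mult_left_mono) auto
  also have "\<dots> = (\<Sum>i<n. (S * f i * B ^ i / fact i) * (u / B) ^ i) + (2 * S * B ^ n / fact n) * (u / B) ^ n"
    using assms(4) by (simp add: sum_distrib_left power_divide mult_ac)
  also have "\<dots> \<le> (\<Sum>i<n. of_int (cs ! i) * (u / B) ^ i) + of_int (cs ! n) * (u / B) ^ n"
    using c cn assms(2,4) by (intro add_mono sum_mono mult_right_mono) auto
  also have "\<dots> = ev cs (u / B)" by (simp add: horner_sum_eq_sum len atLeast0LessThan)
  finally show ?thesis .
qed

text \<open>The entries are \<open>2\<^sup>4\<^sup>0 * 16\<^sup>k / k!\<close>, \<open>2\<^sup>4\<^sup>0 * 16\<^sup>k / (k * k!)\<close> and \<open>2\<^sup>3\<^sup>0 * 8\<^sup>k / k!\<close>, rounded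
  down; adding \<open>1\<close> to each entry of the first two also covers the remainder of the series.\<close>
definition expT :: "int list" where
  "expT = [1099511627776, 17592186044416, 140737488355328, 750599937895082, 3002399751580330,
    9607679205057058, 25620477880152155, 58561092297490640, 117122184594981280,
    208217217057744497, 333147547292391196, 484578250607114467, 646104334142819290,
    795205334329623742, 908806096376712848, 969393169468493704, 969393169468493704,
    912370041852699957, 810995592757955517, 682943657059330962, 546354925647464769,
    416270419540925538, 302742123302491301, 210603216210428731, 140402144140285820,
    89857372249782925, 55296844461404877, 32768500421573260, 18724857383756148,
    10330955797934426, 5509843092231694, 2843789983087326, 1421894991543663, 689403632263594,
    324425238712279, 148308680554184, 65914969135193, 28503770436840, 12001587552353,
    4923728226606, 1969491290642, 768581967080, 292793130316, 108946281047, 39616829471,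
    14085983812, 4899472630, 1667905576, 555968525, 181540742, 58093037, 18225266, 5607774,
    1692913, 501603, 145921, 41691, 11702, 3228, 875, 233, 61, 15, 4, 1, 0, 0]"

definition GserT :: "int list" where
  "GserT = [0, 17592186044416, 70368744177664, 250199979298360, 750599937895082, 1921535841011411,
    4270079646692025, 8365870328212948, 14640273074372660, 23135246339749388,
    33314754729239119, 44052568237010406, 53842027845234940, 61169641102278749,
    64914721169765203, 64626211297899580, 60587073091780856, 53668825991335291,
    45055310708775306, 35944403003122682, 27317746282373238, 19822400930520263,
    13761005604658695, 9156661574366466, 5850089339178575, 3594294889991317, 2126801710054033,
    1213648163761972, 668744906562719, 356239855101187, 183661436407723, 91735160744752,
    44434218485739, 20891019159502, 9541918785655, 4237390872976, 1830971364866, 770372173968,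
    315831251377, 126249441707, 49237282266, 18745901636, 6971265007, 2533634442, 900382487,
    313021862, 106510274, 35487352, 11582677, 3704913, 1161860, 357358, 107841, 31941, 9288,
    2653, 744, 205, 55, 14, 3, 1, 0, 0, 0, 0, 0]"

definition exp8T :: "int list" where
  "exp8T = [1073741824, 8589934592, 34359738368, 91625968981, 183251937962, 293203100740, 390937467653,
    446785677318, 446785677318, 397142824283, 317714259426, 231064915946, 154043277297,
    94795862952, 54169064544, 28890167756, 14445083878, 6797686531, 3021194013, 1272081690,
    508832676]"

text \<open>One pass with running products: at index \<open>i\<close> the argument \<open>S\<close>
  holds the scale times \<open>B ^ i\<close> and \<open>F\<close> holds \<open>i!\<close>, and each
  rounded quotient is checked by cross multiplication. The flag selects the denominators
  \<open>i * i!\<close> of \<open>Gser\<close>.\<close>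

fun tab_check :: "bool \<Rightarrow> int \<Rightarrow> int \<Rightarrow> int \<Rightarrow> int \<Rightarrow> int list \<Rightarrow> bool" where
  "tab_check g B i S F [] = True"
| "tab_check g B i S F (c # cs) \<longleftrightarrow>
    (let G = (if g then i * F else F) in c * G \<le> S \<and> S \<le> (c + 1) * G \<and>
      tab_check g B (i + 1) (S * B) (F * (i + 1)) cs)"

lemma tab_check_nth:
  assumes "tab_check g (int B) (int i) (S * int B ^ i) (fact i) cs" "j < length cs"
  shows "cs ! j * ((if g then int (i + j) else 1) * fact (i + j)) \<le> S * int B ^ (i + j)
    \<and> S * int B ^ (i + j) \<le> (cs ! j + 1) * ((if g then int (i + j) else 1) * fact (i + j))"
  using assms
proof (induction cs arbitrary: i j)
  case (Cons c cs)
  show ?case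
  proof (cases j)
    case 0
    then show ?thesis using Cons.prems by (cases g) (auto simp: Let_def)
  next
    case (Suc j')
    have "tab_check g (int B) (int (Suc i)) (S * int B ^ Suc i) (fact (Suc i)) cs"
      using Cons.prems(1) by (simp add: Let_def mult_ac add_ac)
    moreover have "j' < length cs" "i + j = Suc i + j'" "(c # cs) ! j = cs ! j'"
      using Cons.prems(2) Suc by auto
    ultimately show ?thesis using Cons.IH by metis
  qed
qed simp

lemma expT_check: "tab_check False 16 0 1099511627776 1 expT"
  by code_simp

text \<open>The head of the table belongs to \<open>1 / 0 = 0\<close>, so the check starts at index
  \<open>1\<close> with \<open>2 ^ 40 * 16\<close>.\<close>

lemma GserT_check: "tab_check True 16 1 17592186044416 1 (tl GserT)"
  by code_simp

lemma exp8T_check: "tab_check False 8 0 1073741824 1 exp8T"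
  by code_simp

lemma expT_length: "length expT = Suc 66" "expT ! 66 = 0"
  by (simp_all add: expT_def)

lemma GserT_length: "length GserT = Suc 66" "GserT ! 66 = 0" "GserT ! 0 = 0"
  by (simp_all add: GserT_def)

lemma expT_nth:
  assumes "i < 67"
  shows "of_int (expT ! i) \<le> (2 ^ 40 * 1 * 16 ^ i / fact i :: real)"
    and "2 ^ 40 * 1 * 16 ^ i / fact i \<le> (of_int (expT ! i) + 1 :: real)"
proof -
  have "expT ! i * (1 * fact i) \<le> 2 ^ 40 * 16 ^ i \<and> 2 ^ 40 * 16 ^ i \<le> (expT ! i + 1) * (1 * fact i)"
    using tab_check_nth[of False 16 0 "2 ^ 40" expT i] expT_check expT_length assms by simp
  then have "real_of_int (expT ! i * fact i) \<le> real_of_int (2 ^ 40 * 16 ^ i)"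
    "real_of_int (2 ^ 40 * 16 ^ i) \<le> real_of_int ((expT ! i + 1) * fact i)"
    unfolding of_int_le_iff by simp_all
  then show "of_int (expT ! i) \<le> (2 ^ 40 * 1 * 16 ^ i / fact i :: real)"
    "2 ^ 40 * 1 * 16 ^ i / fact i \<le> (of_int (expT ! i) + 1 :: real)"
    by (simp_all add: pos_le_divide_eq pos_divide_le_eq)
qed

lemma GserT_nth:
  assumes "i < 67"
  shows "of_int (GserT ! i) \<le> (2 ^ 40 * (1 / real i) * 16 ^ i / fact i :: real)"
    and "2 ^ 40 * (1 / real i) * 16 ^ i / fact i \<le> (of_int (GserT ! i) + 1 :: real)"
proof -
  have "of_int (GserT ! i) \<le> (2 ^ 40 * (1 / real i) * 16 ^ i / fact i :: real) \<and>
    2 ^ 40 * (1 / real i) * 16 ^ i / fact i \<le> (of_int (GserT ! i) + 1 :: real)"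
  proof (cases i)
    case 0
    then show ?thesis using GserT_length by simp
  next
    case (Suc j)
    have "tl GserT ! j = GserT ! i" using GserT_length(1) Suc assms by (simp add: nth_tl)
    then have "GserT ! i * (int i * fact i) \<le> 2 ^ 40 * 16 ^ i \<and> 2 ^ 40 * 16 ^ i \<le> (GserT ! i + 1) * (int i * fact i)"
      using tab_check_nth[of True 16 1 "2 ^ 40" "tl GserT" j] GserT_check GserT_length(1) assms Suc by simp
    then have "real_of_int (GserT ! i * (int i * fact i)) \<le> real_of_int (2 ^ 40 * 16 ^ i)"
      "real_of_int (2 ^ 40 * 16 ^ i) \<le> real_of_int ((GserT ! i + 1) * (int i * fact i))"
      unfolding of_int_le_iff by simp_all
    moreover have "real i > 0" using Suc by simp
    ultimately show ?thesis
      by (simp add: pos_le_divide_eq pos_divide_le_eq mult_ac del: fact_Suc)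
  qed
  then show "of_int (GserT ! i) \<le> (2 ^ 40 * (1 / real i) * 16 ^ i / fact i :: real)"
    "2 ^ 40 * (1 / real i) * 16 ^ i / fact i \<le> (of_int (GserT ! i) + 1 :: real)" by auto
qed

text \<open>In the next four functions the argument \<open>t\<close> stands for the number \<open>t / 2 ^ 28\<close> and
  the result is scaled by \<open>2 ^ 40\<close>.\<close>
definition expL :: "int \<Rightarrow> int" where "expL t = lowH t t 32 expT"
definition expU :: "int \<Rightarrow> int" where "expU t = - lowH t t 32 (map (\<lambda>c. - (c + 1)) expT)"
definition GserL :: "int \<Rightarrow> int" where "GserL t = lowH t t 32 GserT"
definition GserU :: "int \<Rightarrow> int" where "GserU t = - lowH t t 32 (map (\<lambda>c. - (c + 1)) GserT)"

lemma fixed_div_16: "of_int t / 2 ^ 28 / 16 = (of_int t / 2 ^ 32 :: real)"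
  by simp

lemma expL_le:
  assumes "0 \<le> t"
  shows "of_int (expL t) \<le> 2 ^ 40 * exp (of_int t / 2 ^ 28 :: real)"
proof -
  have "of_int (expL t) \<le> ev expT (of_int t / 2 ^ 28 / 16)"
    unfolding expL_def fixed_div_16 using assms by (intro lowH_ev_le) auto
  also have "\<dots> \<le> 2 ^ 40 * Ttail (\<lambda>_. 1) 0 (of_int t / 2 ^ 28)"
    using expT_nth(1) expT_length(1) assms by (intro ev_le_Ttail) auto
  finally show ?thesis by (simp add: exp_eq_Ttail)
qed

lemma GserL_le:
  assumes "0 \<le> t"
  shows "of_int (GserL t) \<le> 2 ^ 40 * Gser (of_int t / 2 ^ 28 :: real)"
proof -
  have "of_int (GserL t) \<le> ev GserT (of_int t / 2 ^ 28 / 16)"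
    unfolding GserL_def fixed_div_16 using assms by (intro lowH_ev_le) auto
  also have "\<dots> \<le> 2 ^ 40 * Ttail (\<lambda>k. 1 / real k) 0 (of_int t / 2 ^ 28)"
    using GserT_nth(1) GserT_length(1) assms inverse_nat_bounds by (intro ev_le_Ttail) auto
  finally show ?thesis by (simp add: Gser_eq_Ttail0)
qed

lemma ev_map_uminus: "ev (map (\<lambda>c. - (c + 1)) p) x = - ev (map (\<lambda>c. c + 1) p) x"
  by (induction p) (auto simp: algebra_simps)

text \<open>At degree \<open>66\<close> the doubled last term is below one unit even at the right
  end \<open>16\<close>, so the entry \<open>0\<close> raised to \<open>1\<close> covers it.\<close>

lemma fact_66_bound: "2 * 2 ^ 40 * 16 ^ 66 / fact 66 \<le> (1::real)"
proof -
  have "2 * 2 ^ 40 * 16 ^ 66 \<le> (fact 66 :: real)" by (simp add: fact_numeral)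
  then show ?thesis by (simp only: divide_le_eq_1_pos fact_gt_zero)
qed

lemma expU_ge:
  assumes "0 \<le> t" "t \<le> 2 ^ 32"
  shows "2 ^ 40 * exp (of_int t / 2 ^ 28 :: real) \<le> of_int (expU t)"
proof -
  let ?u = "of_int t / 2 ^ 28 :: real"
  have u: "?u \<le> 16" using assms(2) by simp
  have "of_int (lowH t t 32 (map (\<lambda>c. - (c + 1)) expT)) \<le> ev (map (\<lambda>c. - (c + 1)) expT) (?u / 16)"
    unfolding fixed_div_16 using assms by (intro lowH_ev_le) auto
  then have "ev (map (\<lambda>c. c + 1) expT) (?u / 16) \<le> of_int (expU t)"
    unfolding ev_map_uminus expU_def by simp
  moreover have "2 ^ 40 * Ttail (\<lambda>_. 1) 0 ?u \<le> ev (map (\<lambda>c. c + 1) expT) (?u / 16)"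
  proof (rule Ttail_le_ev[where n = 66])
    show "2 * 2 ^ 40 * 16 ^ 66 / fact 66 \<le> real_of_int (map (\<lambda>c. c + 1) expT ! 66)"
      using fact_66_bound expT_length by simp
    fix i :: nat assume "i < 66"
    then show "2 ^ 40 * 1 * 16 ^ i / fact i \<le> real_of_int (map (\<lambda>c. c + 1) expT ! i)"
      using expT_nth(2)[of i] expT_length(1) by simp
  qed (use assms u expT_length(1) in auto)
  ultimately show ?thesis by (simp add: exp_eq_Ttail)
qed

lemma GserU_ge:
  assumes "0 \<le> t" "t \<le> 2 ^ 32"
  shows "2 ^ 40 * Gser (of_int t / 2 ^ 28 :: real) \<le> of_int (GserU t)"
proof -
  let ?u = "of_int t / 2 ^ 28 :: real"
  have u: "?u \<le> 16" using assms(2) by simp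
  have "of_int (lowH t t 32 (map (\<lambda>c. - (c + 1)) GserT)) \<le> ev (map (\<lambda>c. - (c + 1)) GserT) (?u / 16)"
    unfolding fixed_div_16 using assms by (intro lowH_ev_le) auto
  then have "ev (map (\<lambda>c. c + 1) GserT) (?u / 16) \<le> of_int (GserU t)"
    unfolding ev_map_uminus GserU_def by simp
  moreover have "2 ^ 40 * Ttail (\<lambda>k. 1 / real k) 0 ?u \<le> ev (map (\<lambda>c. c + 1) GserT) (?u / 16)"
  proof (rule Ttail_le_ev[where n = 66])
    show "2 * 2 ^ 40 * 16 ^ 66 / fact 66 \<le> real_of_int (map (\<lambda>c. c + 1) GserT ! 66)"
      using fact_66_bound GserT_length by simp
    fix i :: nat assume "i < 66"
    then show "2 ^ 40 * (1 / real i) * 16 ^ i / fact i \<le> real_of_int (map (\<lambda>c. c + 1) GserT ! i)"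
      using GserT_nth(2)[of i] GserT_length(1) by simp
  qed (use assms u GserT_length(1) inverse_nat_bounds in auto)
  ultimately show ?thesis by (simp add: Gser_eq_Ttail0)
qed

text \<open>The first list is a unary degree bound of which only the length counts. Excess
  coefficients must vanish; such trailing zeros are left behind by the list arithmetic.\<close>

fun fits :: "int list \<Rightarrow> int list \<Rightarrow> bool" where
  "fits [] p = list_all ((=) 0) p"
| "fits (z # zs) [] = True"
| "fits (z # zs) (a # p) = fits zs p"

text \<open>Pads \<open>p\<close> with zeros to the length of \<open>z\<close> and reverses it onto the accumulator; this
  turns a polynomial in \<open>y\<close> into one in \<open>1 / y\<close>.\<close>
fun hrow :: "int list \<Rightarrow> int list \<Rightarrow> int list \<Rightarrow> int list" where
  "hrow [] p acc = acc"
| "hrow (z # zs) [] acc = hrow zs [] (0 # acc)"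
| "hrow (z # zs) (a # p) acc = hrow zs p (a # acc)"

lemma ev_zero_list: "list_all ((=) 0) p \<Longrightarrow> ev p y = 0"
  by (induction p) auto

lemma ev_hrow:
  assumes "y > 0" "fits z p"
  shows "ev (hrow z p acc) (1 / y) = (1 / y) ^ length z * (ev acc (1 / y) + y * ev p y)"
  using assms(2)
proof (induction z arbitrary: p acc)
  case Nil
  then show ?case by (simp add: ev_zero_list)
next
  case (Cons z zs)
  show ?case
  proof (cases p)
    case Nil
    have "fits zs []" by (cases zs) auto
    from Cons.IH[OF this] show ?thesis using Nil by simp
  next
    case [simp]: (Cons a p')
    have "ev (hrow (z # zs) p acc) (1 / y) = ev (hrow zs p' (a # acc)) (1 / y)" by simp
    also have "\<dots> = (1 / y) ^ length zs * (of_int a + 1 / y * ev acc (1 / y) + y * ev p' y)"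
      using Cons.prems by (subst Cons.IH) auto
    also have "of_int a + 1 / y * ev acc (1 / y) + y * ev p' y = (1 / y) * (ev acc (1 / y) + y * ev p y)"
      using assms(1) by (simp add: field_simps)
    finally show ?thesis by (simp add: mult_ac)
  qed
qed

text \<open>With \<open>d + 1 = length z\<close>, a monomial \<open>y ^ i * v ^ j\<close> equals
  \<open>y ^ d * (1 / y) ^ (d + j - i) * (y * v) ^ j\<close>; hence the degree bound grows by one
  from row to row.\<close>

fun homs :: "int list \<Rightarrow> int list list \<Rightarrow> int list list" where
  "homs z [] = []"
| "homs z (r # rs) = hrow z r [] # homs (0 # z) rs"

fun fitss :: "int list \<Rightarrow> int list list \<Rightarrow> bool" where
  "fitss z [] = True"
| "fitss z (r # rs) = (fits z r \<and> fitss (0 # z) rs)"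

lemma ev2_homs:
  assumes "y > 0" "fitss z rs"
  shows "ev2 (homs z rs) (1 / y) (y * v) = (1 / y) ^ length z * y * ev2 rs y v"
  using assms(2)
proof (induction rs arbitrary: z)
  case (Cons r rs)
  have "ev2 (homs z (r # rs)) (1 / y) (y * v)
      = (1 / y) ^ length z * y * ev r y + y * v * ((1 / y) ^ length (0 # z) * y * ev2 rs y v)"
    using Cons.IH[of "0 # z"] Cons.prems ev_hrow[OF assms(1), of z r "[]"] by simp
  also have "\<dots> = (1 / y) ^ length z * y * ev2 (r # rs) y v"
    using assms(1) by (simp add: field_simps)
  finally show ?case .
qed simp

lemma ev_map_drop_bit_le:
  assumes "0 \<le> a" "of_int a / 2 ^ k \<le> x" "x \<le> of_int b / 2 ^ k"
  shows "of_int (lowH a b k (map (drop_bit s) cs)) \<le> ev cs x / 2 ^ s"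
proof -
  have "of_int (lowH a b k (map (drop_bit s) cs)) \<le> horner_sum (\<lambda>c. of_int c / 2 ^ s) x cs"
    by (rule lowH_le[OF assms]) (rule of_int_drop_bit_le)
  also have "\<dots> = ev cs x / 2 ^ s"
    by (induction cs) (auto simp: add_divide_distrib)
  finally show ?thesis .
qed

text \<open>\<open>piece\<close> certifies nonnegativity for \<open>lo \<le> 2\<^sup>1\<^sup>4 / y \<le> hi\<close>. The bound
  \<open>y * v \<le> y * exp (- y) \<le> Tn / 2\<^sup>1\<^sup>4\<close> comes from the end of the interval nearest to \<open>y = 1\<close>,
  with \<open>t / 2\<^sup>1\<^sup>1\<close> a lower bound for \<open>y\<close> there.\<close>
definition piece :: "int list list \<Rightarrow> int \<Rightarrow> int \<Rightarrow> int \<Rightarrow> int \<Rightarrow> bool" where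
  "piece H lo hi Tn t \<longleftrightarrow>
    (let c = (if hi \<le> 16384 then hi else if 16384 \<le> lo then lo else 16384) in
      0 \<le> lo \<and> lo \<le> hi \<and> 0 < c \<and> 0 \<le> Tn \<and> 0 \<le> t \<and> t * c \<le> 33554432 \<and>
      288230376151711744 \<le> c * Tn * lowH t t 14 exp8T) \<and>
    0 \<le> lowH 0 Tn 14 (map (lowH lo hi 14) H)"

fun pieces :: "int list list \<Rightarrow> int \<Rightarrow> (int \<times> int \<times> int) list \<Rightarrow> int \<Rightarrow> bool" where
  "pieces H hi [] lst \<longleftrightarrow> hi \<le> lst"
| "pieces H hi ((lo, Tn, t) # ps) lst \<longleftrightarrow> piece H lo hi Tn t \<and> pieces H lo ps lst"

lemma exp8T_le:
  assumes "0 \<le> t"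
  shows "of_int (lowH t t 14 exp8T) \<le> 2 ^ 30 * exp (of_int t / 2 ^ 11 :: real)"
proof -
  have e: "of_int t / 2 ^ 11 / 8 = (of_int t / 2 ^ 14 :: real)" by simp
  have nth: "of_int (exp8T ! i) \<le> (2 ^ 30 * 1 * 8 ^ i / fact i :: real)" if "i < length exp8T" for i
  proof -
    have "exp8T ! i * (1 * fact i) \<le> 2 ^ 30 * 8 ^ i"
      using tab_check_nth[of False 8 0 "2 ^ 30" exp8T i] exp8T_check that by simp
    then have "real_of_int (exp8T ! i * fact i) \<le> real_of_int (2 ^ 30 * 8 ^ i)"
      unfolding of_int_le_iff by simp
    then show ?thesis by (simp add: pos_le_divide_eq)
  qed
  have "of_int (lowH t t 14 exp8T) \<le> ev exp8T (of_int t / 2 ^ 11 / 8)"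
    unfolding e using assms by (intro lowH_ev_le) auto
  also have "\<dots> \<le> 2 ^ 30 * Ttail (\<lambda>_. 1) 0 (of_int t / 2 ^ 11)"
    using nth assms by (intro ev_le_Ttail) auto
  finally show ?thesis by (simp add: exp_eq_Ttail)
qed

lemma piece_nonneg:
  assumes "piece (map (map (drop_bit s)) H) lo hi Tn t" "y > 0" "0 \<le> v" "v \<le> exp (- y)"
    and "of_int lo / 2 ^ 14 \<le> 1 / y" "1 / y \<le> of_int hi / 2 ^ 14"
  shows "0 \<le> ev2 H (1 / y) (y * v)"
proof -
  define c where "c = (if hi \<le> 16384 then hi else if 16384 \<le> lo then lo else 16384)"
  have c: "0 < c" "288230376151711744 \<le> c * Tn * lowH t t 14 exp8T" "0 \<le> lo" "lo \<le> hi"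
    "0 \<le> Tn" "0 \<le> t" "t * c \<le> 33554432"
    using assms(1) by (auto simp: piece_def c_def Let_def)
  define y0 :: real where "y0 = 2 ^ 14 / of_int c"
  have y0: "y0 > 0" using c by (simp add: y0_def)
  have "0 \<le> (y - y0) * (y0 - 1)"
  proof -
    consider "hi \<le> 16384" "c = hi" | "c = lo" "16384 \<le> lo" | "c = 16384"
      by (cases "hi \<le> 16384"; cases "16384 \<le> lo") (auto simp: c_def)
    then show ?thesis
    proof cases
      case 1
      then have "y0 \<le> y" "1 \<le> y0" using assms c by (auto simp: y0_def field_simps)
      then show ?thesis by simp
    next
      case 2
      then have "y \<le> y0" "y0 \<le> 1" using assms c by (auto simp: y0_def field_simps)
      then show ?thesis by (simp add: mult_nonpos_nonpos)
    next
      case 3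
      then show ?thesis by (simp add: y0_def)
    qed
  qed
  then have "y * exp (- y) \<le> y0 * exp (- y0)" using y0 by (intro mult_exp_minus_le) auto
  also have "y0 * exp (- y0) \<le> of_int Tn / 2 ^ 14"
  proof -
    have "real_of_int (t * c) \<le> real_of_int 33554432"
      using c(7) of_int_le_iff by blast
    then have "of_int t / 2 ^ 11 \<le> y0" using c(1) by (simp add: y0_def field_simps)
    then have e: "2 ^ 30 * exp (of_int t / 2 ^ 11) \<le> 2 ^ 30 * exp y0" by simp
    \<comment> \<open>The exponent collects the scales: \<open>30\<close> for the table of
      \<open>exp\<close>, \<open>14\<close> for \<open>c\<close> and \<open>14\<close> for
      \<open>Tn\<close>.\<close>
    have "(2::real) ^ 58 = real_of_int 288230376151711744" by simp
    also have "\<dots> \<le> of_int (c * Tn * lowH t t 14 exp8T)" using c(2) of_int_le_iff by blast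
    also have "\<dots> = of_int (c * Tn) * of_int (lowH t t 14 exp8T)" by simp
    also have "\<dots> \<le> of_int (c * Tn) * (2 ^ 30 * exp y0)"
      using order_trans[OF exp8T_le[OF c(6)] e] c by (intro mult_left_mono) auto
    finally have "2 ^ 30 * (2 ^ 28) \<le> 2 ^ 30 * (of_int c * of_int Tn * exp y0)" by (simp add: mult_ac)
    then have "2 ^ 28 \<le> of_int c * of_int Tn * exp y0" by (rule mult_left_le_imp_le) simp
    then show ?thesis using c(1) by (simp add: y0_def exp_minus field_simps)
  qed
  finally have T: "y * exp (- y) \<le> of_int Tn / 2 ^ 14" .
  have "y * v \<le> y * exp (- y)" using assms by (intro mult_left_mono) auto
  with T have T: "y * v \<le> of_int Tn / 2 ^ 14" by linarith
  have "of_int (lowH 0 Tn 14 (map (\<lambda>r. lowH lo hi 14 (map (drop_bit s) r)) H))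
      \<le> horner_sum (\<lambda>r. ev r (1 / y) / 2 ^ s) (y * v) H"
    using T assms c by (intro lowH_le ev_map_drop_bit_le) auto
  moreover have "0 \<le> lowH 0 Tn 14 (map (\<lambda>r. lowH lo hi 14 (map (drop_bit s) r)) H)"
    using assms(1) by (simp add: piece_def comp_def)
  ultimately have "0 \<le> horner_sum (\<lambda>r. ev r (1 / y) / 2 ^ s) (y * v) H"
    by (meson of_int_0_le_iff order_trans)
  also have "\<dots> = ev2 H (1 / y) (y * v) / 2 ^ s"
    by (induction H) (auto simp: add_divide_distrib)
  finally have "0 \<le> ev2 H (1 / y) (y * v) / 2 ^ s * 2 ^ s" by (rule mult_nonneg_nonneg) simp
  then show ?thesis by simp
qed

text \<open>The pieces descend from \<open>hi\<close>. The bound at \<open>lst\<close> is strict, so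
  nothing remains once \<open>hi \<le> lst\<close>; with \<open>lst = 0\<close> this reaches all
  large \<open>y\<close>.\<close>

lemma pieces_nonneg:
  assumes "pieces (map (map (drop_bit s)) H) hi ps lst" "y > 0" "0 \<le> v" "v \<le> exp (- y)"
    and "of_int lst / 2 ^ 14 < 1 / y" "1 / y \<le> of_int hi / 2 ^ 14"
  shows "0 \<le> ev2 H (1 / y) (y * v)"
  using assms(1,6)
proof (induction ps arbitrary: hi)
  case Nil
  then have "hi \<le> lst" by simp
  then have "real_of_int hi / 2 ^ 14 \<le> of_int lst / 2 ^ 14" by (simp add: divide_right_mono)
  then show ?case using Nil.prems(2) assms(5) by linarith
next
  case (Cons q ps)
  obtain lo Tn t where q: "q = (lo, Tn, t)" by (cases q)
  show ?case
  proof (cases "of_int lo / 2 ^ 14 \<le> 1 / y")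
    case True
    then show ?thesis using Cons.prems assms q by (intro piece_nonneg[of s H lo hi Tn t]) auto
  next
    case False
    then show ?thesis using Cons.prems q by (intro Cons.IH[of lo]) auto
  qed
qed

text \<open>The length of \<open>z\<close> fixes the degree to which the first nonzero row is homogenised.\<close>
definition nonneg_check :: "nat \<Rightarrow> int list \<Rightarrow> int list list \<Rightarrow> int \<Rightarrow> (int \<times> int \<times> int) list \<Rightarrow> int \<Rightarrow> bool" where
  "nonneg_check s z P hi ps lst \<longleftrightarrow>
    (let R = dropWhile (list_all ((=) 0)) P in
      fitss z R \<and> pieces (map (map (drop_bit s)) (homs z R)) hi ps lst)"

text \<open>The initial zero rows, which come from the choice of the \<open>P_n\<close>, only
  contribute a factor \<open>v ^ k \<ge> 0\<close>.\<close>

lemma ev2_dropWhile_zero: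
  "0 \<le> v \<Longrightarrow> 0 \<le> ev2 (dropWhile (list_all ((=) 0)) P) y v \<Longrightarrow> 0 \<le> ev2 P y v"
  by (induction P) (auto simp: ev_zero_list split: if_splits)

lemma nonneg_check_sound:
  assumes "nonneg_check s z P hi ps lst" "y > 0" "0 \<le> v" "v \<le> exp (- y)"
    and "of_int lst / 2 ^ 14 < 1 / y" "1 / y \<le> of_int hi / 2 ^ 14"
  shows "0 \<le> ev2 P y v"
proof (rule ev2_dropWhile_zero[OF assms(3)])
  define R where "R = dropWhile (list_all ((=) 0)) P"
  have c: "fitss z R" "pieces (map (map (drop_bit s)) (homs z R)) hi ps lst"
    using assms(1) by (auto simp: nonneg_check_def R_def Let_def)
  have "0 \<le> ev2 (homs z R) (1 / y) (y * v)"
    using pieces_nonneg[OF c(2) assms(2-6)] .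
  also have "\<dots> = (1 / y) ^ length z * y * ev2 R y v"
    by (rule ev2_homs[OF assms(2) c(1)])
  finally have "0 \<le> (1 / y) ^ length z * y * ev2 R y v" .
  moreover have "0 < (1 / y) ^ length z * y" using assms(2) by simp
  ultimately show "0 \<le> ev2 R y v" by (metis mult_less_0_iff not_less)
qed

section \<open>The polynomials and the initial values\<close>

text \<open>The polynomials \<open>10080 * P\<^sub>n\<close> for \<open>n \<le> 10\<close>.\<close>
definition Qs :: "int list list" where
  "Qs = [[-10080, 10080],
    [-20160, 10080],
    [-55440, 30240, -5040],
    [-220080, 141120, -35280, 3360],
    [-1119720, 801360, -246960, 38640, -2520],
    [-6848856, 5280240, -1849680, 367920, -41160, 2016],
    [-48692196, 39524520, -15050280, 3450720, -501060, 43176, -1680],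
    [-393986388, 331677696, -133623840, 33551280, -5677140, 644448, -44856, 1440],
    [-3574364204, 3089582412, -1294495776, 345340240, -64391880, 8592444, -796712, 46296, -1260],
    [-35943771732, 31684496044, -13652825424, 3797328976, -755072360, 111619452, -12253304, 956824, -47556, 1120],
    [-396933701073, 355178441632, -156233057622, 44755805248, -9299062556, 1470749700, -179682482, 16711072, -1123983, 48676, -1008]]"

definition Qpoly :: "nat \<Rightarrow> real poly" where
  "Qpoly n = smult (1 / 10080) (Poly (map of_int (Qs ! n)))"

lemma poly_Poly_of_int: "poly (Poly (map of_int p)) y = ev p y"
  by (induction p) auto

lemma poly_Qpoly: "poly (Qpoly n) y = ev (Qs ! n) y / 10080"
  by (simp add: Qpoly_def poly_Poly_of_int)

lemma Pn_Qpoly: "n \<le> 10 \<Longrightarrow> Pn n = Qpoly n"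
proof (induction n rule: less_induct)
  case (less n)
  show ?case
  proof (cases n)
    case 0
    then show ?thesis by (simp add: Qpoly_def Qs_def)
  next
    case (Suc m)
    have IH: "Pn k = Qpoly k" if "k \<le> m" for k using less Suc that by auto
    have "Pn (Suc m) = smult (real (Suc m)) (Qpoly m) - pderiv (Qpoly m)
     + smult (1 / real (Suc m))
         (\<Sum>k\<in>{1..m}. smult (real k)
            (smult (real (k - 1)) (Qpoly (k - 1)) - Qpoly k - pderiv (Qpoly (k - 1))) * Qpoly (m - k))"
      unfolding Pn.simps by (intro arg_cong2[where f = "(+)"] arg_cong2[where f = "(-)"]
        arg_cong2[where f = smult] arg_cong[where f = pderiv] sum.cong arg_cong2[where f = "(*)"] refl IH) auto
    also have "\<dots> = Qpoly (Suc m)"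
    proof -
      have "m \<in> {0,1,2,3,4,5,6,7,8,9}" using less.prems Suc by auto
      then show ?thesis
        by (elim insertE emptyE; hypsubst)
           (simp_all add: Qpoly_def Qs_def pderiv_pCons numeral_eq_Suc sum.atLeast_Suc_atMost)
    qed
    finally show ?thesis using Suc by simp
  qed
qed

definition Ulist :: "nat \<Rightarrow> int list \<Rightarrow> int list list" where
  "Ulist N q = [10080] # take N Qs @ [q]"

abbreviation K0 :: int where "K0 \<equiv> 10080"

lemma Ulist_Cons: "N \<ge> 1 \<Longrightarrow> Ulist N q = [K0] # [- K0, K0] # (take (N - 1) (tl Qs) @ [q])"
  by (cases N) (auto simp: Ulist_def Qs_def)

definition partial_expansion :: "nat \<Rightarrow> real \<Rightarrow> real" where
  "partial_expansion N x = 1 + (\<Sum>n=1..N. poly (Pn (n - 1)) (ln x) / x ^ n)"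

lemma ev2_append: "ev2 (p @ q) y v = ev2 p y v + v ^ length p * ev2 q y v"
  by (induction p) (auto simp: algebra_simps)

lemma ev2_take_Qs:
  assumes "N \<le> 11"
  shows "ev2 (take N Qs) y v = (\<Sum>n<N. ev (Qs ! n) y * v ^ n)"
proof -
  have "length (take N Qs) = N" using assms by (simp add: Qs_def)
  then show ?thesis by (simp add: horner_sum_eq_sum atLeast0LessThan)
qed

lemma barrier_Ulist:
  assumes "N \<le> 11" "x > 0"
  shows "barrier K0 (Ulist N q) x = partial_expansion N x + ev q (ln x) / 10080 / x ^ (N + 1)"
proof -
  have len: "length (take N Qs) = N" using assms by (simp add: Qs_def)
  have "ev2 (Ulist N q) (ln x) (1 / x)
      = 10080 + 1 / x * ((\<Sum>n<N. ev (Qs ! n) (ln x) * (1 / x) ^ n) + (1 / x) ^ N * ev q (ln x))"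
    unfolding Ulist_def by (simp add: ev2_append len ev2_take_Qs[OF assms(1)] del: length_take)
  moreover have "(\<Sum>n=1..N. poly (Pn (n - 1)) (ln x) / x ^ n)
      = (\<Sum>n<N. ev (Qs ! n) (ln x) / 10080 / x ^ Suc n)"
    unfolding sum.shift_bounds_Suc_ivl[symmetric] using assms(1)
    by (intro sum.reindex_bij_witness[of _ Suc "\<lambda>n. n - 1"]) (auto simp: Pn_Qpoly poly_Qpoly)
  moreover have "(\<Sum>n<N. ev (Qs ! n) (ln x) / 10080 / x ^ Suc n)
      = 1 / x * (\<Sum>n<N. ev (Qs ! n) (ln x) * (1 / x) ^ n) / 10080"
    unfolding sum_distrib_left sum_divide_distrib
    by (intro sum.cong refl) (simp add: power_one_over)
  moreover have "1 / x * ((1 / x) ^ N * ev q (ln x)) / 10080 = ev q (ln x) / 10080 / x ^ (N + 1)"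
    by (simp add: power_one_over)
  ultimately show ?thesis
    unfolding barrier_def partial_expansion_def by (simp only: distrib_left add_divide_distrib)
qed

text \<open>Below, a point \<open>x\<close> is given by the integer \<open>an = 100 * x\<close>, and \<open>yl\<close>, \<open>yh\<close> are bounds for
  \<open>2\<^sup>2\<^sup>8 * ln x\<close>.\<close>
definition ln_enclosure :: "int \<Rightarrow> int \<Rightarrow> int \<Rightarrow> bool" where
  "ln_enclosure an yl yh \<longleftrightarrow> 0 < yl \<and> yl \<le> 4294967296 \<and> 0 \<le> yh \<and> 0 < an \<and>
    expU yl * 100 \<le> an * 1099511627776 \<and> an * 1099511627776 < expL yh * 100"

lemma ln_enclosure_sound:
  assumes "ln_enclosure an yl yh"
  shows "of_int yl / 2 ^ 28 \<le> ln (of_int an / 100 :: real)" "ln (of_int an / 100 :: real) < of_int yh / 2 ^ 28"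
    "0 < yl" "0 < an"
proof -
  note l = assms[unfolded ln_enclosure_def]
  have an: "0 < real_of_int an / 100" using l by simp
  have "2 ^ 40 * exp (of_int yl / 2 ^ 28) \<le> real_of_int (expU yl)" using l by (intro expU_ge) auto
  moreover have "real_of_int (expU yl * 100) \<le> real_of_int (an * 1099511627776)"
    unfolding of_int_le_iff using l by blast
  ultimately have "exp (of_int yl / 2 ^ 28) \<le> of_int an / (100 :: real)" by simp
  then show "of_int yl / 2 ^ 28 \<le> ln (of_int an / 100 :: real)" using an by (simp only: ln_ge_iff)
  have "real_of_int (expL yh) \<le> 2 ^ 40 * exp (of_int yh / 2 ^ 28)" using l by (intro expL_le) auto
  moreover have "real_of_int (an * 1099511627776) < real_of_int (expL yh * 100)"
    unfolding of_int_less_iff using l by blast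
  ultimately have "of_int an / (100 :: real) < exp (of_int yh / 2 ^ 28)" by simp
  then show "ln (of_int an / 100 :: real) < of_int yh / 2 ^ 28"
    using an by (metis ln_exp ln_less_cancel_iff exp_gt_zero)
  show "0 < yl" "0 < an" using l by auto
qed

text \<open>\<open>4398046511104 = 2 ^ 42\<close> is \<open>2 ^ 28 * 2 ^ 14\<close>: it translates
  bounds on \<open>2 ^ 28 * ln x\<close> into bounds on \<open>2 ^ 14 / y\<close>. The value
  \<open>lst = 0\<close> leaves the right end \<open>b\<close> arbitrary.\<close>

lemma nonneg_on_dom2:
  assumes "nonneg_check s z P hi ps lst" "ln_enclosure an yl yh" "4398046511104 \<le> yl * hi"
    and "lst = 0 \<or> (\<exists>bn yl' yh'. b = of_int bn / 100 \<and> ln_enclosure bn yl' yh' \<and> 0 < lst \<and> lst * yh' \<le> 4398046511104)"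
    and "dom2 (of_int an / 100) b y v"
  shows "0 \<le> ev2 P y v"
proof (rule nonneg_check_sound[OF assms(1)])
  have y: "of_int yl / 2 ^ 28 \<le> y" "y \<le> ln b" "0 \<le> v" "v \<le> exp (- y)"
    using assms(5) ln_enclosure_sound(1)[OF assms(2)] by (auto simp: dom2_def)
  have yl: "0 < of_int yl / (2 ^ 28 :: real)" using ln_enclosure_sound(3)[OF assms(2)] by simp
  show y0: "0 < y" using y(1) yl by linarith
  show "0 \<le> v" "v \<le> exp (- y)" using y by auto
  have hi: "0 < hi"
    using assms(3) ln_enclosure_sound(3)[OF assms(2)] by (metis less_le_trans zero_less_numeral zero_less_mult_pos)
  have "real_of_int 4398046511104 \<le> of_int (yl * hi)" using assms(3) of_int_le_iff by blast
  then have "2 ^ 14 \<le> of_int yl / 2 ^ 28 * real_of_int hi" by simp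
  also have "\<dots> \<le> y * of_int hi" using y(1) hi by (intro mult_right_mono) auto
  finally show "1 / y \<le> of_int hi / 2 ^ 14" using y0 by (simp add: field_simps)
  show "of_int lst / 2 ^ 14 < 1 / y"
    using assms(4)
  proof
    assume "lst = 0" then show ?thesis using y0 by simp
  next
    assume "\<exists>bn yl' yh'. b = of_int bn / 100 \<and> ln_enclosure bn yl' yh' \<and> 0 < lst \<and> lst * yh' \<le> 4398046511104"
    then obtain bn yl' yh' where b: "b = of_int bn / 100" "ln_enclosure bn yl' yh'" "0 < lst" "lst * yh' \<le> 4398046511104"
      by blast
    have "y < of_int yh' / 2 ^ 28" using y(2) ln_enclosure_sound(2)[OF b(2)] b(1) by simp
    then have "of_int lst * y < of_int lst * (of_int yh' / 2 ^ 28)" using b(3) by (intro mult_strict_left_mono) auto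
    also have "\<dots> = of_int (lst * yh') / 2 ^ 28" by simp
    also have "\<dots> \<le> 2 ^ 14"
    proof -
      have "real_of_int (lst * yh') \<le> real_of_int 4398046511104" using b(4) of_int_le_iff by blast
      then show ?thesis by simp
    qed
    finally show ?thesis using y0 by (simp add: field_simps)
  qed
qed

text \<open>The factor \<open>1048576 = 2 ^ 20\<close> provides twenty binary digits behind the
  point for the nested evaluation.\<close>

definition ulow :: "int \<Rightarrow> int \<Rightarrow> int \<Rightarrow> int \<Rightarrow> int list list \<Rightarrow> int" where
  "ulow yl yh wl wh U = lowH wl wh 28 (map (\<lambda>r. lowH yl yh 28 (map ((*) 1048576) r)) U)"

lemma ulow_le:
  assumes "ln_enclosure an yl yh" "0 \<le> wl" "wl * an \<le> 26843545600" "26843545600 \<le> wh * an"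
  defines "x \<equiv> of_int an / 100"
  shows "of_int (ulow yl yh wl wh U) \<le> 2 ^ 20 * ev2 U (ln x) (1 / x)"
proof -
  note l = ln_enclosure_sound[OF assms(1)]
  have an: "0 < real_of_int an" using l(4) by simp
  have "real_of_int (wl * an) \<le> real_of_int 26843545600" using assms(3) of_int_le_iff by blast
  then have w1: "of_int wl / 2 ^ 28 \<le> 1 / x" using an by (simp add: x_def field_simps)
  have "real_of_int 26843545600 \<le> real_of_int (wh * an)" using assms(4) of_int_le_iff by blast
  then have w2: "1 / x \<le> of_int wh / 2 ^ 28" using an by (simp add: x_def field_simps)
  have "of_int (ulow yl yh wl wh U) \<le> horner_sum (\<lambda>r. ev (map ((*) 1048576) r) (ln x)) (1 / x) U"
    unfolding ulow_def
    by (intro lowH_le lowH_ev_le) (use assms(2) w1 w2 l in \<open>auto simp: x_def\<close>)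
  also have "\<dots> = 2 ^ 20 * ev2 U (ln x) (1 / x)"
    by (induction U) (auto simp: distrib_left)
  finally show ?thesis .
qed

lemma exp_le_of_check:
  assumes "0 \<le> t" "t \<le> 4294967296" "of_int (expU t) \<le> 2 ^ 40 * (r :: real)"
  shows "exp (of_int t / 2 ^ 28) \<le> r"
proof -
  have "2 ^ 40 * exp (of_int t / 2 ^ 28) \<le> 2 ^ 40 * r" using expU_ge[of t] assms by simp
  then show ?thesis by simp
qed

lemma exp_ge_of_check:
  assumes "0 \<le> t" "2 ^ 40 * (r :: real) \<le> of_int (expL t)"
  shows "r \<le> exp (of_int t / 2 ^ 28)"
proof -
  have "2 ^ 40 * r \<le> 2 ^ 40 * exp (of_int t / 2 ^ 28)" using expL_le[of t] assms by simp
  then show ?thesis by simp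
qed

text \<open>Here \<open>zl\<close>, \<open>zh\<close> enclose \<open>2\<^sup>2\<^sup>8 * x\<close> and \<open>wl\<close>, \<open>wh\<close> enclose \<open>2\<^sup>2\<^sup>8 / x\<close>; \<open>bt\<close> bounds
  \<open>2\<^sup>2\<^sup>8 * ln (x * exp x * u(x))\<close>, \<open>lb\<close> bounds \<open>2\<^sup>2\<^sup>8 * ln (bt / 2\<^sup>2\<^sup>8)\<close>, and \<open>LU\<close>, \<open>LL\<close> are upper and
  lower bounds for \<open>2\<^sup>4\<^sup>0 * Lconst\<close>.\<close>
definition init_up :: "int \<Rightarrow> int \<Rightarrow> int \<Rightarrow> int \<Rightarrow> int \<Rightarrow> int \<Rightarrow> int \<Rightarrow> int \<Rightarrow> int \<Rightarrow> int \<Rightarrow> int list list \<Rightarrow> bool" where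
  "init_up LU an zl zh yl yh wl wh bt lb U \<longleftrightarrow>
    0 \<le> wl \<and> wl * an \<le> 26843545600 \<and> 26843545600 \<le> wh * an \<and>
    zl * 100 \<le> 268435456 * an \<and> 268435456 * an \<le> zh * 100 \<and> 0 \<le> zh \<and> zh \<le> 4294967296 \<and>
    zl \<le> bt \<and> bt - zl \<le> 4294967296 \<and> 0 < bt \<and> 0 \<le> lb \<and> lb \<le> 4294967296 \<and>
    expU (bt - zl) * 1056964608000 \<le> 1099511627776 * (an * ulow yl yh wl wh U) \<and>
    expU lb \<le> bt * 4096 \<and> expU zh \<le> lb * 4096 + GserL bt - LU"

lemma init_up_sound:
  assumes "init_up LU an zl zh yl yh wl wh bt lb U" "ln_enclosure an yl yh" "2 ^ 40 * Lconst \<le> of_int LU"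
  defines "x \<equiv> of_int an / 100"
  shows "Lconst \<le> defect (barrier K0 U) x"
proof -
  note i = assms(1)[unfolded init_up_def]
  have an: "0 < real_of_int an" "x > 0" using ln_enclosure_sound(4)[OF assms(2)] by (auto simp: x_def)
  have zr: "of_int zl / 2 ^ 28 \<le> x" "x \<le> of_int zh / 2 ^ 28"
  proof -
    have "real_of_int (zl * 100) \<le> real_of_int (268435456 * an)" "real_of_int (268435456 * an) \<le> real_of_int (zh * 100)"
      unfolding of_int_le_iff using i by auto
    then show "of_int zl / 2 ^ 28 \<le> x" "x \<le> of_int zh / 2 ^ 28" by (simp_all add: x_def)
  qed
  define b where "b = (of_int bt / 2 ^ 28 :: real)"
  have b: "b > 0" using i by (simp add: b_def)
  define u where "u = barrier K0 U x"
  have ul: "of_int (ulow yl yh wl wh U) \<le> 2 ^ 20 * (10080 * u)"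
    using ulow_le[OF assms(2), of wl wh U] i by (simp add: u_def barrier_def x_def)
  \<comment> \<open>\<open>1056964608000 = 100 * 10080 * 2 ^ 20\<close> clears the denominators of
    \<open>x\<close> and \<open>u\<close> and the scale of \<open>ulow\<close>.\<close>
  have "real_of_int (expU (bt - zl) * 1056964608000) \<le> real_of_int (1099511627776 * (an * ulow yl yh wl wh U))"
    unfolding of_int_le_iff using i by auto
  also have "\<dots> = 1099511627776 * (of_int an * of_int (ulow yl yh wl wh U))" by simp
  also have "\<dots> \<le> 1099511627776 * (of_int an * (2 ^ 20 * (10080 * u)))"
    using ul an by (intro mult_left_mono) auto
  finally have "of_int (expU (bt - zl)) \<le> 2 ^ 40 * (x * u)" by (simp add: x_def)
  then have e: "exp (of_int (bt - zl) / 2 ^ 28) \<le> x * u"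
    using i by (intro exp_le_of_check) auto
  then have "0 < x * u" by (rule less_le_trans[OF exp_gt_zero])
  then have u: "u > 0" using an(2) by (simp add: zero_less_mult_iff)
  have "of_int (bt - zl) / 2 ^ 28 \<le> ln (x * u)" using e \<open>0 < x * u\<close> by (simp only: ln_ge_iff)
  then have "b - of_int zl / 2 ^ 28 \<le> ln x + ln u"
    using an(2) u by (simp add: ln_mult b_def diff_divide_distrib)
  then have bl: "b \<le> logbar (barrier K0 U) x" using zr(1) by (simp add: logbar_def u_def)
  have "real_of_int (expU lb) \<le> real_of_int (bt * 4096)" unfolding of_int_le_iff using i by auto
  then have "exp (of_int lb / 2 ^ 28) \<le> b"
    using i by (intro exp_le_of_check) (auto simp: b_def)
  then have ln_enclosure: "of_int lb / 2 ^ 28 \<le> ln b" using b by (simp only: ln_ge_iff)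
  have "2 ^ 40 * exp x \<le> 2 ^ 40 * exp (of_int zh / 2 ^ 28)" using zr(2) by simp
  also have "\<dots> \<le> of_int (expU zh)" using i by (intro expU_ge) auto
  also have "\<dots> \<le> real_of_int (lb * 4096 + GserL bt - LU)" unfolding of_int_le_iff using i by auto
  also have "\<dots> = 2 ^ 40 * (of_int lb / 2 ^ 28) + of_int (GserL bt) - of_int LU" by simp
  also have "\<dots> \<le> 2 ^ 40 * ln b + 2 ^ 40 * Gser b - 2 ^ 40 * Lconst"
    using ln_enclosure GserL_le[of bt] i assms(3) by (intro diff_mono add_mono) (auto simp: b_def)
  finally have "exp x \<le> Ei0 b - Lconst" using b by (simp add: Ei0_def)
  moreover have "Ei0 b \<le> Ei0 (logbar (barrier K0 U) x)"
    using Ei0_strict_mono[OF b, of "logbar (barrier K0 U) x"] bl by fastforce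
  ultimately show ?thesis by (simp add: defect_def)
qed

text \<open>Since \<open>ulow\<close> bounds from below only, the upper bound for \<open>u\<close>
  is taken as minus the lower bound for \<open>- U\<close>.\<close>

definition init_low :: "int \<Rightarrow> int \<Rightarrow> int \<Rightarrow> int \<Rightarrow> int \<Rightarrow> int \<Rightarrow> int \<Rightarrow> int \<Rightarrow> int \<Rightarrow> int \<Rightarrow> int list list \<Rightarrow> bool" where
  "init_low LL an zl zh yl yh wl wh bt lb U \<longleftrightarrow>
    0 \<le> wl \<and> wl * an \<le> 26843545600 \<and> 26843545600 \<le> wh * an \<and>
    zl * 100 \<le> 268435456 * an \<and> 268435456 * an \<le> zh * 100 \<and> 0 \<le> zl \<and>
    zh \<le> bt \<and> 0 < bt \<and> bt \<le> 4294967296 \<and> 0 \<le> lb \<and>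
    1099511627776 * (an * - ulow yl yh wl wh (bscale (- 1) U)) \<le> expL (bt - zh) * 1056964608000 \<and>
    bt * 4096 \<le> expL lb \<and> lb * 4096 + GserU bt - LL \<le> expL zl"

lemma init_low_sound:
  assumes "init_low LL an zl zh yl yh wl wh bt lb U" "ln_enclosure an yl yh" "of_int LL \<le> 2 ^ 40 * Lconst"
  defines "x \<equiv> of_int an / 100"
  assumes "3 / 2 \<le> x" "1 / 5 \<le> barrier K0 U x"
  shows "defect (barrier K0 U) x \<le> Lconst"
proof -
  note i = assms(1)[unfolded init_low_def]
  have an: "0 < real_of_int an" "x > 0" using ln_enclosure_sound(4)[OF assms(2)] by (auto simp: x_def)
  have zr: "of_int zl / 2 ^ 28 \<le> x" "x \<le> of_int zh / 2 ^ 28"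
  proof -
    have "real_of_int (zl * 100) \<le> real_of_int (268435456 * an)" "real_of_int (268435456 * an) \<le> real_of_int (zh * 100)"
      unfolding of_int_le_iff using i by auto
    then show "of_int zl / 2 ^ 28 \<le> x" "x \<le> of_int zh / 2 ^ 28" by (simp_all add: x_def)
  qed
  define b where "b = (of_int bt / 2 ^ 28 :: real)"
  have b: "b > 0" using i by (simp add: b_def)
  define u where "u = barrier K0 U x"
  have u: "u > 0" using assms(6) by (simp add: u_def)
  have ul: "2 ^ 20 * (10080 * u) \<le> - of_int (ulow yl yh wl wh (bscale (- 1) U))"
    using ulow_le[OF assms(2), of wl wh "bscale (- 1) U"] i by (simp add: u_def barrier_def x_def)
  have "1099511627776 * (of_int an * (2 ^ 20 * (10080 * u)))
      \<le> 1099511627776 * (of_int an * - of_int (ulow yl yh wl wh (bscale (- 1) U)))"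
    using ul an by (intro mult_left_mono) auto
  also have "\<dots> = real_of_int (1099511627776 * (an * - ulow yl yh wl wh (bscale (- 1) U)))" by simp
  also have "\<dots> \<le> real_of_int (expL (bt - zh) * 1056964608000)"
    unfolding of_int_le_iff using i by auto
  finally have "2 ^ 40 * (x * u) \<le> of_int (expL (bt - zh))" by (simp add: x_def)
  then have e: "x * u \<le> exp (of_int (bt - zh) / 2 ^ 28)"
    using i by (intro exp_ge_of_check) auto
  have "0 < x * u" using u an by simp
  then have "ln (x * u) \<le> of_int (bt - zh) / 2 ^ 28"
    using e by (metis ln_exp ln_le_cancel_iff exp_gt_zero)
  then have "ln x + ln u \<le> b - of_int zh / 2 ^ 28"
    using an(2) u by (simp add: ln_mult b_def diff_divide_distrib)
  then have bl: "logbar (barrier K0 U) x \<le> b" using zr(2) by (simp add: logbar_def u_def)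
  have "real_of_int (bt * 4096) \<le> real_of_int (expL lb)" unfolding of_int_le_iff using i by auto
  then have "b \<le> exp (of_int lb / 2 ^ 28)"
    using i by (intro exp_ge_of_check) (auto simp: b_def)
  then have ln_enclosure: "ln b \<le> of_int lb / 2 ^ 28" using b by (metis ln_exp ln_le_cancel_iff exp_gt_zero)
  have "2 ^ 40 * ln b + 2 ^ 40 * Gser b - 2 ^ 40 * Lconst
      \<le> 2 ^ 40 * (of_int lb / 2 ^ 28) + of_int (GserU bt) - of_int LL"
    using ln_enclosure GserU_ge[of bt] i assms(3) by (intro diff_mono add_mono) (auto simp: b_def)
  also have "\<dots> = real_of_int (lb * 4096 + GserU bt - LL)" by simp
  also have "\<dots> \<le> real_of_int (expL zl)" unfolding of_int_le_iff using i by auto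
  also have "\<dots> \<le> 2 ^ 40 * exp (of_int zl / 2 ^ 28)" using i by (intro expL_le) auto
  also have "\<dots> \<le> 2 ^ 40 * exp x" using zr(1) by simp
  finally have "Ei0 b - Lconst \<le> exp x" using b by (simp add: Ei0_def)
  moreover have "Ei0 (logbar (barrier K0 U) x) \<le> Ei0 b"
    using Ei0_strict_mono[OF logbar_pos[of x "barrier K0 U", OF assms(5,6)], of b] bl by fastforce
  ultimately show ?thesis by (simp add: defect_def)
qed

section \<open>Upper and lower estimates from certificates\<close>

definition ali_ratio :: "real \<Rightarrow> real" where
  "ali_ratio x = ali (exp x) / (x * exp x)"

definition fifth_bound :: "int list list \<Rightarrow> int list list" where
  "fifth_bound U = badd (bscale 5 U) [[- 10080]]"

lemma fifth_bound_imp: "0 \<le> ev2 (fifth_bound U) y v \<Longrightarrow> 1 / 5 \<le> ev2 U y v / 10080"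
  by (simp add: fifth_bound_def)

lemma ev_monomial: "ev (replicate N 0 @ [c]) y = of_int c * y ^ N"
  by (induction N) auto

lemma ln2_bounds: "ln_enclosure 200 186065270 186065290"
  by code_simp

lemma exp2_check: "7388 * 1099511627776 \<le> expL 536870912 * 1000"
  by code_simp

lemma Gser_minus_2: "\<bar>Gser (- 2) + 1.319263\<bar> \<le> 1 / 10 ^ 5"
proof -
  have "Gser (- 2) = (\<Sum>k<16. 1 / real k * (- 2) ^ k / fact k)
      + (- 2) ^ 16 / fact 16 * Ttail (\<lambda>k. 1 / real k) 16 (- 2)"
    unfolding Gser_eq_Ttail0 by (rule Ttail_partial_sum[OF inverse_nat_bounds])
  moreover have "\<bar>Ttail (\<lambda>k. 1 / real k) 16 (- 2)\<bar> \<le> 2"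
    by (rule Ttail_abs_le_2[OF inverse_nat_bounds]) simp
  ultimately show ?thesis
    by (simp add: fact_numeral numeral_eq_Suc lessThan_Suc)
qed

text \<open>These are \<open>- 0.5767\<close> and \<open>- 0.63\<close>, against the true value
  \<open>- 0.5772...\<close>. The coarse side suffices for the initial values of the lower
  barriers.\<close>

lemma Lconst_bounds: "2 ^ 40 * Lconst \<le> of_int (- 634088355738)" "of_int (- 692692325498) \<le> 2 ^ 40 * Lconst"
proof -
  have ln2: "of_int 186065270 / 2 ^ 28 \<le> ln (2 :: real)" "ln (2 :: real) < of_int 186065290 / 2 ^ 28"
    using ln_enclosure_sound(1,2)[OF ln2_bounds] by simp_all
  have "7.388 \<le> exp (of_int 536870912 / 2 ^ 28 :: real)"
  proof (rule exp_ge_of_check)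
    have "real_of_int (7388 * 1099511627776) \<le> real_of_int (expL 536870912 * 1000)"
      unfolding of_int_le_iff by (rule exp2_check)
    then show "2 ^ 40 * 7.388 \<le> real_of_int (expL 536870912)" by simp
  qed simp
  then have "exp (- 2) \<le> (1 / 7.388 :: real)"
    by (simp add: exp_minus field_simps)
  then have e: "exp (- 2) * (4 / 11) \<le> (1 / 7.388 :: real) * (4 / 11)" by simp
  have G: "Gser (- 2) \<le> - 1.319253" "- 1.319273 \<le> Gser (- 2)" 
    using abs_le_D1[OF Gser_minus_2] abs_le_D2[OF Gser_minus_2] by simp_all
  have "Lconst \<le> ln 2 + Gser (- 2) + exp (- 2) * (4 / 11)" using Lconst_le by (simp add: Ei0_def)
  then show "2 ^ 40 * Lconst \<le> of_int (- 634088355738)" using ln2 e G by simp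
  have "ln 2 + Gser (- 2) \<le> Lconst" using Lconst_ge by (simp add: Ei0_def)
  then show "of_int (- 692692325498) \<le> 2 ^ 40 * Lconst" using ln2 e G by simp
qed

lemma upper_barrier:
  assumes "ln_enclosure an yl yh" "150 \<le> an" "4398046511104 \<le> yl * hi"
    and "nonneg_check s z (Mop K0 (Ulist N q) []) hi ps 0"
    and "\<And>b y v. dom2 (of_int an / 100) b y v \<Longrightarrow> 1 / 5 \<le> ev2 (Ulist N q) y v / 10080"
    and "init_up (- 634088355738) an zl zh yl yh wl wh bt lb (Ulist N q)"
    and "N \<ge> 1" "of_int an / 100 \<le> x"
  shows "ali_ratio x \<le> barrier K0 (Ulist N q) x"
proof -
  let ?a = "of_int an / 100 :: real"
  have a: "3 / 2 \<le> ?a" using assms(2) by simp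
  obtain us where us: "Ulist N q = [K0] # [- K0, K0] # us" using Ulist_Cons[OF assms(7)] by blast
  have "Lconst \<le> defect (barrier K0 (Ulist N q)) ?a"
    using assms(1,6) Lconst_bounds(1) by (intro init_up_sound)
  also have "\<dots> \<le> defect (barrier K0 (Ulist N q)) x"
    unfolding us
  proof (rule supersolution_mono[OF _ a assms(8)])
    fix y v assume d: "dom2 ?a x y v"
    show "0 \<le> ev2 (Mop K0 ([K0] # [- K0, K0] # us) []) y v"
      using nonneg_on_dom2[OF assms(4,1,3) _ d] by (simp add: us)
    show "1 / 5 \<le> ev2 ([K0] # [- K0, K0] # us) y v / of_int K0"
      using assms(5)[OF d] by (simp add: us)
  qed simp
  finally have "Lconst \<le> defect (barrier K0 (Ulist N q)) x" .
  moreover have "1 / 5 \<le> barrier K0 (Ulist N q) x"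
    using assms(5)[OF dom2_ln[OF a, of x x "1 / x"]] assms(8) a by (simp add: barrier_def)
  ultimately show ?thesis unfolding ali_ratio_def using a assms(8) by (intro ali_upper) auto
qed

lemma defect_le:
  assumes "u x \<le> v x" "1 / 5 \<le> u x" "3 / 2 \<le> x"
  shows "defect u x \<le> defect v x"
proof -
  have "logbar u x \<le> logbar v x" using assms by (simp add: logbar_def)
  moreover have "0 < logbar u x" using assms by (intro logbar_pos)
  ultimately have "Ei0 (logbar u x) \<le> Ei0 (logbar v x)"
    using Ei0_strict_mono[of "logbar u x" "logbar v x"] by fastforce
  then show ?thesis by (simp add: defect_def)
qed

lemma ev2_replicate_Nil: "ev2 (replicate N []) y v = 0"
  by (induction N) auto

text \<open>The term \<open>E\<close> removes the derivative of the linear function from \<open>D\<close> and puts a constant in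
  a lower order in \<open>v\<close> instead; this makes \<open>D\<close> larger for \<open>x \<le> bn / 100\<close>.\<close>
lemma lower_phase:
  assumes "ln_enclosure an yl yh" "ln_enclosure bn yl' yh'" "150 \<le> an" "4398046511104 \<le> yl * hi"
    and "0 < lst" "lst * yh' \<le> 4398046511104"
    and "nonneg_check s z (bscale (- 1) (Mop K0 (Ulist N [a, - b]) (replicate N [] @ [[- c], [b]]))) hi ps lst"
    and "nonneg_check s5 z5 (fifth_bound (Ulist N [a, - b])) hi ps5 lst"
    and "init_low (- 692692325498) an zl zh yl yh wl wh bt lb (Ulist N [a, - b])"
    and "N \<ge> 1" "0 \<le> c" "c * bn \<le> 100 * b" and x: "x \<in> {of_int an / 100..of_int bn / 100}"
  shows "1 / 5 \<le> barrier K0 (Ulist N [a, - b]) x" "defect (barrier K0 (Ulist N [a, - b])) x \<le> Lconst"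
proof -
  let ?a = "of_int an / 100 :: real" and ?b = "of_int bn / 100 :: real"
  let ?E = "replicate N [] @ [[- c], [b]]"
  let ?U = "Ulist N [a, - b]"
  have a: "3 / 2 \<le> ?a" using assms(3) by simp
  obtain us where us: "?U = [K0] # [- K0, K0] # us" using Ulist_Cons[OF assms(10)] by blast
  have dom: "dom2 ?a ?b y v" if "dom2 ?a x y v" for y v
    using that x a by (auto simp: dom2_def intro: order_trans)
  have ex: "lst = 0 \<or> (\<exists>bn' yl' yh'. ?b = of_int bn' / 100 \<and> ln_enclosure bn' yl' yh' \<and> 0 < lst \<and> lst * yh' \<le> 4398046511104)"
    using assms(2,5,6) by blast
  have u5: "1 / 5 \<le> ev2 ?U y v / 10080" if "dom2 ?a ?b y v" for y v
    using nonneg_on_dom2[OF assms(8,1,4) ex that] by (rule fifth_bound_imp)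
  have u: "1 / 5 \<le> barrier K0 ?U t" if "t \<in> {?a..?b}" for t
    using u5[OF dom2_ln[OF a that, of "1 / t"]] that a by (simp add: barrier_def)
  show "1 / 5 \<le> barrier K0 ?U x" using u x .
  have "defect (barrier K0 ?U) x \<le> defect (barrier K0 ?U) ?a"
    unfolding us
  proof (rule subsolution_antimono[OF _ a])
    show "?a \<le> x" using x by simp
    \<comment> \<open>The exchange concerns the start of each path: a term of order
      \<open>v ^ N\<close> in \<open>D\<close> reaches the quotient of \<open>M\<close> already at
      \<open>v = 0\<close>, one of order \<open>v ^ (N + 1)\<close> does not.\<close>
    have E: "ev2 ?E y v = v ^ N * (of_int b * v - of_int c)" for y v
      by (simp add: ev2_append ev2_replicate_Nil)
    show "ev2 ?E y 0 = 0" for y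
      unfolding E using assms(10) by simp
    show "0 \<le> ev2 ?E (ln t) (1 / t)" if t: "t \<in> {?a..x}" for t
    proof -
      have t': "0 < t" "t \<le> ?b" using t x a by auto
      have "of_int c * t \<le> of_int c * ?b" using t' assms(11) by (intro mult_left_mono) auto
      also have "\<dots> = of_int (c * bn) / 100" by simp
      also have "\<dots> \<le> of_int b"
      proof -
        have "real_of_int (c * bn) \<le> real_of_int (100 * b)" unfolding of_int_le_iff by (rule assms(12))
        then show ?thesis by simp
      qed
      finally have "0 \<le> of_int b * (1 / t) - of_int c" using t'(1) by (simp add: field_simps)
      then show ?thesis unfolding E using t'(1) by (intro mult_nonneg_nonneg) auto
    qed
    fix y v assume d: "dom2 ?a x y v"
    show "ev2 (Mop K0 ([K0] # [- K0, K0] # us) ?E) y v \<le> 0"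
      using nonneg_on_dom2[OF assms(7,1,4) ex dom[OF d]] by (simp add: us)
    show "1 / 5 \<le> ev2 ([K0] # [- K0, K0] # us) y v / of_int K0"
      using u5[OF dom[OF d]] by (simp add: us)
  qed simp
  also have "\<dots> \<le> Lconst"
    using x by (intro init_low_sound[OF assms(9,1) Lconst_bounds(2)] a u) auto
  finally show "defect (barrier K0 ?U) x \<le> Lconst" .
qed

section \<open>Lower estimates and their transfer to larger ranges and smaller orders\<close>

definition lower_estimate :: "nat \<Rightarrow> int \<Rightarrow> real \<Rightarrow> bool" where
  "lower_estimate N c x \<longleftrightarrow> partial_expansion N x - of_int c / 10080 * ln x ^ N / x ^ (N + 1) \<le> ali_ratio x"

lemma barrier_linear:
  assumes "N \<le> 11" "x > 0" "0 \<le> ev (padd [a, - b] (replicate N 0 @ [c])) (ln x)"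
  shows "partial_expansion N x - of_int c / 10080 * ln x ^ N / x ^ (N + 1) \<le> barrier K0 (Ulist N [a, - b]) x"
proof -
  have "- (of_int c * ln x ^ N) \<le> ev [a, - b] (ln x)" using assms(3) by (simp add: ev_monomial)
  then have "- (of_int c * ln x ^ N) / 10080 / x ^ (N + 1) \<le> ev [a, - b] (ln x) / 10080 / x ^ (N + 1)"
    using assms(2) by (intro divide_right_mono) auto
  then show ?thesis unfolding barrier_Ulist[OF assms(1,2)] by simp
qed

lemma phq_sound:
  assumes "ln_enclosure an yl yh" "ln_enclosure bn yl' yh'" "150 \<le> an" "4398046511104 \<le> yl * hi"
    and "0 < lst" "lst * yh' \<le> 4398046511104"
    and "nonneg_check s z [padd [a, - b] (replicate N 0 @ [c])] hi ps lst"
    and x: "x \<in> {of_int an / 100..of_int bn / 100}"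
  shows "0 \<le> ev (padd [a, - b] (replicate N 0 @ [c])) (ln x)"
proof -
  have a: "3 / 2 \<le> (of_int an / 100 :: real)" using assms(3) by simp
  have ex: "lst = 0 \<or> (\<exists>bn' yl' yh'. (of_int bn / 100 :: real) = of_int bn' / 100 \<and> ln_enclosure bn' yl' yh'
      \<and> 0 < lst \<and> lst * yh' \<le> 4398046511104)"
    using assms(2,5,6) by blast
  have "0 \<le> ev2 [padd [a, - b] (replicate N 0 @ [c])] (ln x) 0"
    using x a by (intro nonneg_on_dom2[OF assms(7,1,4) ex] dom2_ln) auto
  then show ?thesis by simp
qed

text \<open>Continuation of a lower estimate to infinity: \<open>v\<close> is any barrier already
  known to lie below the solution at the left end. The barrier with correction
  \<open>- c * ln x ^ N\<close> lies below \<open>v\<close> there, so it inherits the initial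
  inequality.\<close>

lemma lower_const:
  assumes "ln_enclosure an yl yh" "150 \<le> an" "4398046511104 \<le> yl * hi"
    and "nonneg_check s z (bscale (- 1) (Mop K0 (Ulist N (replicate N 0 @ [- c])) [])) hi ps 0"
    and "nonneg_check s5 z5 (fifth_bound (Ulist N (replicate N 0 @ [- c]))) hi5 ps5 0" "4398046511104 \<le> yl * hi5"
    and "1 \<le> N" "N \<le> 11" "of_int an / 100 \<le> x"
    and "partial_expansion N (of_int an / 100) - of_int c / 10080 * ln (of_int an / 100) ^ N / (of_int an / 100) ^ (N + 1)
      \<le> v (of_int an / 100)" "defect v (of_int an / 100) \<le> Lconst"
  shows "lower_estimate N c x"
proof -
  let ?a = "of_int an / 100 :: real" and ?U = "Ulist N (replicate N 0 @ [- c])"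
  have a: "3 / 2 \<le> ?a" using assms(2) by simp
  obtain us where us: "?U = [K0] # [- K0, K0] # us" using Ulist_Cons[OF assms(7)] by blast
  have u5: "1 / 5 \<le> ev2 ?U y w / 10080" if "dom2 ?a b y w" for b y w
    using nonneg_on_dom2[OF assms(5,1,6) _ that] by (intro fifth_bound_imp) simp
  have u: "1 / 5 \<le> barrier K0 ?U t" if "?a \<le> t" for t
    using u5[OF dom2_ln[OF a, of t t "1 / t"]] that a by (simp add: barrier_def)
  have U: "barrier K0 ?U t = partial_expansion N t - of_int c / 10080 * ln t ^ N / t ^ (N + 1)" if "?a \<le> t" for t
    using that a by (subst barrier_Ulist[OF assms(8)]) (auto simp: ev_monomial)
  have "defect (barrier K0 ?U) x \<le> defect (barrier K0 ?U) ?a"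
    unfolding us
  proof (rule subsolution_antimono[OF _ a assms(9)])
    fix y w assume d: "dom2 ?a x y w"
    show "ev2 (Mop K0 ([K0] # [- K0, K0] # us) []) y w \<le> 0"
      using nonneg_on_dom2[OF assms(4,1,3) _ d] by (simp add: us)
    show "1 / 5 \<le> ev2 ([K0] # [- K0, K0] # us) y w / of_int K0"
      using u5[OF d] by (simp add: us)
  qed simp_all
  also have "\<dots> \<le> defect v ?a"
    using assms(10) U[of ?a] u[of ?a] a by (intro defect_le) auto
  also have "\<dots> \<le> Lconst" by (rule assms(11))
  finally have "barrier K0 ?U x \<le> ali_ratio x"
    unfolding ali_ratio_def using a u[OF assms(9)] assms(9) by (intro ali_lower) auto
  then show ?thesis using U[OF assms(9)] by (simp add: lower_estimate_def)
qed

text \<open>Consecutive expansions differ by \<open>P_N / x ^ (N + 1)\<close>. It remains to compare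
  this difference with the two error terms, which is a condition linear in \<open>v\<close>.\<close>

lemma lower_chain:
  assumes "ln_enclosure an yl yh" "150 \<le> an" "4398046511104 \<le> yl * hi"
    and "nonneg_check s z [padd (Qs ! N) (replicate N 0 @ [c]), replicate (N + 1) 0 @ [- c']] hi ps 0"
    and "N \<le> 10" "of_int an / 100 \<le> x" "lower_estimate (N + 1) c' x"
  shows "lower_estimate N c x"
proof -
  let ?a = "of_int an / 100 :: real"
  have a: "3 / 2 \<le> ?a" using assms(2) by simp
  then have x: "x > 0" using assms(6) by linarith
  have "0 \<le> ev2 [padd (Qs ! N) (replicate N 0 @ [c]), replicate (N + 1) 0 @ [- c']] (ln x) (1 / x)"
    using a assms(6) x by (intro nonneg_on_dom2[where b = x, OF assms(4,1,3)] dom2_ln) auto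
  then have "0 \<le> ev (Qs ! N) (ln x) + of_int c * ln x ^ N - of_int c' * ln x ^ (N + 1) / x"
    unfolding horner_sum_simps ev_padd ev_monomial by simp
  then have "0 \<le> (ev (Qs ! N) (ln x) + of_int c * ln x ^ N - of_int c' * ln x ^ (N + 1) / x) / (10080 * x ^ (N + 1))"
    using x by (intro divide_nonneg_pos) auto
  also have "\<dots> = ev (Qs ! N) (ln x) / 10080 / x ^ (N + 1) + of_int c / 10080 * ln x ^ N / x ^ (N + 1)
      - of_int c' / 10080 * ln x ^ (N + 1) / x ^ (N + 1 + 1)"
    using x by (simp add: add_divide_distrib diff_divide_distrib mult_ac)
  also have "ev (Qs ! N) (ln x) / 10080 / x ^ (N + 1) = partial_expansion (N + 1) x - partial_expansion N x"
    using assms(5) by (simp add: partial_expansion_def Pn_Qpoly poly_Qpoly)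
  finally show ?thesis using assms(7) unfolding lower_estimate_def by simp
qed

lemma exp1_check: "expU 268435456 * 1048576 \<le> 1099511627776 * 2850328"
  by code_simp

text \<open>Upper bounds \<open>2850328 / 2 ^ 20\<close> for \<open>e\<close> and
  \<open>lh / 2 ^ 20\<close> for \<open>ln N\<close> reduce the claim to integers, with
  \<open>201600 = 20 * 10080\<close>. The integers \<open>c\<close> of the certificates are chosen
  slightly below the exact constants.\<close>

lemma constant_bound:
  assumes "ln_enclosure (100 * int N) yl yh" "yh \<le> lh * 256" "2 \<le> N"
    and "c * (2850328 * lh) ^ N \<le> 201600 * (int N * 1099511627776) ^ N"
  shows "of_int c / 10080 \<le> 20 * (real N / (exp 1 * ln (real N))) ^ N"
proof -
  have e: "exp 1 \<le> (2850328 / 2 ^ 20 :: real)"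
  proof -
    have "real_of_int (expU 268435456 * 1048576) \<le> real_of_int (1099511627776 * 2850328)"
      unfolding of_int_le_iff by (rule exp1_check)
    then have "exp (of_int 268435456 / 2 ^ 28) \<le> (2850328 / 2 ^ 20 :: real)"
      by (intro exp_le_of_check) simp_all
    then show ?thesis by simp
  qed
  have "ln (real N) < of_int yh / 2 ^ 28" using ln_enclosure_sound(2)[OF assms(1)] by simp
  moreover have "real_of_int yh \<le> real_of_int (lh * 256)" unfolding of_int_le_iff by (rule assms(2))
  ultimately have l: "ln (real N) \<le> of_int lh / 2 ^ 20" by simp
  have l0: "0 < ln (real N)" using assms(3) by simp
  have "exp 1 * ln (real N) \<le> 2850328 / 2 ^ 20 * (of_int lh / 2 ^ 20)"
    using e l l0 by (intro mult_mono) auto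
  then have el: "exp 1 * ln (real N) \<le> of_int (2850328 * lh) / 2 ^ 40" by simp
  have p: "0 < exp 1 * ln (real N)" using l0 by simp
  have lh: "0 < real_of_int (2850328 * lh)" using less_le_trans[OF p el] by simp
  have "real_of_int (c * (2850328 * lh) ^ N) \<le> real_of_int (201600 * (int N * 1099511627776) ^ N)"
    unfolding of_int_le_iff by (rule assms(4))
  then have "of_int c * real_of_int (2850328 * lh) ^ N \<le> 201600 * (real N * 2 ^ 40) ^ N" by simp
  then have "of_int c / 10080 \<le> 20 * ((real N * 2 ^ 40) ^ N / real_of_int (2850328 * lh) ^ N)"
    using lh by (simp add: field_simps)
  also have "(real N * 2 ^ 40) ^ N / real_of_int (2850328 * lh) ^ N = (real N / (of_int (2850328 * lh) / 2 ^ 40)) ^ N"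
  proof -
    have "(n * p) ^ k / m ^ k = (n / (m / p)) ^ k" for n p m :: real and k
      by (simp add: power_divide power_mult_distrib)
    then show ?thesis .
  qed
  also have "20 * \<dots> \<le> 20 * (real N / (exp 1 * ln (real N))) ^ N"
    using el p lh by (intro mult_left_mono power_mono divide_left_mono) auto
  finally show ?thesis .
qed

definition expansion_bound :: "nat \<Rightarrow> real \<Rightarrow> bool" where
  "expansion_bound N x \<longleftrightarrow> (\<exists>\<theta>::real. \<bar>\<theta>\<bar> \<le> 1 \<and>
    ali (exp x) / (x * exp x) =
      1 + (\<Sum>n=1..N. poly (Pn (n - 1)) (ln x) / x ^ n)
        + \<theta> * 20 * (real N / (exp 1 * ln (real N))) ^ N * (ln x) ^ N / x ^ (N + 1))"

lemma theta_exists: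
  assumes "ali_ratio x \<le> partial_expansion N x + of_int c / 10080 * ln x ^ N / x ^ (N + 1)" "lower_estimate N c x"
    and "of_int c / 10080 \<le> 20 * (real N / (exp 1 * ln (real N))) ^ N" "x > 1"
    and "0 < (real N / (exp 1 * ln (real N))) ^ N"
  shows "expansion_bound N x"
proof -
  define B where "B = 20 * (real N / (exp 1 * ln (real N))) ^ N * ln x ^ N / x ^ (N + 1)"
  have B: "B > 0" unfolding B_def using assms(4,5) by simp
  have "of_int c / 10080 * (ln x ^ N / x ^ (N + 1)) \<le> 20 * (real N / (exp 1 * ln (real N))) ^ N * (ln x ^ N / x ^ (N + 1))"
    using assms(3,4) by (intro mult_right_mono) auto
  then have "of_int c / 10080 * ln x ^ N / x ^ (N + 1) \<le> B" by (simp add: B_def)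
  then have "\<bar>ali_ratio x - partial_expansion N x\<bar> \<le> B" using assms(1,2) by (simp add: lower_estimate_def abs_le_iff)
  then have "\<bar>(ali_ratio x - partial_expansion N x) / B\<bar> \<le> 1" using B by simp
  moreover have "ali_ratio x = partial_expansion N x + (ali_ratio x - partial_expansion N x) / B * B" using B by simp
  ultimately obtain \<theta> where "\<bar>\<theta>\<bar> \<le> 1" "ali_ratio x = partial_expansion N x + \<theta> * B" by blast
  then show ?thesis
    unfolding expansion_bound_def ali_ratio_def partial_expansion_def B_def
    by (intro exI[of _ \<theta>]) (simp only: times_divide_eq_right mult.assoc simp_thms)
qed

lemma fifth_bound_of_check:
  assumes "nonneg_check s z (fifth_bound U) hi ps 0" "ln_enclosure an yl yh" "4398046511104 \<le> yl * hi"
    and "dom2 (of_int an / 100) b y v"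
  shows "1 / 5 \<le> ev2 U y v / 10080"
  using nonneg_on_dom2[OF assms(1-3) _ assms(4)] by (intro fifth_bound_imp) simp

lemma upper_of_checks:
  assumes "ln_enclosure an yl yh" "150 \<le> an" "4398046511104 \<le> yl * hi"
    and "nonneg_check s z (Mop K0 (Ulist N (replicate N 0 @ [c])) []) hi ps 0"
    and "\<And>b y v. dom2 (of_int an / 100) b y v \<Longrightarrow> 1 / 5 \<le> ev2 (Ulist N (replicate N 0 @ [c])) y v / 10080"
    and "init_up (- 634088355738) an zl zh yl yh wl wh bt lb (Ulist N (replicate N 0 @ [c]))"
    and "1 \<le> N" "N \<le> 11" "of_int an / 100 \<le> x"
  shows "ali_ratio x \<le> partial_expansion N x + of_int c / 10080 * ln x ^ N / x ^ (N + 1)"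
proof -
  have "x > 0" using assms(2,9) by simp
  then show ?thesis
    using upper_barrier[OF assms(1-7,9)] barrier_Ulist[OF assms(8), of x "replicate N 0 @ [c]"]
    by (simp add: ev_monomial)
qed

lemma phase_lower_estimate:
  assumes "ln_enclosure an yl yh" "ln_enclosure bn yl' yh'" "150 \<le> an" "4398046511104 \<le> yl * hi"
    and "0 < lst" "lst * yh' \<le> 4398046511104"
    and "nonneg_check s z (bscale (- 1) (Mop K0 (Ulist N [a, - b]) (replicate N [] @ [[- d], [b]]))) hi ps lst"
    and "nonneg_check s5 z5 (fifth_bound (Ulist N [a, - b])) hi ps5 lst"
    and "init_low (- 692692325498) an zl zh yl yh wl wh bt lb (Ulist N [a, - b])"
    and "1 \<le> N" "0 \<le> d" "d * bn \<le> 100 * b"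
    and "nonneg_check sq zq [padd [a, - b] (replicate N 0 @ [c])] hi psq lst" "N \<le> 11"
    and x: "x \<in> {of_int an / 100..of_int bn / 100}"
  shows "lower_estimate N c x"
proof -
  have x0: "3 / 2 \<le> x" "x > 0" using x assms(3) by auto
  note p = lower_phase[OF assms(1-12) x]
  have "partial_expansion N x - of_int c / 10080 * ln x ^ N / x ^ (N + 1) \<le> barrier K0 (Ulist N [a, - b]) x"
    by (intro barrier_linear assms(14) x0 phq_sound[OF assms(1-6,13) x])
  also have "\<dots> \<le> ali_ratio x" unfolding ali_ratio_def by (rule ali_lower[OF x0(1) p])
  finally show ?thesis by (simp add: lower_estimate_def)
qed

lemma phase_const_lower_estimate:
  assumes "ln_enclosure an yl yh" "ln_enclosure bn yl' yh'" "150 \<le> an" "4398046511104 \<le> yl * hi"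
    and "0 < lst" "lst * yh' \<le> 4398046511104"
    and "nonneg_check s z (bscale (- 1) (Mop K0 (Ulist N [a, - b]) (replicate N [] @ [[- d], [b]]))) hi ps lst"
    and "nonneg_check s5 z5 (fifth_bound (Ulist N [a, - b])) hi ps5 lst"
    and "init_low (- 692692325498) an zl zh yl yh wl wh bt lb (Ulist N [a, - b])"
    and "1 \<le> N" "0 \<le> d" "d * bn \<le> 100 * b"
    and "nonneg_check sq zq [padd [a, - b] (replicate N 0 @ [c])] hi psq lst" "N \<le> 11"
    and "4398046511104 \<le> yl' * hi'" "an \<le> bn"
    and "nonneg_check s' z' (bscale (- 1) (Mop K0 (Ulist N (replicate N 0 @ [- c])) [])) hi' ps' 0"
    and "nonneg_check s5' z5' (fifth_bound (Ulist N (replicate N 0 @ [- c]))) hi' ps5' 0"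
    and "of_int an / 100 \<le> x"
  shows "lower_estimate N c x"
proof (cases "x \<le> of_int bn / 100")
  case True
  then show ?thesis using assms(19) by (intro phase_lower_estimate[OF assms(1-14)]) auto
next
  case False
  let ?b = "of_int bn / 100 :: real"
  have b: "?b \<in> {of_int an / 100..?b}" "?b > 0" "150 \<le> bn" using assms(3,16) by auto
  have "partial_expansion N ?b - of_int c / 10080 * ln ?b ^ N / ?b ^ (N + 1) \<le> barrier K0 (Ulist N [a, - b]) ?b"
    by (intro barrier_linear assms(14) b phq_sound[OF assms(1-6,13) b(1)])
  then show ?thesis
    using False lower_phase(2)[OF assms(1-12) b(1)]
    by (intro lower_const[OF assms(2) b(3) assms(15,17,18,15,10,14)]) auto
qed

lemma poly_Pn: "n \<le> 10 \<Longrightarrow> poly (Pn n) y = ev (Qs ! n) y / 10080"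
  by (simp only: Pn_Qpoly poly_Qpoly)

lemma partial_expansion_2: "partial_expansion 2 x = 1 + (ln x - 1) / x + (ln x - 2) / x\<^sup>2"
proof -
  have "{1..2::nat} = {1, 2}" by auto
  then show ?thesis
    unfolding partial_expansion_def by (simp add: poly_Pn Qs_def diff_divide_distrib del: Pn.simps)
qed

lemma partial_expansion_3: "partial_expansion 3 x = 1 + (ln x - 1) / x + (ln x - 2) / x\<^sup>2 + (- 11 / 2 + 3 * ln x - (ln x)\<^sup>2 / 2) / x ^ 3"
proof -
  have "{1..3::nat} = {1, 2, 3}" by auto
  then show ?thesis
    unfolding partial_expansion_def
    by (simp add: poly_Pn Qs_def diff_divide_distrib add_divide_distrib power2_eq_square algebra_simps del: Pn.simps)
qed

section \<open>Certificates\<close>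

lemma ln_enclosure_150: "ln_enclosure 150 108841210 108841213" by code_simp
lemma ln_enclosure_170: "ln_enclosure 170 142439435 142439438" by code_simp
lemma ln_enclosure_234: "ln_enclosure 234 228210651 228210654" by code_simp
lemma ln_enclosure_300: "ln_enclosure 300 294906489 294906492" by code_simp
lemma ln_enclosure_332: "ln_enclosure 332 322113092 322113095" by code_simp
lemma ln_enclosure_433: "ln_enclosure 433 393410290 393410293" by code_simp
lemma ln_enclosure_536: "ln_enclosure 536 450693459 450693462" by code_simp
lemma ln_enclosure_639: "ln_enclosure 639 497876438 497876441" by code_simp
lemma ln_enclosure_743: "ln_enclosure 743 538354247 538354250" by code_simp
lemma ln_enclosure_846: "ln_enclosure 846 573203428 573203431" by code_simp
lemma ln_enclosure_950: "ln_enclosure 950 604326539 604326542" by code_simp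
lemma ln_enclosure_1053: "ln_enclosure 1053 631958353 631958356" by code_simp
lemma ln_enclosure_770: "ln_enclosure 770 547935908 547935911" by code_simp
lemma ln_enclosure_890: "ln_enclosure 890 586813670 586813673" by code_simp
lemma ln_enclosure_1000: "ln_enclosure 1000 618095478 618095481" by code_simp
lemma ln_enclosure_1115: "ln_enclosure 1115 647315860 647315863" by code_simp
lemma ln_enclosure_1230: "ln_enclosure 1230 673665421 673665424" by code_simp
lemma ln_enclosure_400: "ln_enclosure 400 372130557 372130560" by code_simp
lemma ln_enclosure_500: "ln_enclosure 500 432030198 432030201" by code_simp
lemma ln_enclosure_600: "ln_enclosure 600 480971769 480971772" by code_simp
lemma ln_enclosure_700: "ln_enclosure 700 522351277 522351280" by code_simp
lemma ln_enclosure_800: "ln_enclosure 800 558195837 558195840" by code_simp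
lemma ln_enclosure_900: "ln_enclosure 900 589812980 589812983" by code_simp
lemma ln_enclosure_1100: "ln_enclosure 1100 643680109 643680112" by code_simp

text \<open>\<open>40408\<close> is \<open>2 ^ 14 / ln (3 / 2)\<close> rounded up, and the pieces
  descend from it to \<open>0\<close>, that is, to unbounded \<open>x\<close>. The length
  \<open>N + 1\<close> of the \<open>replicate\<close> is the degree bound: the first nonzero row is
  a multiple of \<open>c * y ^ N - 10080 * P_N\<close>, of degree at most \<open>N\<close>.\<close>

lemma up_check_2:
  "nonneg_check 0 (replicate 3 0) (Mop 10080 (Ulist 2 (replicate 2 0 @ [227137])) []) 40408
    [(37511, 4625, 894), (33821, 4890, 992), (30124, 5175, 1113), (26465, 5464, 1267), (22893,
    5735, 1465), (19079, 5964, 1758), (15154, 6028, 2048), (9873, 6010, 2214), (1877, 5174, 3398),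
    (0, 24, 17876)] 0"
  by code_simp

lemma up_init_2:
  "init_up (- 634088355738) 150 402653184 402653185 108841210 108841213 178956970 178956971
    509501337 172019340 (Ulist 2 (replicate 2 0 @ [227137]))"
  by code_simp

text \<open>The case with the smallest starting point, done by hand: \<open>y\<close> is replaced by
  its lower bound \<open>81 / 200\<close>, which leaves a cubic in \<open>v\<close> on
  \<open>[0, 2/3]\<close>.\<close>

lemma fifth_bound_2:
  assumes "dom2 (of_int 150 / 100) b y v"
  shows "1 / 5 \<le> ev2 (Ulist 2 (replicate 2 0 @ [227137])) y v / 10080"
proof -
  have l: "81 / 200 \<le> ln (3 / 2 :: real)" using ln_enclosure_sound(1)[OF ln_enclosure_150] by simp
  have y: "ln (3 / 2) \<le> y" and v: "0 \<le> v" "v \<le> exp (- y)" using assms by (auto simp: dom2_def)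
  have "exp (- y) \<le> exp (- ln (3 / 2))" using y by simp
  also have "\<dots> = 2 / 3" by (simp add: exp_minus)
  finally have v2: "v \<le> 2 / 3" using v by simp
  have y4: "81 / 200 \<le> y" using l y by linarith
  have "(81 / 200)\<^sup>2 \<le> y\<^sup>2" using y4 by (intro power_mono) auto
  then have t3: "36 / 10 * v ^ 3 \<le> 227137 / 10080 * y\<^sup>2 * v ^ 3"
    using v by (intro mult_right_mono) (auto simp: power2_eq_square)
  have t1: "v * (- 6 / 10) \<le> v * (y - 1)" using y4 v by (intro mult_left_mono) auto
  have t2: "v\<^sup>2 * (- 16 / 10) \<le> v\<^sup>2 * (y - 2)" using y4 by (intro mult_left_mono) auto
  have "16 / 10 * v\<^sup>2 - 36 / 10 * v ^ 3 \<le> 4 / 10"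
  proof (cases "v \<le> 4 / 9")
    case True
    then have "v\<^sup>2 \<le> (4 / 9)\<^sup>2" using v by (intro power_mono) auto
    then have "v\<^sup>2 \<le> 16 / 81" by (simp add: power2_eq_square)
    moreover have "0 \<le> v ^ 3" using v by simp
    ultimately show ?thesis by linarith
  next
    case False
    then have "v\<^sup>2 * (4 / 9) \<le> v\<^sup>2 * v" by (intro mult_left_mono) auto
    then show ?thesis by (simp add: power3_eq_cube power2_eq_square)
  qed
  with t1 t2 t3 v2 have "1 / 5 \<le> 1 + v * (y - 1) + v\<^sup>2 * (y - 2) + 227137 / 10080 * y\<^sup>2 * v ^ 3" by linarith
  also have "\<dots> = ev2 (Ulist 2 (replicate 2 0 @ [227137])) y v / 10080"
    by (simp add: Ulist_def Qs_def numeral_2_eq_2 numeral_3_eq_3 field_simps)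
  finally show ?thesis .
qed

lemma upper_2: "of_int 150 / 100 \<le> x \<Longrightarrow> ali_ratio x \<le> partial_expansion 2 x + of_int 227137 / 10080 * ln x ^ 2 / x ^ (2 + 1)"
  by (rule upper_of_checks[OF ln_enclosure_150 _ _ up_check_2 fifth_bound_2 up_init_2]) simp_all

lemma constant_2: "of_int 227137 / 10080 \<le> 20 * (real 2 / (exp 1 * ln (real 2))) ^ 2"
  by (rule constant_bound[of _ 186065270 186065290 726818]) (use ln2_bounds in simp_all)

lemma up_check_3:
  "nonneg_check 0 (replicate 4 0) (Mop 10080 (Ulist 3 (replicate 3 0 @ [204369])) []) 19272
    [(16932, 6027, 1981), (14112, 6028, 2048), (10528, 5960, 2377), (4935, 5379, 3187), (0, 1967,
    6799)] 0"
  by code_simp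

lemma up5_check_3:
  "nonneg_check 0 (replicate 1 0) (fifth_bound (Ulist 3 (replicate 3 0 @ [204369]))) 19272 [(0, 6028,
    2048)] 0"
  by code_simp

lemma up_init_3:
  "init_up (- 634088355738) 234 628138967 628138968 228210651 228210654 114716006 114716007
    822969170 300730453 (Ulist 3 (replicate 3 0 @ [204369]))"
  by code_simp

lemma upper_3: "of_int 234 / 100 \<le> x \<Longrightarrow> ali_ratio x \<le> partial_expansion 3 x + of_int 204369 / 10080 * ln x ^ 3 / x ^ (3 + 1)"
  by (rule upper_of_checks[OF ln_enclosure_234 _ _ up_check_3 fifth_bound_of_check[OF up5_check_3 ln_enclosure_234] up_init_3]) simp_all

lemma constant_3: "of_int 204369 / 10080 \<le> 20 * (real 3 / (exp 1 * ln (real 3))) ^ 3"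
  by (rule constant_bound[of _ 294906489 294906492 1151979]) (use ln_enclosure_300 in simp_all)

lemma up_check_4:
  "nonneg_check 0 (replicate 5 0) (Mop 10080 (Ulist 4 (replicate 4 0 @ [255922])) []) 13654
    [(11127, 5924, 2457), (7986, 5535, 3015), (799, 4322, 4201), (0, 1, 41995)] 0"
  by code_simp

lemma up5_check_4:
  "nonneg_check 0 (replicate 1 0) (fifth_bound (Ulist 4 (replicate 4 0 @ [255922]))) 13654 [(0, 5924,
    2457)] 0"
  by code_simp

lemma up_init_4:
  "init_up (- 634088355738) 332 891205713 891205714 322113092 322113095 80854053 80854054
    1204694502 403021152 (Ulist 4 (replicate 4 0 @ [255922]))"
  by code_simp

lemma upper_4: "of_int 332 / 100 \<le> x \<Longrightarrow> ali_ratio x \<le> partial_expansion 4 x + of_int 255922 / 10080 * ln x ^ 4 / x ^ (4 + 1)"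
  by (rule upper_of_checks[OF ln_enclosure_332 _ _ up_check_4 fifth_bound_of_check[OF up5_check_4 ln_enclosure_332] up_init_4]) simp_all

lemma constant_4: "of_int 255922 / 10080 \<le> 20 * (real 4 / (exp 1 * ln (real 4))) ^ 4"
  by (rule constant_bound[of _ 372130557 372130560 1453635]) (use ln_enclosure_400 in simp_all)

lemma up_check_5:
  "nonneg_check 3 (replicate 6 0) (Mop 10080 (Ulist 5 (replicate 5 0 @ [393074])) []) 11180
    [(9111, 5547, 3001), (6254, 4881, 3682), (0, 3127, 5365)] 0"
  by code_simp

lemma up5_check_5:
  "nonneg_check 0 (replicate 1 0) (fifth_bound (Ulist 5 (replicate 5 0 @ [393074]))) 11180 [(0, 5547,
    3001)] 0"
  by code_simp

lemma up_init_5: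
  "init_up (- 634088355738) 433 1162325524 1162325525 393410290 393410293 61994331 61994332
    1567865692 473751010 (Ulist 5 (replicate 5 0 @ [393074]))"
  by code_simp

lemma upper_5: "of_int 433 / 100 \<le> x \<Longrightarrow> ali_ratio x \<le> partial_expansion 5 x + of_int 393074 / 10080 * ln x ^ 5 / x ^ (5 + 1)"
  by (rule upper_of_checks[OF ln_enclosure_433 _ _ up_check_5 fifth_bound_of_check[OF up5_check_5 ln_enclosure_433] up_init_5]) simp_all

lemma constant_5: "of_int 393074 / 10080 \<le> 20 * (real 5 / (exp 1 * ln (real 5))) ^ 5"
  by (rule constant_bound[of _ 432030198 432030201 1687618]) (use ln_enclosure_500 in simp_all)

lemma up_check_6:
  "nonneg_check 6 (replicate 7 0) (Mop 10080 (Ulist 6 (replicate 6 0 @ [704581])) []) 9759 [(8134,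
    5134, 3438), (5839, 4404, 4125), (0, 2780, 5746)] 0"
  by code_simp

lemma up5_check_6:
  "nonneg_check 0 (replicate 1 0) (fifth_bound (Ulist 6 (replicate 6 0 @ [704581]))) 9759 [(0, 5134, 3438)]
    0"
  by code_simp

lemma up_init_6:
  "init_up (- 634088355738) 536 1438814044 1438814045 450693459 450693462 50081241 50081242
    1913475397 527224938 (Ulist 6 (replicate 6 0 @ [704581]))"
  by code_simp

lemma upper_6: "of_int 536 / 100 \<le> x \<Longrightarrow> ali_ratio x \<le> partial_expansion 6 x + of_int 704581 / 10080 * ln x ^ 6 / x ^ (6 + 1)"
  by (rule upper_of_checks[OF ln_enclosure_536 _ _ up_check_6 fifth_bound_of_check[OF up5_check_6 ln_enclosure_536] up_init_6]) simp_all

lemma constant_6: "of_int 704581 / 10080 \<le> 20 * (real 6 / (exp 1 * ln (real 6))) ^ 6"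
  by (rule constant_bound[of _ 480971769 480971772 1878796]) (use ln_enclosure_600 in simp_all)

lemma up_check_7:
  "nonneg_check 9 (replicate 8 0) (Mop 10080 (Ulist 7 (replicate 7 0 @ [1432960])) []) 8834
    [(7644, 4757, 3798), (6074, 4120, 4389), (0, 2979, 5524)] 0"
  by code_simp

lemma up5_check_7:
  "nonneg_check 0 (replicate 1 0) (fifth_bound (Ulist 7 (replicate 7 0 @ [1432960]))) 8834 [(0, 4757,
    3798)] 0"
  by code_simp

lemma up_init_7:
  "init_up (- 634088355738) 639 1715302563 1715302564 497876438 497876441 42008678 42008679
    2242938697 569870140 (Ulist 7 (replicate 7 0 @ [1432960]))"
  by code_simp

lemma upper_7: "of_int 639 / 100 \<le> x \<Longrightarrow> ali_ratio x \<le> partial_expansion 7 x + of_int 1432960 / 10080 * ln x ^ 7 / x ^ (7 + 1)"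
  by (rule upper_of_checks[OF ln_enclosure_639 _ _ up_check_7 fifth_bound_of_check[OF up5_check_7 ln_enclosure_639] up_init_7]) simp_all

lemma constant_7: "of_int 1432960 / 10080 \<le> 20 * (real 7 / (exp 1 * ln (real 7))) ^ 7"
  by (rule constant_bound[of _ 522351277 522351280 2040435]) (use ln_enclosure_700 in simp_all)

lemma up_check_8:
  "nonneg_check 13 (replicate 9 0) (Mop 10080 (Ulist 8 (replicate 8 0 @ [3245331])) []) 8170
    [(7279, 4423, 4107), (6191, 3886, 4609), (2904, 3076, 5419), (0, 328, 11554)] 0"
  by code_simp

lemma up5_check_8:
  "nonneg_check 0 (replicate 1 0) (fifth_bound (Ulist 8 (replicate 8 0 @ [3245331]))) 8170 [(0, 4423,
    4107)] 0"
  by code_simp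

lemma up_init_8:
  "init_up (- 634088355738) 743 1994475438 1994475439 538354247 538354250 36128594 36128595
    2565175707 605904930 (Ulist 8 (replicate 8 0 @ [3245331]))"
  by code_simp

lemma upper_8: "of_int 743 / 100 \<le> x \<Longrightarrow> ali_ratio x \<le> partial_expansion 8 x + of_int 3245331 / 10080 * ln x ^ 8 / x ^ (8 + 1)"
  by (rule upper_of_checks[OF ln_enclosure_743 _ _ up_check_8 fifth_bound_of_check[OF up5_check_8 ln_enclosure_743] up_init_8]) simp_all

lemma constant_8: "of_int 3245331 / 10080 \<le> 20 * (real 8 / (exp 1 * ln (real 8))) ^ 8"
  by (rule constant_bound[of _ 558195837 558195840 2180453]) (use ln_enclosure_800 in simp_all)

lemma up_check_9:
  "nonneg_check 16 (replicate 10 0) (Mop 10080 (Ulist 9 (replicate 9 0 @ [8074786])) []) 7673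
    [(6997, 4136, 4373), (6150, 3691, 4795), (4223, 3041, 5456), (0, 1314, 7945)] 0"
  by code_simp

lemma up5_check_9:
  "nonneg_check 0 (replicate 1 0) (fifth_bound (Ulist 9 (replicate 9 0 @ [8074786]))) 7673 [(0, 4136,
    4373)] 0"
  by code_simp

lemma up_init_9:
  "init_up (- 634088355738) 846 2270963957 2270963958 573203428 573203431 31729959 31729960
    2877396106 636737098 (Ulist 9 (replicate 9 0 @ [8074786]))"
  by code_simp

lemma upper_9: "of_int 846 / 100 \<le> x \<Longrightarrow> ali_ratio x \<le> partial_expansion 9 x + of_int 8074786 / 10080 * ln x ^ 9 / x ^ (9 + 1)"
  by (rule upper_of_checks[OF ln_enclosure_846 _ _ up_check_9 fifth_bound_of_check[OF up5_check_9 ln_enclosure_846] up_init_9]) simp_all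

lemma constant_9: "of_int 8074786 / 10080 \<le> 20 * (real 9 / (exp 1 * ln (real 9))) ^ 9"
  by (rule constant_bound[of _ 589812980 589812983 2303957]) (use ln_enclosure_900 in simp_all)

lemma up_check_10:
  "nonneg_check 20 (replicate 11 0) (Mop 10080 (Ulist 10 (replicate 10 0 @ [21845757])) []) 7278
    [(6760, 3884, 4610), (6165, 3520, 4963), (5027, 3055, 5442), (0, 2053, 6674)] 0"
  by code_simp

lemma up5_check_10:
  "nonneg_check 0 (replicate 1 0) (fifth_bound (Ulist 10 (replicate 10 0 @ [21845757]))) 7278 [(0, 3884,
    4610)] 0"
  by code_simp

lemma up_init_10:
  "init_up (- 634088355738) 950 2550136832 2550136833 604326539 604326542 28256363 28256364
    3187717032 664230054 (Ulist 10 (replicate 10 0 @ [21845757]))"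
  by code_simp

lemma upper_10: "of_int 950 / 100 \<le> x \<Longrightarrow> ali_ratio x \<le> partial_expansion 10 x + of_int 21845757 / 10080 * ln x ^ 10 / x ^ (10 + 1)"
  by (rule upper_of_checks[OF ln_enclosure_950 _ _ up_check_10 fifth_bound_of_check[OF up5_check_10 ln_enclosure_950] up_init_10]) simp_all

lemma constant_10: "of_int 21845757 / 10080 \<le> 20 * (real 10 / (exp 1 * ln (real 10))) ^ 10"
  by (rule constant_bound[of _ 618095478 618095481 2414436]) (use ln_enclosure_1000 in simp_all)

lemma up_check_11:
  "nonneg_check 23 (replicate 12 0) (Mop 10080 (Ulist 11 (replicate 11 0 @ [63740684])) []) 6960
    [(6560, 3664, 4821), (6094, 3368, 5115), (5357, 2995, 5506), (2513, 2354, 6263), (0, 158,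
    13352)] 0"
  by code_simp

lemma up5_check_11:
  "nonneg_check 0 (replicate 1 0) (fifth_bound (Ulist 11 (replicate 11 0 @ [63740684]))) 6960 [(0, 3664,
    4821)] 0"
  by code_simp

lemma up_init_11:
  "init_up (- 634088355738) 1053 2826625351 2826625352 631958353 631958356 25492445 25492446
    3491420814 688658692 (Ulist 11 (replicate 11 0 @ [63740684]))"
  by code_simp

lemma upper_11: "of_int 1053 / 100 \<le> x \<Longrightarrow> ali_ratio x \<le> partial_expansion 11 x + of_int 63740684 / 10080 * ln x ^ 11 / x ^ (11 + 1)"
  by (rule upper_of_checks[OF ln_enclosure_1053 _ _ up_check_11 fifth_bound_of_check[OF up5_check_11 ln_enclosure_1053] up_init_11]) simp_all

lemma constant_11: "of_int 63740684 / 10080 \<le> 20 * (real 11 / (exp 1 * ln (real 11))) ^ 11"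
  by (rule constant_bound[of _ 643680109 643680112 2514376]) (use ln_enclosure_1100 in simp_all)

text \<open>The linear correction changes sign at \<open>ln x = 22884 / 9687\<close>, just to the
  right of \<open>x = 10.53\<close>. \<open>787560975609\<close> is
  \<open>100 * 9687000000000 / 1230\<close> rounded down, the largest integer \<open>d\<close> with
  \<open>d * bn \<le> 100 * b\<close> for the end \<open>x = 12.30\<close>; \<open>6528\<close> is
  \<open>2 ^ 14 / ln 12.30\<close> rounded down. The certificates for smaller \<open>N\<close>
  follow the same pattern.\<close>

lemma ph_check_11:
  "nonneg_check 26 (replicate 12 0) (bscale (- 1) (Mop 10080 (Ulist 11 [22884000000000, -
    9687000000000]) (replicate 11 [] @ [[- 787560975609], [9687000000000]]))) 6960 [(6922, 3664,
    4821), (6886, 3638, 4847), (6854, 3612, 4872), (6822, 3589, 4895), (6794, 3565, 4918), (6766,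
    3545, 4938), (6741, 3524, 4959), (6716, 3506, 4977), (6691, 3486, 4996), (6667, 3469, 5014),
    (6642, 3451, 5032), (6617, 3432, 5051), (6592, 3413, 5070), (6564, 3392, 5090), (6536, 3372,
    5111), (6528, 3350, 5133)] 6528"
  by code_simp

lemma ph5_check_11:
  "nonneg_check 0 (replicate 1 0) (fifth_bound (Ulist 11 [22884000000000, - 9687000000000])) 6960 [(6528,
    3664, 4821)] 6528"
  by code_simp

lemma phq_check_11:
  "nonneg_check 9 (replicate 12 0) ([padd [22884000000000, - 9687000000000] (replicate 11 0 @
    [63740684])]) 6960 [(6707, 3664, 4821), (6591, 3481, 5002), (6528, 3393, 5090)] 6528"
  by code_simp

lemma ph_init_11:
  "init_low (- 692692325498) 1053 2826625351 2826625352 631958353 631958356 25492445 25492446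
    3491411863 688658004 (Ulist 11 [22884000000000, - 9687000000000])"
  by code_simp

lemma low_check_11:
  "nonneg_check 23 (replicate 12 0) (bscale (- 1) (Mop 10080 (Ulist 11 (replicate 11 0 @ [-
    63740684])) [])) 6529 [(6500, 3344, 5139), (6449, 3322, 5162), (6359, 3282, 5203), (6187,
    3211, 5276), (5831, 3072, 5423), (4862, 2773, 5754), (0, 1900, 6901)] 0"
  by code_simp

lemma low5_check_11:
  "nonneg_check 0 (replicate 1 0) (fifth_bound (Ulist 11 (replicate 11 0 @ [- 63740684]))) 6529 [(0, 3344,
    5139)] 0"
  by code_simp

lemma lower_estimate_11: "of_int 1053 / 100 \<le> x \<Longrightarrow> lower_estimate 11 63740684 x"
  by (rule phase_const_lower_estimate[OF ln_enclosure_1053 ln_enclosure_1230 _ _ _ _ ph_check_11 ph5_check_11 ph_init_11 _ _ _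
      phq_check_11 _ _ _ low_check_11 low5_check_11]) simp_all

lemma ph_check_10:
  "nonneg_check 22 (replicate 11 0) (bscale (- 1) (Mop 10080 (Ulist 10 [1947800000000, -
    861900000000]) (replicate 10 [] @ [[- 77300448430], [861900000000]]))) 7278 [(7223, 3884,
    4610), (7175, 3847, 4645), (7132, 3815, 4676), (7095, 3786, 4704), (7059, 3759, 4729), (7023,
    3735, 4753), (6987, 3710, 4777), (6955, 3684, 4802), (6922, 3661, 4824), (6890, 3638, 4847),
    (6855, 3614, 4870), (6821, 3590, 4894), (6794, 3564, 4919)] 6794"
  by code_simp

lemma ph5_check_10:
  "nonneg_check 0 (replicate 1 0) (fifth_bound (Ulist 10 [1947800000000, - 861900000000])) 7278 [(6794,
    3884, 4610)] 6794"
  by code_simp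

lemma phq_check_10:
  "nonneg_check 5 (replicate 11 0) ([padd [1947800000000, - 861900000000] (replicate 10 0 @
    [21845757])]) 7278 [(6995, 3884, 4610), (6865, 3690, 4796), (6794, 3597, 4887)] 6794"
  by code_simp

lemma ph_init_10:
  "init_low (- 692692325498) 950 2550136832 2550136833 604326539 604326542 28256363 28256364
    3187689879 664227768 (Ulist 10 [1947800000000, - 861900000000])"
  by code_simp

lemma low_check_10:
  "nonneg_check 20 (replicate 11 0) (bscale (- 1) (Mop 10080 (Ulist 10 (replicate 10 0 @ [-
    21845757])) [])) 6795 [(6759, 3545, 4938), (6691, 3519, 4964), (6560, 3469, 5014), (6286,
    3368, 5115), (5671, 3153, 5337), (2962, 2635, 5916), (0, 359, 11328)] 0"
  by code_simp

lemma low5_check_10: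
  "nonneg_check 0 (replicate 1 0) (fifth_bound (Ulist 10 (replicate 10 0 @ [- 21845757]))) 6795 [(0, 3545,
    4938)] 0"
  by code_simp

lemma lower_estimate_10: "of_int 950 / 100 \<le> x \<Longrightarrow> lower_estimate 10 21845757 x"
  by (rule phase_const_lower_estimate[OF ln_enclosure_950 ln_enclosure_1115 _ _ _ _ ph_check_10 ph5_check_10 ph_init_10 _ _ _
      phq_check_10 _ _ _ low_check_10 low5_check_10]) simp_all

lemma ph_check_9:
  "nonneg_check 19 (replicate 10 0) (bscale (- 1) (Mop 10080 (Ulist 9 [179090000000, -
    83520000000]) (replicate 9 [] @ [[- 8352000000], [83520000000]]))) 7673 [(7601, 4136, 4373),
    (7538, 4093, 4414), (7484, 4053, 4451), (7433, 4019, 4483), (7388, 3986, 4514), (7341, 3957,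
    4541), (7298, 3927, 4570), (7255, 3898, 4597), (7215, 3868, 4625), (7170, 3842, 4650), (7126,
    3812, 4679), (7115, 3782, 4708)] 7115"
  by code_simp

lemma ph5_check_9:
  "nonneg_check 0 (replicate 1 0) (fifth_bound (Ulist 9 [179090000000, - 83520000000])) 7673 [(7115, 4136,
    4373)] 7115"
  by code_simp

lemma phq_check_9:
  "nonneg_check 2 (replicate 10 0) ([padd [179090000000, - 83520000000] (replicate 9 0 @
    [8074786])]) 7673 [(7346, 4136, 4373), (7196, 3930, 4567), (7115, 3830, 4662)] 7115"
  by code_simp

lemma ph_init_9:
  "init_low (- 692692325498) 846 2270963957 2270963958 573203428 573203431 31729959 31729960
    2877312056 636729258 (Ulist 9 [179090000000, - 83520000000])"
  by code_simp

lemma low_check_9: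
  "nonneg_check 16 (replicate 10 0) (bscale (- 1) (Mop 10080 (Ulist 9 (replicate 9 0 @ [-
    8074786])) [])) 7116 [(7071, 3774, 4715), (6982, 3743, 4745), (6793, 3681, 4805), (6358, 3544,
    4939), (5053, 3210, 5277), (0, 2076, 6640)] 0"
  by code_simp

lemma low5_check_9:
  "nonneg_check 0 (replicate 1 0) (fifth_bound (Ulist 9 (replicate 9 0 @ [- 8074786]))) 7116 [(0, 3774,
    4715)] 0"
  by code_simp

lemma lower_estimate_9: "of_int 846 / 100 \<le> x \<Longrightarrow> lower_estimate 9 8074786 x"
  by (rule phase_const_lower_estimate[OF ln_enclosure_846 ln_enclosure_1000 _ _ _ _ ph_check_9 ph5_check_9 ph_init_9 _ _ _
      phq_check_9 _ _ _ low_check_9 low5_check_9]) simp_all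

lemma ph_check_8:
  "nonneg_check 15 (replicate 9 0) (bscale (- 1) (Mop 10080 (Ulist 8 [17951000000, - 8909000000])
    (replicate 8 [] @ [[- 1001011235], [8909000000]]))) 8170 [(8082, 4423, 4107), (7998, 4376,
    4151), (7926, 4328, 4195), (7865, 4287, 4233), (7808, 4252, 4266), (7754, 4218, 4297), (7697,
    4186, 4327), (7643, 4152, 4359), (7593, 4118, 4390), (7542, 4087, 4419), (7494, 4055, 4449)]
    7494"
  by code_simp

lemma ph5_check_8:
  "nonneg_check 0 (replicate 1 0) (fifth_bound (Ulist 8 [17951000000, - 8909000000])) 8170 [(7494, 4423,
    4107)] 7494"
  by code_simp

lemma phq_check_8:
  "nonneg_check 0 (replicate 9 0) ([padd [17951000000, - 8909000000] (replicate 8 0 @ [3245331])])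
    8170 [(7773, 4423, 4107), (7592, 4198, 4316), (7494, 4087, 4419)] 7494"
  by code_simp

lemma ph_init_8:
  "init_low (- 692692325498) 743 1994475438 1994475439 538354247 538354250 36128594 36128595
    2564913682 605877510 (Ulist 8 [17951000000, - 8909000000])"
  by code_simp

lemma low_check_8:
  "nonneg_check 13 (replicate 9 0) (bscale (- 1) (Mop 10080 (Ulist 8 (replicate 8 0 @ [-
    3245331])) [])) 7495 [(7410, 4027, 4476), (7229, 3971, 4528), (6766, 3852, 4641), (5376, 3524,
    4959), (0, 2371, 6241)] 0"
  by code_simp

lemma low5_check_8:
  "nonneg_check 0 (replicate 1 0) (fifth_bound (Ulist 8 (replicate 8 0 @ [- 3245331]))) 7495 [(0, 4027,
    4476)] 0"
  by code_simp

lemma lower_estimate_8: "of_int 743 / 100 \<le> x \<Longrightarrow> lower_estimate 8 3245331 x"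
  by (rule phase_const_lower_estimate[OF ln_enclosure_743 ln_enclosure_890 _ _ _ _ ph_check_8 ph5_check_8 ph_init_8 _ _ _
      phq_check_8 _ _ _ low_check_8 low5_check_8]) simp_all

lemma ph_check_7:
  "nonneg_check 12 (replicate 8 0) (bscale (- 1) (Mop 10080 (Ulist 7 [2131000000, - 1137000000])
    (replicate 7 [] @ [[- 147662337], [1137000000]]))) 8834 [(8689, 4757, 3798), (8570, 4690,
    3861), (8461, 4631, 3915), (8365, 4578, 3965), (8282, 4527, 4011), (8195, 4484, 4051), (8116,
    4438, 4094), (8035, 4394, 4134), (8026, 4349, 4176)] 8026"
  by code_simp

lemma ph5_check_7:
  "nonneg_check 0 (replicate 1 0) (fifth_bound (Ulist 7 [2131000000, - 1137000000])) 8834 [(8026, 4757,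
    3798)] 8026"
  by code_simp

lemma phq_check_7:
  "nonneg_check 0 (replicate 8 0) ([padd [2131000000, - 1137000000] (replicate 7 0 @ [1432960])])
    8834 [(8305, 4757, 3798), (8103, 4496, 4040), (8026, 4389, 4140)] 8026"
  by code_simp

lemma ph_init_7:
  "init_low (- 692692325498) 639 1715302563 1715302564 497876438 497876441 42008678 42008679
    2242200014 569781721 (Ulist 7 [2131000000, - 1137000000])"
  by code_simp

lemma low_check_7:
  "nonneg_check 9 (replicate 8 0) (bscale (- 1) (Mop 10080 (Ulist 7 (replicate 7 0 @ [- 1432960]))
    [])) 8027 [(7946, 4344, 4180), (7751, 4300, 4222), (7254, 4183, 4329), (5764, 3869, 4625), (0,
    2715, 5821)] 0"
  by code_simp

lemma low5_check_7:
  "nonneg_check 0 (replicate 1 0) (fifth_bound (Ulist 7 (replicate 7 0 @ [- 1432960]))) 8027 [(0, 4344,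
    4180)] 0"
  by code_simp

lemma lower_estimate_7: "of_int 639 / 100 \<le> x \<Longrightarrow> lower_estimate 7 1432960 x"
  by (rule phase_const_lower_estimate[OF ln_enclosure_639 ln_enclosure_770 _ _ _ _ ph_check_7 ph5_check_7 ph_init_7 _ _ _
      phq_check_7 _ _ _ low_check_7 low5_check_7]) simp_all

lemma ph_check_6:
  "nonneg_check 9 (replicate 7 0) (bscale (- 1) (Mop 10080 (Ulist 6 [296500000, - 173800000])
    (replicate 6 [] @ [[- 27198748], [173800000]]))) 9759 [(9550, 5134, 3438), (9371, 5057, 3513),
    (9223, 4988, 3580), (9090, 4927, 3638), (8955, 4871, 3691), (8833, 4811, 3747)] 8833"
  by code_simp

lemma ph5_check_6:
  "nonneg_check 0 (replicate 1 0) (fifth_bound (Ulist 6 [296500000, - 173800000])) 9759 [(8833, 5134,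
    3438)] 8833"
  by code_simp

lemma phq_check_6:
  "nonneg_check 0 (replicate 7 0) ([padd [296500000, - 173800000] (replicate 6 0 @ [704581])])
    9759 [(9085, 5134, 3438), (8882, 4869, 3693), (8833, 4780, 3777)] 8833"
  by code_simp

lemma ph_init_6:
  "init_low (- 692692325498) 536 1438814044 1438814045 450693459 450693462 50081241 50081242
    1911342504 526925556 (Ulist 6 [296500000, - 173800000])"
  by code_simp

lemma chain_check_6:
  "nonneg_check 0 (replicate 7 0) ([padd (Qs ! 6) (replicate 6 0 @ [704581]), replicate (6 + 1) 0
    @ [- 1432960]]) 8834 [(8324, 4757, 3798), (5976, 4506, 4031), (0, 2897, 5614)] 0"
  by code_simp

lemma lower_estimate_chain_6: "of_int 639 / 100 \<le> x \<Longrightarrow> lower_estimate 6 704581 x"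
  by (rule lower_chain[OF ln_enclosure_639 _ _ chain_check_6]) (use lower_estimate_7 in simp_all)

lemma lower_estimate_phase_6: "x \<in> {of_int 536 / 100..of_int 639 / 100} \<Longrightarrow> lower_estimate 6 704581 x"
  by (rule phase_lower_estimate[OF ln_enclosure_536 ln_enclosure_639 _ _ _ _ ph_check_6 ph5_check_6 ph_init_6 _ _ _ phq_check_6])
    simp_all

lemma lower_estimate_6: "of_int 536 / 100 \<le> x \<Longrightarrow> lower_estimate 6 704581 x"
  using lower_estimate_phase_6[of x] lower_estimate_chain_6[of x] by (cases "x \<le> of_int 639 / 100") auto

lemma ph_check_5:
  "nonneg_check 5 (replicate 6 0) (bscale (- 1) (Mop 10080 (Ulist 5 [40780000, - 27100000])
    (replicate 5 [] @ [[- 5055970], [27100000]]))) 11180 [(10946, 5547, 3001), (10729, 5491,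
    3065), (10533, 5435, 3127), (10359, 5382, 3185), (10209, 5330, 3239), (10056, 5285, 3286),
    (9916, 5236, 3336), (9774, 5190, 3383), (9758, 5138, 3433)] 9758"
  by code_simp

lemma ph5_check_5:
  "nonneg_check 0 (replicate 1 0) (fifth_bound (Ulist 5 [40780000, - 27100000])) 11180 [(9758, 5547, 3001)]
    9758"
  by code_simp

lemma phq_check_5:
  "nonneg_check 0 (replicate 6 0) ([padd [40780000, - 27100000] (replicate 5 0 @ [393074])]) 11180
    [(10249, 5547, 3001), (9893, 5298, 3273), (9758, 5182, 3391)] 9758"
  by code_simp

lemma ph_init_5:
  "init_low (- 692692325498) 433 1162325524 1162325525 393410290 393410293 61994331 61994332
    1561635529 472682215 (Ulist 5 [40780000, - 27100000])"
  by code_simp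

lemma chain_check_5:
  "nonneg_check 0 (replicate 6 0) ([padd (Qs ! 5) (replicate 5 0 @ [393074]), replicate (5 + 1) 0
    @ [- 704581]]) 9759 [(7281, 5134, 3438), (0, 3886, 4608)] 0"
  by code_simp

lemma lower_estimate_chain_5: "of_int 536 / 100 \<le> x \<Longrightarrow> lower_estimate 5 393074 x"
  by (rule lower_chain[OF ln_enclosure_536 _ _ chain_check_5]) (use lower_estimate_6 in simp_all)

lemma lower_estimate_phase_5: "x \<in> {of_int 433 / 100..of_int 536 / 100} \<Longrightarrow> lower_estimate 5 393074 x"
  by (rule phase_lower_estimate[OF ln_enclosure_433 ln_enclosure_536 _ _ _ _ ph_check_5 ph5_check_5 ph_init_5 _ _ _ phq_check_5])
    simp_all

lemma lower_estimate_5: "of_int 433 / 100 \<le> x \<Longrightarrow> lower_estimate 5 393074 x"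
  using lower_estimate_phase_5[of x] lower_estimate_chain_5[of x] by (cases "x \<le> of_int 536 / 100") auto

lemma ph_check_4:
  "nonneg_check 3 (replicate 5 0) (bscale (- 1) (Mop 10080 (Ulist 4 [7143000, - 5599000])
    (replicate 4 [] @ [[- 1293071], [5599000]]))) 13654 [(13387, 5924, 2457), (13123, 5899, 2506),
    (12890, 5873, 2556), (12663, 5843, 2603), (12445, 5816, 2649), (12259, 5783, 2696), (12083,
    5755, 2737), (11901, 5728, 2776), (11739, 5695, 2819), (11584, 5665, 2858), (11431, 5635,
    2896), (11285, 5603, 2935), (11179, 5571, 2973)] 11179"
  by code_simp

lemma ph5_check_4:
  "nonneg_check 0 (replicate 1 0) (fifth_bound (Ulist 4 [7143000, - 5599000])) 13654 [(11179, 5924, 2457)]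
    11179"
  by code_simp

lemma phq_check_4:
  "nonneg_check 0 (replicate 5 0) ([padd [7143000, - 5599000] (replicate 4 0 @ [255922])]) 13654
    [(11851, 5924, 2457), (11308, 5686, 2831), (11179, 5576, 2967)] 11179"
  by code_simp

lemma ph_init_4:
  "init_low (- 692692325498) 332 891205713 891205714 322113092 322113095 80854053 80854054
    1197353176 401380321 (Ulist 4 [7143000, - 5599000])"
  by code_simp

lemma chain_check_4:
  "nonneg_check 0 (replicate 5 0) ([padd (Qs ! 4) (replicate 4 0 @ [255922]), replicate (4 + 1) 0
    @ [- 393074]]) 11180 [(0, 5547, 3001)] 0"
  by code_simp

lemma lower_estimate_chain_4: "of_int 433 / 100 \<le> x \<Longrightarrow> lower_estimate 4 255922 x"
  by (rule lower_chain[OF ln_enclosure_433 _ _ chain_check_4]) (use lower_estimate_5 in simp_all)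

lemma lower_estimate_phase_4: "x \<in> {of_int 332 / 100..of_int 433 / 100} \<Longrightarrow> lower_estimate 4 255922 x"
  by (rule phase_lower_estimate[OF ln_enclosure_332 ln_enclosure_433 _ _ _ _ ph_check_4 ph5_check_4 ph_init_4 _ _ _ phq_check_4])
    simp_all

lemma lower_estimate_4: "of_int 332 / 100 \<le> x \<Longrightarrow> lower_estimate 4 255922 x"
  using lower_estimate_phase_4[of x] lower_estimate_chain_4[of x] by (cases "x \<le> of_int 433 / 100") auto

section \<open>The lower estimates for N = 3 and N = 2\<close>

lemma chain_check_3:
  "nonneg_check 0 (replicate 4 0) ([padd (Qs ! 3) (replicate 3 0 @ [204369]), replicate (3 + 1) 0
    @ [- 255922]]) 13654 [(0, 5924, 2457)] 0"
  by code_simp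

lemma lower_estimate_chain_3: "of_int 332 / 100 \<le> x \<Longrightarrow> lower_estimate 3 204369 x"
  by (rule lower_chain[OF ln_enclosure_332 _ _ chain_check_3]) (use lower_estimate_4 in simp_all)

text \<open>\<open>8064 = 10080 * 4 / 5\<close> encodes the constant barrier, started at
  \<open>x = 2.34\<close>.\<close>

lemma const_init_3:
  "init_low (- 692692325498) 234 628138967 628138968 228210651 228210654 114716006 114716007
    796449980 291938009 [[8064]]"
  by code_simp

text \<open>For constant \<open>u = 4 / 5\<close> the barrier condition is
  \<open>4 / 5 - t / 5 - ln t \<le> ln (4 / 5)\<close>; it follows from
  \<open>ln t \<ge> 4 / 5\<close> and \<open>ln (4 / 5) \<ge> - 1 / 4\<close>.\<close>

lemma four_fifths_le_ali_ratio:
  assumes "of_int 234 / 100 \<le> x"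
  shows "4 / 5 \<le> ali_ratio x"
proof -
  let ?a = "of_int 234 / 100 :: real"
  have u: "barrier K0 [[8064]] = (\<lambda>_. 4 / 5)" by (simp add: barrier_def fun_eq_iff)
  have "defect (\<lambda>_. 4 / 5) x \<le> defect (\<lambda>_. 4 / 5) ?a"
  proof (rule defect_antimono[OF assms])
    fix t assume t: "t \<in> {?a..x}"
    show "((\<lambda>_. 4 / 5) has_real_derivative 0) (at t)" by simp
    have "4 / 5 \<le> ln ?a" using ln_enclosure_sound(1)[OF ln_enclosure_234] by simp
    also have "\<dots> \<le> ln t" using t by simp
    finally have l: "4 / 5 \<le> ln t" .
    have "ln (5 / 4 :: real) \<le> 5 / 4 - 1" by (rule ln_le_minus_one) simp
    moreover have "ln (5 / 4 :: real) = - ln (4 / 5)" by (simp add: ln_div)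
    ultimately have "- 1 / 4 \<le> ln (4 / 5 :: real)" by simp
    then show "4 / 5 + t * (4 / 5 - 1) + t * 0 - ln t \<le> ln (4 / 5)" using l t by simp
  qed simp_all
  also have "\<dots> \<le> Lconst"
    using init_low_sound[OF const_init_3 ln_enclosure_234 Lconst_bounds(2)] by (simp add: u)
  finally show ?thesis unfolding ali_ratio_def using assms by (intro ali_lower[of x "\<lambda>_. 4 / 5"]) auto
qed

lemma lower_estimate_3_initial:
  assumes "x \<in> {of_int 234 / 100..of_int 332 / 100}"
  shows "lower_estimate 3 204369 x"
proof -
  define y where "y = ln x"
  have x: "234 / 100 \<le> x" "x \<le> 332 / 100" using assms by auto
  have l: "85 / 100 \<le> ln (of_int 234 / 100 :: real)" "109 / 100 \<le> ln (of_int 300 / 100 :: real)"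
    "ln (of_int 300 / 100 :: real) \<le> 11 / 10" "ln (of_int 332 / 100 :: real) \<le> 6 / 5"
    using ln_enclosure_sound[OF ln_enclosure_234] ln_enclosure_sound[OF ln_enclosure_300] ln_enclosure_sound[OF ln_enclosure_332] by simp_all
  \<comment> \<open>The claim that the lower bound is at most \<open>4 / 5\<close>, multiplied by
    \<open>x ^ 4\<close>, with \<open>20\<close> in place of the slightly larger
    \<open>204369 / 10080\<close>. The terms are estimated separately by endpoint bounds; the cut at
    \<open>3\<close> keeps the loss within the margin.\<close>
  have "x ^ 4 / 5 + (y - 1) * x ^ 3 + (y - 2) * x\<^sup>2 + (- 11 / 2 + 3 * y - y\<^sup>2 / 2) * x \<le> 20 * y ^ 3"
  proof (cases "x \<le> 3")
    case True
    have "ln (of_int 234 / 100) \<le> y" "y \<le> ln (of_int 300 / 100)" using x True by (simp_all add: y_def)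
    then have y: "85 / 100 \<le> y" "y \<le> 11 / 10" using l by linarith+
    have "(85 / 100) ^ 3 \<le> y ^ 3" "(85 / 100)\<^sup>2 \<le> y\<^sup>2" using y by (auto intro!: power_mono)
    moreover have "x ^ 4 \<le> 3 ^ 4" using x True by (intro power_mono) auto
    moreover have "(y - 1) * x ^ 3 \<le> 1 / 10 * 3 ^ 3"
    proof -
      have "(y - 1) * x ^ 3 \<le> 1 / 10 * x ^ 3" using y x by (intro mult_right_mono) auto
      also have "\<dots> \<le> 1 / 10 * 3 ^ 3" using x True by (intro mult_left_mono power_mono) auto
      finally show ?thesis .
    qed
    moreover have "(y - 2) * x\<^sup>2 \<le> 0" using y by (intro mult_nonpos_nonneg) auto
    moreover have "(- 11 / 2 + 3 * y - y\<^sup>2 / 2) * x \<le> (- 11 / 2 + 3 * (11 / 10)) * (234 / 100)"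
    proof -
      have "(- 11 / 2 + 3 * y - y\<^sup>2 / 2) * x \<le> (- 11 / 2 + 3 * (11 / 10)) * x"
        using y x zero_le_power2[of y] by (intro mult_right_mono; linarith)
      also have "\<dots> \<le> (- 11 / 2 + 3 * (11 / 10)) * (234 / 100)" using x by (intro mult_left_mono_neg) auto
      finally show ?thesis .
    qed
    moreover have "(y - 2) * x\<^sup>2 \<le> (- 9 / 10) * (234 / 100)\<^sup>2"
    proof -
      have "(y - 2) * x\<^sup>2 \<le> (- 9 / 10) * x\<^sup>2" using y by (intro mult_right_mono) auto
      also have "\<dots> \<le> (- 9 / 10) * (234 / 100)\<^sup>2" using x by (intro mult_left_mono_neg power_mono) auto
      finally show ?thesis .
    qed
    ultimately show ?thesis by (simp add: power2_eq_square power3_eq_cube)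
  next
    case False
    have "ln (of_int 300 / 100) \<le> y" "y \<le> ln (of_int 332 / 100)" using x False by (simp_all add: y_def)
    then have y: "109 / 100 \<le> y" "y \<le> 6 / 5" using l by linarith+
    have "(109 / 100) ^ 3 \<le> y ^ 3" "(109 / 100)\<^sup>2 \<le> y\<^sup>2" using y by (auto intro!: power_mono)
    moreover have "x ^ 4 \<le> (332 / 100) ^ 4" using x by (intro power_mono) auto
    moreover have "(y - 1) * x ^ 3 \<le> 1 / 5 * (332 / 100) ^ 3"
    proof -
      have "(y - 1) * x ^ 3 \<le> 1 / 5 * x ^ 3" using y x by (intro mult_right_mono) auto
      also have "\<dots> \<le> 1 / 5 * (332 / 100) ^ 3" using x by (intro mult_left_mono power_mono) auto
      finally show ?thesis .
    qed
    moreover have "(- 11 / 2 + 3 * y - y\<^sup>2 / 2) * x \<le> (- 11 / 2 + 3 * (6 / 5)) * 3"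
    proof -
      have "(- 11 / 2 + 3 * y - y\<^sup>2 / 2) * x \<le> (- 11 / 2 + 3 * (6 / 5)) * x"
        using y x zero_le_power2[of y] by (intro mult_right_mono; linarith)
      also have "\<dots> \<le> (- 11 / 2 + 3 * (6 / 5)) * 3" using False by (intro mult_left_mono_neg) auto
      finally show ?thesis .
    qed
    moreover have "(y - 2) * x\<^sup>2 \<le> (- 4 / 5) * 3\<^sup>2"
    proof -
      have "(y - 2) * x\<^sup>2 \<le> (- 4 / 5) * x\<^sup>2" using y by (intro mult_right_mono) auto
      also have "\<dots> \<le> (- 4 / 5) * 3\<^sup>2" using False by (intro mult_left_mono_neg power_mono) auto
      finally show ?thesis .
    qed
    ultimately show ?thesis by (simp add: power2_eq_square power3_eq_cube power4_eq_xxxx)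
  qed
  moreover have "0 \<le> y ^ 3" using x by (simp add: y_def)
  ultimately have le: "x ^ 4 / 5 + (y - 1) * x ^ 3 + (y - 2) * x\<^sup>2 + (- 11 / 2 + 3 * y - y\<^sup>2 / 2) * x
      \<le> of_int 204369 / 10080 * y ^ 3"
    unfolding of_int_numeral by linarith
  have frac: "1 + p / x + q / x\<^sup>2 + r / x ^ 3 - s / x ^ (3 + 1) - 4 / 5
      = (x ^ 4 / 5 + p * x ^ 3 + q * x\<^sup>2 + r * x - s) / x ^ 4" for p q r s
    using x by (simp add: field_simps eval_nat_numeral)
  have "partial_expansion 3 x - of_int 204369 / 10080 * ln x ^ 3 / x ^ (3 + 1) - 4 / 5 \<le> 0"
    unfolding partial_expansion_3 frac y_def[symmetric] using le x by (intro divide_nonpos_pos) simp_all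
  then have "partial_expansion 3 x - of_int 204369 / 10080 * ln x ^ 3 / x ^ (3 + 1) \<le> 4 / 5" by linarith
  also have "\<dots> \<le> ali_ratio x" using x by (intro four_fifths_le_ali_ratio) simp
  finally show ?thesis by (simp add: lower_estimate_def)
qed

lemma lower_estimate_3: "of_int 234 / 100 \<le> x \<Longrightarrow> lower_estimate 3 204369 x"
  using lower_estimate_3_initial[of x] lower_estimate_chain_3[of x] by (cases "x \<le> of_int 332 / 100") auto

lemma chain_check_2:
  "nonneg_check 0 (replicate 3 0) ([padd (Qs ! 2) (replicate 2 0 @ [227137]), replicate (2 + 1) 0
    @ [- 204369]]) 19272 [(0, 6028, 2048)] 0"
  by code_simp

lemma lower_estimate_chain_2: "of_int 234 / 100 \<le> x \<Longrightarrow> lower_estimate 2 227137 x"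
  by (rule lower_chain[OF ln_enclosure_234 _ _ chain_check_2]) (use lower_estimate_3 in simp_all)

lemma lower_estimate_2_initial:
  assumes "x \<in> {of_int 150 / 100..of_int 234 / 100}"
  shows "lower_estimate 2 227137 x"
proof -
  define y where "y = ln x"
  have x: "3 / 2 \<le> x" "x \<le> 234 / 100" using assms by auto
  have l: "405 / 1000 \<le> ln (of_int 150 / 100 :: real)" "530 / 1000 \<le> ln (of_int 170 / 100 :: real)"
    "693 / 1000 \<le> ln (of_int 200 / 100 :: real)" "ln (of_int 234 / 100 :: real) \<le> 851 / 1000"
    using ln_enclosure_sound[OF ln_enclosure_150] ln_enclosure_sound[OF ln_enclosure_170] ln_enclosure_sound[OF ln2_bounds] ln_enclosure_sound[OF ln_enclosure_234]
    by simp_all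
  have "y \<le> ln (of_int 234 / 100)" using x by (simp add: y_def)
  then have y1: "y \<le> 851 / 1000" using l by linarith
  \<comment> \<open>On a subinterval the cube is taken at the right end and the two negative terms
    at the left end, with \<open>y \<le> 0.851\<close> in their coefficients. The cuts at
    \<open>1.7\<close> and \<open>2\<close> make the resulting numerical condition true.\<close>
  have bound: "x ^ 3 + (y - 1) * x\<^sup>2 + (y - 2) * x \<le> 22 * y\<^sup>2"
    if "of_int n / 100 \<le> x" "x \<le> of_int m / 100" "0 < n" "0 \<le> r" "r \<le> ln (of_int n / 100)"
      "(of_int m / 100) ^ 3 - 149 / 1000 * (of_int n / 100)\<^sup>2 - 1149 / 1000 * (of_int n / 100) \<le> 22 * r\<^sup>2"
    for n m :: int and r :: real
  proof -
    have "ln (of_int n / 100) \<le> y" using that x by (simp add: y_def)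
    then have "r\<^sup>2 \<le> y\<^sup>2" using that by (intro power_mono) auto
    moreover have "x ^ 3 \<le> (of_int m / 100) ^ 3" using that x by (intro power_mono) auto
    moreover have "(y - 1) * x\<^sup>2 \<le> (- 149 / 1000) * (of_int n / 100)\<^sup>2"
    proof -
      have "(y - 1) * x\<^sup>2 \<le> (- 149 / 1000) * x\<^sup>2" using y1 by (intro mult_right_mono) auto
      also have "\<dots> \<le> (- 149 / 1000) * (of_int n / 100)\<^sup>2" using that by (intro mult_left_mono_neg power_mono) auto
      finally show ?thesis .
    qed
    moreover have "(y - 2) * x \<le> (- 1149 / 1000) * (of_int n / 100)"
    proof -
      have "(y - 2) * x \<le> (- 1149 / 1000) * x" using y1 x by (intro mult_right_mono) auto
      also have "\<dots> \<le> (- 1149 / 1000) * (of_int n / 100)" using that by (intro mult_left_mono_neg) auto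
      finally show ?thesis .
    qed
    ultimately show ?thesis using that(6) by linarith
  qed
  consider "x \<le> of_int 170 / 100" | "of_int 170 / 100 \<le> x" "x \<le> of_int 200 / 100" | "of_int 200 / 100 \<le> x"
    by linarith
  then have "x ^ 3 + (y - 1) * x\<^sup>2 + (y - 2) * x \<le> 22 * y\<^sup>2"
  proof cases
    case 1
    then show ?thesis using x l by (intro bound[of 150 170 "405 / 1000"]) (auto simp: power2_eq_square power3_eq_cube)
  next
    case 2
    then show ?thesis using x l by (intro bound[of 170 200 "530 / 1000"]) (auto simp: power2_eq_square power3_eq_cube)
  next
    case 3
    then show ?thesis using x l by (intro bound[of 200 234 "693 / 1000"]) (auto simp: power2_eq_square power3_eq_cube)
  qed
  moreover have "0 \<le> y\<^sup>2" by simp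
  ultimately have le: "x ^ 3 + (y - 1) * x\<^sup>2 + (y - 2) * x \<le> of_int 227137 / 10080 * y\<^sup>2"
    unfolding of_int_numeral by linarith
  have frac: "1 + p / x + q / x\<^sup>2 - s / x ^ (2 + 1) = (x ^ 3 + p * x\<^sup>2 + q * x - s) / x ^ 3" for p q s
    using x by (simp add: field_simps eval_nat_numeral)
  have "partial_expansion 2 x - of_int 227137 / 10080 * ln x ^ 2 / x ^ (2 + 1) \<le> 0"
    unfolding partial_expansion_2 frac y_def[symmetric] using le x by (intro divide_nonpos_pos) simp_all
  also have "0 \<le> ali_ratio x" unfolding ali_ratio_def using x ali_pos[of "exp x"] by simp
  finally show ?thesis by (simp add: lower_estimate_def)
qed

lemma lower_estimate_2: "of_int 150 / 100 \<le> x \<Longrightarrow> lower_estimate 2 227137 x"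
  using lower_estimate_2_initial[of x] lower_estimate_chain_2[of x] by (cases "x \<le> of_int 234 / 100") auto

lemma expansion_bound_2: assumes "zN 2 < x" shows "expansion_bound 2 x"
proof -
  have x: "of_int 150 / 100 \<le> x" using assms by (simp add: zN_def)
  show ?thesis by (rule theta_exists[OF upper_2[OF x] lower_estimate_2[OF x] constant_2]) (use x in simp_all)
qed

lemma expansion_bound_3: assumes "zN 3 < x" shows "expansion_bound 3 x"
proof -
  have x: "of_int 234 / 100 \<le> x" using assms by (simp add: zN_def)
  show ?thesis by (rule theta_exists[OF upper_3[OF x] lower_estimate_3[OF x] constant_3]) (use x in simp_all)
qed

lemma expansion_bound_4: assumes "zN 4 < x" shows "expansion_bound 4 x"
proof -
  have x: "of_int 332 / 100 \<le> x" using assms by (simp add: zN_def)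
  show ?thesis by (rule theta_exists[OF upper_4[OF x] lower_estimate_4[OF x] constant_4]) (use x in simp_all)
qed

lemma expansion_bound_5: assumes "zN 5 < x" shows "expansion_bound 5 x"
proof -
  have x: "of_int 433 / 100 \<le> x" using assms by (simp add: zN_def)
  show ?thesis by (rule theta_exists[OF upper_5[OF x] lower_estimate_5[OF x] constant_5]) (use x in simp_all)
qed

lemma expansion_bound_6: assumes "zN 6 < x" shows "expansion_bound 6 x"
proof -
  have x: "of_int 536 / 100 \<le> x" using assms by (simp add: zN_def)
  show ?thesis by (rule theta_exists[OF upper_6[OF x] lower_estimate_6[OF x] constant_6]) (use x in simp_all)
qed

lemma expansion_bound_7: assumes "zN 7 < x" shows "expansion_bound 7 x"
proof -
  have x: "of_int 639 / 100 \<le> x" using assms by (simp add: zN_def)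
  show ?thesis by (rule theta_exists[OF upper_7[OF x] lower_estimate_7[OF x] constant_7]) (use x in simp_all)
qed

lemma expansion_bound_8: assumes "zN 8 < x" shows "expansion_bound 8 x"
proof -
  have x: "of_int 743 / 100 \<le> x" using assms by (simp add: zN_def)
  show ?thesis by (rule theta_exists[OF upper_8[OF x] lower_estimate_8[OF x] constant_8]) (use x in simp_all)
qed

lemma expansion_bound_9: assumes "zN 9 < x" shows "expansion_bound 9 x"
proof -
  have x: "of_int 846 / 100 \<le> x" using assms by (simp add: zN_def)
  show ?thesis by (rule theta_exists[OF upper_9[OF x] lower_estimate_9[OF x] constant_9]) (use x in simp_all)
qed

lemma expansion_bound_10: assumes "zN 10 < x" shows "expansion_bound 10 x"
proof -
  have x: "of_int 950 / 100 \<le> x" using assms by (simp add: zN_def)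
  show ?thesis by (rule theta_exists[OF upper_10[OF x] lower_estimate_10[OF x] constant_10]) (use x in simp_all)
qed

lemma expansion_bound_11: assumes "zN 11 < x" shows "expansion_bound 11 x"
proof -
  have x: "of_int 1053 / 100 \<le> x" using assms by (simp add: zN_def)
  show ?thesis by (rule theta_exists[OF upper_11[OF x] lower_estimate_11[OF x] constant_11]) (use x in simp_all)
qed

theorem theorem5p17:
  fixes N :: nat and x :: real
  assumes "2 \<le> N" and "N \<le> 11" and "x > zN N"
  shows "\<exists>\<theta>::real. \<bar>\<theta>\<bar> \<le> 1 \<and>
    ali (exp x) / (x * exp x) =
      1 + (\<Sum>n=1..N. poly (Pn (n - 1)) (ln x) / x ^ n)
        + \<theta> * 20 * (real N / (exp 1 * ln (real N))) ^ N * (ln x) ^ N / x ^ (N + 1)"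
proof -
  have "N \<in> {2, 3, 4, 5, 6, 7, 8, 9, 10, 11}" using assms(1,2) by simp presburger
  then have "expansion_bound N x"
    using assms(3) expansion_bound_2 expansion_bound_3 expansion_bound_4 expansion_bound_5 expansion_bound_6 expansion_bound_7 expansion_bound_8 expansion_bound_9 expansion_bound_10 expansion_bound_11
    by blast
  then show ?thesis unfolding expansion_bound_def .
qed

end
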